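(* Let $\mathsf{S}$ be a pseudo-tensor category over a field $\mathbf{k}$ with grading shift functor $X\mapsto X\langle i\rangle$ and with a set $\mathbb{W}$ and family $\{B_x\mid x\in\mathbb{W}\}$ of indecomposable objects satisfying conditions (i) and (ii) of the context. Then the following hold. P2. If $d\in\mathcal{D}$ and $B_d\langle\mathsf{a}(d)\rangle$ is a direct summand of $B_y\otimes B_z$, then $y={}^\ast z$. P3. For each $z\in\mathbb{W}$ there is a unique $d\in\mathcal{D}$ such that $B_d\langle\mathsf{a}(d)\rangle$ is a direct summand of ${}^\ast B_z\otimes B_z$. P5. If $d\in\mathcal{D}$, then the multiplicity of $B_d\langle\mathsf{a}(d)\rangle$ in ${}^\ast B_z\otimes B_z$ is at most $1$ (for each $z\in\mathbb{W}$). Moreover, $\dim_{\mathbf{k}}\mathrm{Hom}(\mathbf{1},B_d\langle\mathsf{a}(d)\rangle)=1$. P13. Any left cell $\Gamma$ (resp. right cell $\mathrm{P}$) contains a unique $d\in\mathcal{D}$, and $B_d\langle\mathsf{a}(d)\rangle$ is a direct summand of ${}^\ast B_z\otimes B_z$ for each $z\in\Gamma$ (resp. of $B_y\otimes B_y^\ast$ for each $y\in\mathrm{P}$). P13'. For a right cell $\mathrm{P}$, the coevaluation $\mathrm{co}_{B_y}:\mathbf{1}\to B_y\otimes B_y^\ast$, for each $y\in\mathrm{P}$, factors through the direct summand $B_d\langle\mathsf{a}(d)\rangle$ of $B_y\otimes B_y^\ast$, where $\mathrm{P}\cap\mathcal{D}=\{d\}$.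
   Context: A pseudo-tensor category over $\mathbf{k}$ is an essentially small $\mathbf{k}$-linear monoidal category $(\mathsf{S},\otimes,\mathbf{1})$ that is additive, idempotent complete, has finite-dimensional morphism spaces, satisfies $\mathbf{k}\xrightarrow{\sim}\mathrm{End}(\mathbf{1})$, and in which every object $X$ has a left dual $X^\ast$ (with $\mathrm{ev}_X:X^\ast\otimes X\to\mathbf{1}$, $\mathrm{co}_X:\mathbf{1}\to X\otimes X^\ast$ satisfying the usual identities) and a right dual ${}^\ast X$ (so that $X$ is a left dual of ${}^\ast X$). Grading shift functor: an auto-equivalence $F:\mathsf{S}\to\mathsf{S}$ of $\mathsf{S}$ as a bimodule category over itself; write $X\langle i\rangle=F^i(X)$, $i\in\mathbb{Z}$. Conditions: (i) $\{B_x\mid x\in\mathbb{W}\}$ is a family of indecomposable objects closed (up to isomorphism) under taking duals, such that for every indecomposable $X\in\mathsf{S}$ there is precisely one pair $(x,i)\in\mathbb{W}\times\mathbb{Z}$ with $X\simeq B_x\langle i\rangle$; (ii) for all $x,y\in\mathbb{W}$ and $i\le0$, $\dim_{\mathbf{k}}\mathrm{Hom}(B_x,B_y\langle i\rangle)=\delta_{x,y}\delta_{i,0}$. For $x\in\mathbb{W}$, $x^\ast,{}^\ast x\in\mathbb{W}$ are defined by $B_x^\ast\simeq B_{x^\ast}$ and ${}^\ast B_x\simeq B_{{}^\ast x}$. Define $\mathsf{a}(x)=\sup\{i\in\mathbb{Z}\mid B_x\langle i\rangle\text{ is a direct summand of }B_y\otimes B_z\text{ for some }y,z\in\mathbb{W}\}\in\mathbb{Z}\cup\{\infty\}$,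 $\Delta(x)=\min\{i\in\mathbb{N}\mid\mathrm{Hom}(\mathbf{1},B_x\langle i\rangle)\neq0\}\in\mathbb{N}\cup\{\infty\}$ (with $\min\varnothing=\infty$), and $\mathcal{D}=\{x\in\mathbb{W}\mid\mathsf{a}(x)=\Delta(x)<\infty\}$. Write $x\preceq_L y$ if $B_y$ is a direct summand of $Y\otimes B_x$ for some $Y\in\mathsf{S}$, and $x\preceq_R y$ if $B_y$ is a direct summand of $B_x\otimes Y$ for some $Y\in\mathsf{S}$. Left (resp. right) cells are the equivalence classes in $\mathbb{W}$ of the equivalence relation associated with $\preceq_L$ (resp. $\preceq_R$). *)

theory Defs
  imports Complex_Main "HOL-Library.Extended_Real"
begin

section \<open>Linear categories\<close>

text \<open>
  All Hom spaces of a \<open>k\<close>-linear category are subspaces of one ambient \<open>k\<close>-vector space, the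
  type \<open>'m\<close>, so the vector space notions of the library (subspace, span, dim) apply to them.
  This loses no generality: for a small category take \<open>'m\<close> to be the direct sum of all Hom
  spaces, to which composition, tensor product and linear functors extend (bi)linearly.
  Operations on morphisms are only constrained, and only meaningful, on composable arguments.
  Objects form a set, so smallness is built in.
\<close>

record ('o, 'm, 'k) lincat =
  obj :: "'o set"
  hom :: "'o \<Rightarrow> 'o \<Rightarrow> 'm set"
  idm :: "'o \<Rightarrow> 'm"
  cmp :: "'m \<Rightarrow> 'm \<Rightarrow> 'm" (infixr "\<cdot>\<index>" 70)
  scl :: "'k \<Rightarrow> 'm \<Rightarrow> 'm"

locale linear_category =
  fixes S :: "('o, 'm::ab_group_add, 'k::field, 'z) lincat_scheme" (structure)
  assumes ambient_vector_space: "vector_space (scl S)"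
    and hom_subspace: "\<lbrakk>X \<in> obj S; Y \<in> obj S\<rbrakk> \<Longrightarrow> module.subspace (scl S) (hom S X Y)"
    and idm_in_hom: "X \<in> obj S \<Longrightarrow> idm S X \<in> hom S X X"
    and cmp_in_hom:
      "\<lbrakk>X \<in> obj S; Y \<in> obj S; Z \<in> obj S; f \<in> hom S X Y; g \<in> hom S Y Z\<rbrakk> \<Longrightarrow> g \<cdot> f \<in> hom S X Z"
    and cmp_idm: "\<lbrakk>X \<in> obj S; Y \<in> obj S; f \<in> hom S X Y\<rbrakk> \<Longrightarrow> f \<cdot> idm S X = f"
    and idm_cmp: "\<lbrakk>X \<in> obj S; Y \<in> obj S; f \<in> hom S X Y\<rbrakk> \<Longrightarrow> idm S Y \<cdot> f = f"
    and cmp_assoc: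
      "\<lbrakk>W \<in> obj S; X \<in> obj S; Y \<in> obj S; Z \<in> obj S;
        f \<in> hom S W X; g \<in> hom S X Y; h \<in> hom S Y Z\<rbrakk> \<Longrightarrow> (h \<cdot> g) \<cdot> f = h \<cdot> (g \<cdot> f)"
    and cmp_add_left:
      "\<lbrakk>X \<in> obj S; Y \<in> obj S; Z \<in> obj S; f \<in> hom S X Y; g \<in> hom S Y Z; g' \<in> hom S Y Z\<rbrakk>
        \<Longrightarrow> (g + g') \<cdot> f = g \<cdot> f + g' \<cdot> f"
    and cmp_add_right:
      "\<lbrakk>X \<in> obj S; Y \<in> obj S; Z \<in> obj S; f \<in> hom S X Y; f' \<in> hom S X Y; g \<in> hom S Y Z\<rbrakk>
        \<Longrightarrow> g \<cdot> (f + f') = g \<cdot> f + g \<cdot> f'"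
    and cmp_scl_left:
      "\<lbrakk>X \<in> obj S; Y \<in> obj S; Z \<in> obj S; f \<in> hom S X Y; g \<in> hom S Y Z\<rbrakk>
        \<Longrightarrow> scl S c g \<cdot> f = scl S c (g \<cdot> f)"
    and cmp_scl_right:
      "\<lbrakk>X \<in> obj S; Y \<in> obj S; Z \<in> obj S; f \<in> hom S X Y; g \<in> hom S Y Z\<rbrakk>
        \<Longrightarrow> g \<cdot> scl S c f = scl S c (g \<cdot> f)"

definition hom_dim :: "('o, 'm::ab_group_add, 'k::field, 'z) lincat_scheme \<Rightarrow> 'o \<Rightarrow> 'o \<Rightarrow> nat" where
  "hom_dim S X Y = vector_space.dim (scl S) (hom S X Y)"

definition inverse_pair :: "('o, 'm, 'k, 'z) lincat_scheme \<Rightarrow> 'o \<Rightarrow> 'o \<Rightarrow> 'm \<Rightarrow> 'm \<Rightarrow> bool" where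
  "inverse_pair S X Y f g \<longleftrightarrow>
     f \<in> hom S X Y \<and> g \<in> hom S Y X \<and> g \<cdot>\<^bsub>S\<^esub> f = idm S X \<and> f \<cdot>\<^bsub>S\<^esub> g = idm S Y"

definition is_iso :: "('o, 'm, 'k, 'z) lincat_scheme \<Rightarrow> 'o \<Rightarrow> 'o \<Rightarrow> 'm \<Rightarrow> bool" where
  "is_iso S X Y f \<longleftrightarrow> (\<exists>g. inverse_pair S X Y f g)"

definition inv_mor :: "('o, 'm, 'k, 'z) lincat_scheme \<Rightarrow> 'o \<Rightarrow> 'o \<Rightarrow> 'm \<Rightarrow> 'm" where
  "inv_mor S X Y f = (THE g. inverse_pair S X Y f g)"

definition isomorphic :: "('o, 'm, 'k, 'z) lincat_scheme \<Rightarrow> 'o \<Rightarrow> 'o \<Rightarrow> bool" where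
  "isomorphic S X Y \<longleftrightarrow> (\<exists>f. is_iso S X Y f)"

text \<open>
  \<open>Y\<close> is the direct sum (biproduct) of the finite list \<open>Xs\<close>, with inclusions \<open>i\<close> and
  projections \<open>p\<close>; for \<open>Xs = []\<close> this says that \<open>Y\<close> is a zero object.
\<close>

definition direct_sum ::
  "('o, 'm::ab_group_add, 'k, 'z) lincat_scheme \<Rightarrow> 'o \<Rightarrow> 'o list \<Rightarrow> (nat \<Rightarrow> 'm) \<Rightarrow> (nat \<Rightarrow> 'm) \<Rightarrow> bool"
  where
  "direct_sum S Y Xs i p \<longleftrightarrow>
     Y \<in> obj S \<and> set Xs \<subseteq> obj S \<and>
     (\<forall>a < length Xs. i a \<in> hom S (Xs ! a) Y \<and> p a \<in> hom S Y (Xs ! a)) \<and>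
     (\<forall>a < length Xs. \<forall>b < length Xs. p a \<cdot>\<^bsub>S\<^esub> i b = (if a = b then idm S (Xs ! a) else 0)) \<and>
     (\<Sum>a < length Xs. i a \<cdot>\<^bsub>S\<^esub> p a) = idm S Y"

definition zero_obj :: "('o, 'm::ab_group_add, 'k, 'z) lincat_scheme \<Rightarrow> 'o \<Rightarrow> bool" where
  "zero_obj S X \<longleftrightarrow> X \<in> obj S \<and> idm S X = 0"

definition is_summand :: "('o, 'm::ab_group_add, 'k, 'z) lincat_scheme \<Rightarrow> 'o \<Rightarrow> 'o \<Rightarrow> bool" where
  "is_summand S X Y \<longleftrightarrow> (\<exists>C i p. direct_sum S Y [X, C] i p)"

definition indecomposable :: "('o, 'm::ab_group_add, 'k, 'z) lincat_scheme \<Rightarrow> 'o \<Rightarrow> bool" where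
  "indecomposable S X \<longleftrightarrow> X \<in> obj S \<and> \<not> zero_obj S X \<and>
     (\<forall>A C i p. direct_sum S X [A, C] i p \<longrightarrow> zero_obj S A \<or> zero_obj S C)"

text \<open>
  The multiplicity of \<open>X\<close> in \<open>Y\<close> is the number of summands isomorphic to \<open>X\<close> in a decomposition
  of \<open>Y\<close> into indecomposables; by Krull--Schmidt it does not depend on the decomposition.
\<close>

definition summand_multiplicity :: "('o, 'm::ab_group_add, 'k, 'z) lincat_scheme \<Rightarrow> 'o \<Rightarrow> 'o \<Rightarrow> nat" where
  "summand_multiplicity S X Y = (THE n. \<exists>Xs i p. direct_sum S Y Xs i p \<and> (\<forall>Z \<in> set Xs. indecomposable S Z) \<and>
     n = length (filter (\<lambda>Z. isomorphic S Z X) Xs))"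


section \<open>Pseudo-tensor categories\<close>

text \<open>
  The duals are part of the data: \<open>ldual X\<close> (with \<open>ev X\<close> and \<open>co X\<close>) and \<open>rdual X\<close> are an
  arbitrary choice of a left dual and a right dual of \<open>X\<close>.
\<close>

record ('o, 'm, 'k) moncat = "('o, 'm, 'k) lincat" +
  ten :: "'o \<Rightarrow> 'o \<Rightarrow> 'o" (infixr "\<odot>\<index>" 75)
  tenm :: "'m \<Rightarrow> 'm \<Rightarrow> 'm" (infixr "\<otimes>\<index>" 75)
  unit_obj :: 'o ("\<one>\<index>")
  assoc :: "'o \<Rightarrow> 'o \<Rightarrow> 'o \<Rightarrow> 'm"
  lunit :: "'o \<Rightarrow> 'm"
  runit :: "'o \<Rightarrow> 'm"

record ('o, 'm, 'k) rigidcat = "('o, 'm, 'k) moncat" +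
  ldual :: "'o \<Rightarrow> 'o"
  ev :: "'o \<Rightarrow> 'm"
  co :: "'o \<Rightarrow> 'm"
  rdual :: "'o \<Rightarrow> 'o"

locale linear_monoidal_category =
  linear_category S for S :: "('o, 'm::ab_group_add, 'k::field, 'z) moncat_scheme" (structure) +
  assumes unit_in_obj: "\<one> \<in> obj S"
    and ten_in_obj: "\<lbrakk>X \<in> obj S; Y \<in> obj S\<rbrakk> \<Longrightarrow> X \<odot> Y \<in> obj S"
    and tenm_in_hom:
      "\<lbrakk>X \<in> obj S; X' \<in> obj S; Y \<in> obj S; Y' \<in> obj S; f \<in> hom S X X'; g \<in> hom S Y Y'\<rbrakk>
        \<Longrightarrow> f \<otimes> g \<in> hom S (X \<odot> Y) (X' \<odot> Y')"
    and tenm_idm: "\<lbrakk>X \<in> obj S; Y \<in> obj S\<rbrakk> \<Longrightarrow> idm S X \<otimes> idm S Y = idm S (X \<odot> Y)"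
    and tenm_cmp:
      "\<lbrakk>X \<in> obj S; X' \<in> obj S; X'' \<in> obj S; Y \<in> obj S; Y' \<in> obj S; Y'' \<in> obj S;
        f \<in> hom S X X'; f' \<in> hom S X' X''; g \<in> hom S Y Y'; g' \<in> hom S Y' Y''\<rbrakk>
        \<Longrightarrow> (f' \<cdot> f) \<otimes> (g' \<cdot> g) = (f' \<otimes> g') \<cdot> (f \<otimes> g)"
    and tenm_add_left:
      "\<lbrakk>X \<in> obj S; X' \<in> obj S; Y \<in> obj S; Y' \<in> obj S;
        f \<in> hom S X X'; f' \<in> hom S X X'; g \<in> hom S Y Y'\<rbrakk> \<Longrightarrow> (f + f') \<otimes> g = f \<otimes> g + f' \<otimes> g"
    and tenm_add_right:
      "\<lbrakk>X \<in> obj S; X' \<in> obj S; Y \<in> obj S; Y' \<in> obj S;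
        f \<in> hom S X X'; g \<in> hom S Y Y'; g' \<in> hom S Y Y'\<rbrakk> \<Longrightarrow> f \<otimes> (g + g') = f \<otimes> g + f \<otimes> g'"
    and tenm_scl_left:
      "\<lbrakk>X \<in> obj S; X' \<in> obj S; Y \<in> obj S; Y' \<in> obj S; f \<in> hom S X X'; g \<in> hom S Y Y'\<rbrakk>
        \<Longrightarrow> scl S c f \<otimes> g = scl S c (f \<otimes> g)"
    and tenm_scl_right:
      "\<lbrakk>X \<in> obj S; X' \<in> obj S; Y \<in> obj S; Y' \<in> obj S; f \<in> hom S X X'; g \<in> hom S Y Y'\<rbrakk>
        \<Longrightarrow> f \<otimes> scl S c g = scl S c (f \<otimes> g)"
    and assoc_iso:
      "\<lbrakk>X \<in> obj S; Y \<in> obj S; Z \<in> obj S\<rbrakk>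
        \<Longrightarrow> is_iso S ((X \<odot> Y) \<odot> Z) (X \<odot> (Y \<odot> Z)) (assoc S X Y Z)"
    and assoc_natural:
      "\<lbrakk>X \<in> obj S; X' \<in> obj S; Y \<in> obj S; Y' \<in> obj S; Z \<in> obj S; Z' \<in> obj S;
        f \<in> hom S X X'; g \<in> hom S Y Y'; h \<in> hom S Z Z'\<rbrakk>
        \<Longrightarrow> assoc S X' Y' Z' \<cdot> ((f \<otimes> g) \<otimes> h) = (f \<otimes> (g \<otimes> h)) \<cdot> assoc S X Y Z"
    and lunit_iso: "X \<in> obj S \<Longrightarrow> is_iso S (\<one> \<odot> X) X (lunit S X)"
    and lunit_natural:
      "\<lbrakk>X \<in> obj S; Y \<in> obj S; f \<in> hom S X Y\<rbrakk>
        \<Longrightarrow> lunit S Y \<cdot> (idm S \<one> \<otimes> f) = f \<cdot> lunit S X"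
    and runit_iso: "X \<in> obj S \<Longrightarrow> is_iso S (X \<odot> \<one>) X (runit S X)"
    and runit_natural:
      "\<lbrakk>X \<in> obj S; Y \<in> obj S; f \<in> hom S X Y\<rbrakk>
        \<Longrightarrow> runit S Y \<cdot> (f \<otimes> idm S \<one>) = f \<cdot> runit S X"
    and pentagon:
      "\<lbrakk>W \<in> obj S; X \<in> obj S; Y \<in> obj S; Z \<in> obj S\<rbrakk>
        \<Longrightarrow> (idm S W \<otimes> assoc S X Y Z) \<cdot> assoc S W (X \<odot> Y) Z \<cdot> (assoc S W X Y \<otimes> idm S Z)
            = assoc S W X (Y \<odot> Z) \<cdot> assoc S (W \<odot> X) Y Z"
    and triangle:
      "\<lbrakk>X \<in> obj S; Y \<in> obj S\<rbrakk>
        \<Longrightarrow> (idm S X \<otimes> lunit S Y) \<cdot> assoc S X \<one> Y = runit S X \<otimes> idm S Y"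

definition is_left_dual ::
  "('o, 'm, 'k, 'z) moncat_scheme \<Rightarrow> 'o \<Rightarrow> 'o \<Rightarrow> 'm \<Rightarrow> 'm \<Rightarrow> bool" where
  "is_left_dual S X Y e c \<longleftrightarrow>
     X \<in> obj S \<and> Y \<in> obj S \<and>
     e \<in> hom S (Y \<odot>\<^bsub>S\<^esub> X) \<one>\<^bsub>S\<^esub> \<and> c \<in> hom S \<one>\<^bsub>S\<^esub> (X \<odot>\<^bsub>S\<^esub> Y) \<and>
     runit S X \<cdot>\<^bsub>S\<^esub> (idm S X \<otimes>\<^bsub>S\<^esub> e) \<cdot>\<^bsub>S\<^esub> assoc S X Y X \<cdot>\<^bsub>S\<^esub> (c \<otimes>\<^bsub>S\<^esub> idm S X)
       \<cdot>\<^bsub>S\<^esub> inv_mor S (\<one>\<^bsub>S\<^esub> \<odot>\<^bsub>S\<^esub> X) X (lunit S X) = idm S X \<and>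
     lunit S Y \<cdot>\<^bsub>S\<^esub> (e \<otimes>\<^bsub>S\<^esub> idm S Y)
       \<cdot>\<^bsub>S\<^esub> inv_mor S ((Y \<odot>\<^bsub>S\<^esub> X) \<odot>\<^bsub>S\<^esub> Y) (Y \<odot>\<^bsub>S\<^esub> (X \<odot>\<^bsub>S\<^esub> Y)) (assoc S Y X Y)
       \<cdot>\<^bsub>S\<^esub> (idm S Y \<otimes>\<^bsub>S\<^esub> c) \<cdot>\<^bsub>S\<^esub> inv_mor S (Y \<odot>\<^bsub>S\<^esub> \<one>\<^bsub>S\<^esub>) Y (runit S Y) = idm S Y"

locale pseudo_tensor_category =
  linear_monoidal_category S
  for S :: "('o, 'm::ab_group_add, 'k::field, 'z) rigidcat_scheme" (structure) +
  assumes additive: "set Xs \<subseteq> obj S \<Longrightarrow> \<exists>Y i p. direct_sum S Y Xs i p"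
    and idempotent_complete:
      "\<lbrakk>X \<in> obj S; e \<in> hom S X X; e \<cdot> e = e\<rbrakk>
        \<Longrightarrow> \<exists>Y \<in> obj S. \<exists>s \<in> hom S Y X. \<exists>r \<in> hom S X Y. s \<cdot> r = e \<and> r \<cdot> s = idm S Y"
    and hom_finite_dim:
      "\<lbrakk>X \<in> obj S; Y \<in> obj S\<rbrakk> \<Longrightarrow> \<exists>A. finite A \<and> module.span (scl S) A = hom S X Y"
    and end_unit: "bij_betw (\<lambda>c. scl S c (idm S \<one>)) UNIV (hom S \<one> \<one>)"
    and left_dual: "X \<in> obj S \<Longrightarrow> is_left_dual S X (ldual S X) (ev S X) (co S X)"
    and right_dual: "X \<in> obj S \<Longrightarrow> \<exists>e c. is_left_dual S (rdual S X) X e c"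


section \<open>Grading shift functors\<close>

definition linear_endofunctor ::
  "('o, 'm::ab_group_add, 'k, 'z) lincat_scheme \<Rightarrow> ('o \<Rightarrow> 'o) \<Rightarrow> ('m \<Rightarrow> 'm) \<Rightarrow> bool" where
  "linear_endofunctor S F Fm \<longleftrightarrow>
     (\<forall>X \<in> obj S. F X \<in> obj S \<and> Fm (idm S X) = idm S (F X)) \<and>
     (\<forall>X \<in> obj S. \<forall>Y \<in> obj S. \<forall>f \<in> hom S X Y. Fm f \<in> hom S (F X) (F Y) \<and>
        (\<forall>f' \<in> hom S X Y. Fm (f + f') = Fm f + Fm f') \<and> (\<forall>c. Fm (scl S c f) = scl S c (Fm f))) \<and>
     (\<forall>X \<in> obj S. \<forall>Y \<in> obj S. \<forall>Z \<in> obj S. \<forall>f \<in> hom S X Y. \<forall>g \<in> hom S Y Z.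
        Fm (g \<cdot>\<^bsub>S\<^esub> f) = Fm g \<cdot>\<^bsub>S\<^esub> Fm f)"

definition natural_iso ::
  "('o, 'm, 'k, 'z) lincat_scheme \<Rightarrow> ('o \<Rightarrow> 'o) \<Rightarrow> ('m \<Rightarrow> 'm) \<Rightarrow> ('o \<Rightarrow> 'o) \<Rightarrow> ('m \<Rightarrow> 'm)
    \<Rightarrow> ('o \<Rightarrow> 'm) \<Rightarrow> bool" where
  "natural_iso S F Fm G Gm t \<longleftrightarrow>
     (\<forall>X \<in> obj S. is_iso S (F X) (G X) (t X)) \<and>
     (\<forall>X \<in> obj S. \<forall>Y \<in> obj S. \<forall>f \<in> hom S X Y. t Y \<cdot>\<^bsub>S\<^esub> Fm f = Gm f \<cdot>\<^bsub>S\<^esub> t X)"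

text \<open>
  A functor \<open>F\<close> (\<open>fobj\<close> on objects, \<open>fmor\<close> on morphisms) with a quasi-inverse \<open>G\<close> (\<open>gobj\<close>, \<open>gmor\<close>)
  and the structure of a bimodule functor, \<open>lact X Y : F (X \<otimes> Y) \<rightarrow> X \<otimes> F Y\<close> and
  \<open>ract X Y : F (X \<otimes> Y) \<rightarrow> F X \<otimes> Y\<close>.
\<close>

record ('o, 'm) autoequiv =
  fobj :: "'o \<Rightarrow> 'o"
  fmor :: "'m \<Rightarrow> 'm"
  gobj :: "'o \<Rightarrow> 'o"
  gmor :: "'m \<Rightarrow> 'm"
  lact :: "'o \<Rightarrow> 'o \<Rightarrow> 'm"
  ract :: "'o \<Rightarrow> 'o \<Rightarrow> 'm"

locale bimodule_autoequivalence =
  linear_monoidal_category S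
  for S :: "('o, 'm::ab_group_add, 'k::field, 'z) moncat_scheme" (structure)
    and T :: "('o, 'm) autoequiv" +
  assumes fobj_functor: "linear_endofunctor S (fobj T) (fmor T)"
    and gobj_functor: "linear_endofunctor S (gobj T) (gmor T)"
    and quasi_inverse_left:
      "\<exists>t. natural_iso S (gobj T \<circ> fobj T) (gmor T \<circ> fmor T) id id t"
    and quasi_inverse_right:
      "\<exists>t. natural_iso S (fobj T \<circ> gobj T) (fmor T \<circ> gmor T) id id t"
    and lact_iso:
      "\<lbrakk>X \<in> obj S; Y \<in> obj S\<rbrakk> \<Longrightarrow> is_iso S (fobj T (X \<odot> Y)) (X \<odot> fobj T Y) (lact T X Y)"
    and lact_natural:
      "\<lbrakk>X \<in> obj S; X' \<in> obj S; Y \<in> obj S; Y' \<in> obj S; f \<in> hom S X X'; g \<in> hom S Y Y'\<rbrakk>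
        \<Longrightarrow> lact T X' Y' \<cdot> fmor T (f \<otimes> g) = (f \<otimes> fmor T g) \<cdot> lact T X Y"
    and lact_assoc:
      "\<lbrakk>X \<in> obj S; Y \<in> obj S; Z \<in> obj S\<rbrakk>
        \<Longrightarrow> assoc S X Y (fobj T Z) \<cdot> lact T (X \<odot> Y) Z
            = (idm S X \<otimes> lact T Y Z) \<cdot> lact T X (Y \<odot> Z) \<cdot> fmor T (assoc S X Y Z)"
    and lact_unit: "X \<in> obj S \<Longrightarrow> lunit S (fobj T X) \<cdot> lact T \<one> X = fmor T (lunit S X)"
    and ract_iso:
      "\<lbrakk>X \<in> obj S; Y \<in> obj S\<rbrakk> \<Longrightarrow> is_iso S (fobj T (X \<odot> Y)) (fobj T X \<odot> Y) (ract T X Y)"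
    and ract_natural:
      "\<lbrakk>X \<in> obj S; X' \<in> obj S; Y \<in> obj S; Y' \<in> obj S; f \<in> hom S X X'; g \<in> hom S Y Y'\<rbrakk>
        \<Longrightarrow> ract T X' Y' \<cdot> fmor T (f \<otimes> g) = (fmor T f \<otimes> g) \<cdot> ract T X Y"
    and ract_assoc:
      "\<lbrakk>X \<in> obj S; Y \<in> obj S; Z \<in> obj S\<rbrakk>
        \<Longrightarrow> assoc S (fobj T X) Y Z \<cdot> (ract T X Y \<otimes> idm S Z) \<cdot> ract T (X \<odot> Y) Z
            = ract T X (Y \<odot> Z) \<cdot> fmor T (assoc S X Y Z)"
    and ract_unit: "X \<in> obj S \<Longrightarrow> runit S (fobj T X) \<cdot> ract T X \<one> = fmor T (runit S X)"
    and bimodule_compat: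
      "\<lbrakk>X \<in> obj S; Y \<in> obj S; Z \<in> obj S\<rbrakk>
        \<Longrightarrow> assoc S X (fobj T Y) Z \<cdot> (lact T X Y \<otimes> idm S Z) \<cdot> ract T (X \<odot> Y) Z
            = (idm S X \<otimes> ract T Y Z) \<cdot> lact T X (Y \<odot> Z) \<cdot> fmor T (assoc S X Y Z)"

text \<open>\<open>X\<langle>i\<rangle>\<close> is written \<open>shift T i X\<close>.\<close>

definition shift :: "('o, 'm) autoequiv \<Rightarrow> int \<Rightarrow> 'o \<Rightarrow> 'o" where
  "shift T i X = (if 0 \<le> i then (fobj T ^^ nat i) X else (gobj T ^^ nat (- i)) X)"


section \<open>Cells, the functions a and Delta, and the set D\<close>

definition rstar ::
  "('o, 'm, 'k, 'z) rigidcat_scheme \<Rightarrow> 'w set \<Rightarrow> ('w \<Rightarrow> 'o) \<Rightarrow> 'w \<Rightarrow> 'w" where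
  "rstar S W B x = (THE y. y \<in> W \<and> isomorphic S (rdual S (B x)) (B y))"

definition a_fun ::
  "('o, 'm::ab_group_add, 'k, 'z) moncat_scheme \<Rightarrow> ('o, 'm) autoequiv \<Rightarrow> 'w set \<Rightarrow> ('w \<Rightarrow> 'o)
    \<Rightarrow> 'w \<Rightarrow> ereal" where
  "a_fun S T W B x =
     (SUP i \<in> {i::int. \<exists>y \<in> W. \<exists>z \<in> W. is_summand S (shift T i (B x)) (B y \<odot>\<^bsub>S\<^esub> B z)}.
        ereal (of_int i))"

definition Delta ::
  "('o, 'm::ab_group_add, 'k, 'z) moncat_scheme \<Rightarrow> ('o, 'm) autoequiv \<Rightarrow> ('w \<Rightarrow> 'o)
    \<Rightarrow> 'w \<Rightarrow> enat" where
  "Delta S T B x = (INF i \<in> {i::nat. hom S \<one>\<^bsub>S\<^esub> (shift T (int i) (B x)) \<noteq> {0}}. enat i)"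

definition D_set ::
  "('o, 'm::ab_group_add, 'k, 'z) moncat_scheme \<Rightarrow> ('o, 'm) autoequiv \<Rightarrow> 'w set \<Rightarrow> ('w \<Rightarrow> 'o)
    \<Rightarrow> 'w set" where
  "D_set S T W B = {x \<in> W. a_fun S T W B x = ereal_of_enat (Delta S T B x) \<and> a_fun S T W B x < \<infinity>}"

text \<open>\<open>B\<^sub>x\<langle>a(x)\<rangle>\<close>, meaningful only when \<open>a(x)\<close> is finite.\<close>

definition top_shift ::
  "('o, 'm::ab_group_add, 'k, 'z) moncat_scheme \<Rightarrow> ('o, 'm) autoequiv \<Rightarrow> 'w set \<Rightarrow> ('w \<Rightarrow> 'o)
    \<Rightarrow> 'w \<Rightarrow> 'o" where
  "top_shift S T W B x = shift T (THE i. a_fun S T W B x = ereal (of_int i)) (B x)"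

definition prec_left ::
  "('o, 'm::ab_group_add, 'k, 'z) moncat_scheme \<Rightarrow> ('w \<Rightarrow> 'o) \<Rightarrow> 'w \<Rightarrow> 'w \<Rightarrow> bool" where
  "prec_left S B x y \<longleftrightarrow> (\<exists>Y \<in> obj S. is_summand S (B y) (Y \<odot>\<^bsub>S\<^esub> B x))"

definition prec_right ::
  "('o, 'm::ab_group_add, 'k, 'z) moncat_scheme \<Rightarrow> ('w \<Rightarrow> 'o) \<Rightarrow> 'w \<Rightarrow> 'w \<Rightarrow> bool" where
  "prec_right S B x y \<longleftrightarrow> (\<exists>Y \<in> obj S. is_summand S (B y) (B x \<odot>\<^bsub>S\<^esub> Y))"

definition left_cells ::
  "('o, 'm::ab_group_add, 'k, 'z) moncat_scheme \<Rightarrow> 'w set \<Rightarrow> ('w \<Rightarrow> 'o) \<Rightarrow> 'w set set" where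
  "left_cells S W B = W // {(x, y). x \<in> W \<and> y \<in> W \<and> prec_left S B x y \<and> prec_left S B y x}"

definition right_cells ::
  "('o, 'm::ab_group_add, 'k, 'z) moncat_scheme \<Rightarrow> 'w set \<Rightarrow> ('w \<Rightarrow> 'o) \<Rightarrow> 'w set set" where
  "right_cells S W B = W // {(x, y). x \<in> W \<and> y \<in> W \<and> prec_right S B x y \<and> prec_right S B y x}"

text \<open>
  \<open>f : A \<rightarrow> Y\<close> factors through the direct summand \<open>X\<close> of \<open>Y\<close>.  The inclusion of a summand is
  determined by \<open>X\<close> and \<open>Y\<close> only up to a choice, so the factorization is required for every way
  of realizing \<open>X\<close> as a direct summand of \<open>Y\<close>.
\<close>

definition factors_through_summand ::
  "('o, 'm::ab_group_add, 'k, 'z) lincat_scheme \<Rightarrow> 'o \<Rightarrow> 'o \<Rightarrow> 'm \<Rightarrow> 'o \<Rightarrow> bool" where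
  "factors_through_summand S A Y f X \<longleftrightarrow> is_summand S X Y \<and>
     (\<forall>C i p. direct_sum S Y [X, C] i p \<longrightarrow> (\<exists>g \<in> hom S A X. f = i 0 \<cdot>\<^bsub>S\<^esub> g))"

end

theory Submission
  imports Defs
begin

text \<open>
  The theorem rests on one computation.  By duality \<open>Hom(1, \<^sup>*B\<^sub>z \<otimes> B\<^sub>z)\<close> is isomorphic to
  \<open>End(\<^sup>*B\<^sub>z)\<close>, and \<open>\<^sup>*B\<^sub>z\<close> is isomorphic to some \<open>B\<^sub>y\<close>, whose endomorphisms are scalars by the
  orthogonality condition.  So this Hom space is the line spanned by the coevaluation, and in a
  decomposition of \<open>\<^sup>*B\<^sub>z \<otimes> B\<^sub>z\<close> exactly one indecomposable summand receives a nonzero morphism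
  from the unit object: the coevaluation factors through it (\<open>coev_factors\<close>).

  Which summand is it?  Transposition (\<open>transpose_surj\<close>) turns a nonzero morphism
  \<open>1 \<rightarrow> B\<^sub>y \<otimes> B\<^sub>z\<close> into a nonzero morphism \<open>\<^sup>*B\<^sub>z \<rightarrow> B\<^sub>y\<close>.  Applied to shifted objects, it shows
  that if \<open>B\<^sub>x\<langle>i\<rangle>\<close> is a summand of \<open>B\<^sub>y \<otimes> B\<^sub>z\<close> and \<open>Hom(1, B\<^sub>x\<langle>n\<rangle>) \<noteq> 0\<close>, then \<open>i < n\<close>, or
  \<open>i = n\<close> and \<open>B\<^sub>y \<simeq> \<^sup>*B\<^sub>z\<close> (\<open>summand_shift_bound\<close>).  Hence \<open>a(x) \<le> \<Delta>(x)\<close> for all \<open>x\<close>.  The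
  summand \<open>B\<^sub>x\<langle>i\<rangle>\<close> singled out by the coevaluation satisfies \<open>\<Delta>(x) \<le> i \<le> a(x)\<close>, so that it is
  \<open>B\<^sub>d\<langle>a(d)\<rangle>\<close> for an element \<open>d = d\<^sub>z\<close> of \<open>\<D>\<close>.  This settles everything that does not mention
  cells.

  For left cells, suppose that \<open>B\<^sub>y\<close> is a summand of \<open>Y \<otimes> B\<^sub>x\<close>.  Transposing its inclusion gives a
  morphism \<open>\<^sup>*B\<^sub>x \<otimes> B\<^sub>x \<rightarrow> \<^sup>*B\<^sub>y \<otimes> B\<^sub>y\<close> that carries one coevaluation to the other
  (\<open>prec_left_coev\<close>), hence a nonzero morphism between the two distinguished summands.  Within a
  left cell there are such morphisms in both directions, and orthogonality then forces
  \<open>d\<^sub>x = d\<^sub>y\<close>.  Finally \<open>d\<^sub>z\<close> lies in the left cell of \<open>z\<close>, because by the zigzag identity the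
  identity of \<open>B\<^sub>z\<close> factors through \<open>B\<^sub>z \<otimes> B\<^sub>d\<langle>a(d)\<rangle>\<close> (\<open>prec_left_top\<close>).

  Right cells are the left cells of the category with the reversed tensor product, in which left
  and right duals are exchanged, so they need no separate argument.  The associator and the unit
  constraints are not assumed to be identities; transposition therefore depends on Kelly's two
  consequences of the pentagon and triangle axioms, \<open>lu_ten\<close> and \<open>ru_ten\<close>.
\<close>

section \<open>Dimensions of subspaces\<close>

lemma (in vector_space) basis_of_finite_dimensional:
  assumes "finite A" "span A = V"
  obtains b where "b \<subseteq> V" "independent b" "V = span b" "finite b" "card b = dim V"
proof -
  obtain b where b: "b \<subseteq> V" "independent b" "V \<subseteq> span b" "card b = dim V"
    using basis_exists by metis
  have "finite b" using independent_span_bound[OF assms(1) b(2)] b(1) assms(2) by auto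
  moreover have "V = span b" using b assms(2) by (metis span_mono span_span subset_antisym)
  ultimately show thesis using b that by blast
qed

lemma (in vector_space) dim_one_iff:
  assumes "finite A" "span A = V"
  shows "dim V = 1 \<longleftrightarrow> (\<exists>v. v \<noteq> 0 \<and> V = range (\<lambda>c. scale c v))"
proof
  assume 1: "dim V = 1"
  obtain b where b: "b \<subseteq> V" "independent b" "V = span b" "finite b" "card b = dim V"
    by (rule basis_of_finite_dimensional[OF assms])
  obtain v where v: "b = {v}" using b 1 by (metis card_1_singletonE)
  show "\<exists>v. v \<noteq> 0 \<and> V = range (\<lambda>c. scale c v)"
    using b v by (metis dependent_single span_singleton)
next
  assume "\<exists>v. v \<noteq> 0 \<and> V = range (\<lambda>c. scale c v)"
  then obtain v where v: "v \<noteq> 0" "V = span {v}" by (auto simp: span_singleton)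
  then show "dim V = 1" by (simp add: dim_eq_card_independent)
qed

lemma (in vector_space) dim_zero_imp:
  assumes "finite A" "span A = V" "dim V = 0"
  shows "V = {0}"
proof -
  obtain b where "b \<subseteq> V" "independent b" "V = span b" "finite b" "card b = dim V"
    by (rule basis_of_finite_dimensional[OF assms(1,2)])
  then show ?thesis using assms(3) by simp
qed

text \<open>The map \<open>h\<close> is linear on \<open>U\<close> only, as composition of morphisms is; it is replaced by a linear
  map of the whole space with the same values on a basis of \<open>U\<close>.\<close>

lemma (in vector_space) dim_less_of_injection:
  assumes U: "finite A" "span A = U" and V: "finite A'" "span A' = V"
    and hV: "\<And>u. u \<in> U \<Longrightarrow> h u \<in> V"
    and hadd: "\<And>u u'. u \<in> U \<Longrightarrow> u' \<in> U \<Longrightarrow> h (u + u') = h u + h u'"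
    and hscale: "\<And>c u. u \<in> U \<Longrightarrow> h (scale c u) = scale c (h u)"
    and hinj: "\<And>u. u \<in> U \<Longrightarrow> h u = 0 \<Longrightarrow> u = 0"
    and v: "v \<in> V" "v \<notin> h ` U"
  shows "dim U < dim V"
proof -
  interpret p: vector_space_pair scale scale ..
  obtain b where b: "b \<subseteq> U" "independent b" "U = span b" "finite b" "card b = dim U"
    by (rule basis_of_finite_dimensional[OF U])
  obtain b' where b': "b' \<subseteq> V" "independent b'" "V = span b'" "finite b'" "card b' = dim V"
    by (rule basis_of_finite_dimensional[OF V])
  define g where "g = p.construct b h"
  have g: "Vector_Spaces.linear scale scale g" unfolding g_def by (rule p.linear_construct[OF b(2)])
  have gh: "g u = h u" if "u \<in> U" for u
  proof -
    have "u \<in> span b" using that b by simp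
    then have "u \<in> U \<and> g u = h u"
    proof (induction rule: span_induct_alt)
      case base
      have "h 0 = 0" using hscale[of 0 0] b by (simp add: span_zero)
      then show ?case using p.linear_0[OF g] b by (simp add: span_zero)
    next
      case (step c x y)
      have "x \<in> U" "y \<in> U" using step b by (auto simp: span_base)
      have y: "scale c x \<in> U" using \<open>x \<in> U\<close> b by (simp add: span_scale)
      have "g x = h x" using step unfolding g_def by (simp add: p.construct_basis b(2))
      then show ?case
        using step.IH hadd[OF y \<open>y \<in> U\<close>] hscale[OF \<open>x \<in> U\<close>] span_add[of "scale c x" b y] y b
        by (simp add: p.linear_add[OF g] p.linear_scale[OF g])
    qed
    then show ?thesis by blast
  qed
  have inj: "inj_on g (span b)"
    by (subst p.linear_inj_on_iff_eq_0[OF g subspace_span]) (use gh hinj b in auto)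
  have im: "g ` U = span (g ` b)" using p.linear_span_image[OF g] b by simp
  have "independent (g ` b)" by (rule p.linear_independent_injective_image[OF g b(2) inj])
  moreover have "v \<notin> span (g ` b)" using v gh im by (metis image_cong)
  ultimately have ind: "independent (insert v (g ` b))" by (simp add: independent_insert)
  have "insert v (g ` b) \<subseteq> span b'" using v hV gh b b' by auto
  then have le: "card (insert v (g ` b)) \<le> dim V"
    using independent_span_bound[OF b'(4) ind] b' by simp
  have "v \<notin> g ` b" using \<open>v \<notin> span (g ` b)\<close> span_base by blast
  moreover have "inj_on g b" using inj b by (metis inj_on_subset span_superset)
  ultimately have "card (insert v (g ` b)) = Suc (dim U)" using b by (simp add: card_image)
  then show ?thesis using le by simp
qed

section \<open>Retracts and direct sums\<close>

lemma sum_lessThan_add: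
  fixes f :: "nat \<Rightarrow> 'c::comm_monoid_add"
  shows "(\<Sum>a<m + n. f a) = (\<Sum>a<m. f a) + (\<Sum>a<n. f (m + a))"
  by (induction n) (simp_all add: add.assoc)

text \<open>Retracts are what the arguments produce; over an idempotent complete category they are
  the same as direct summands.\<close>

definition retract_via :: "('o, 'm, 'k, 'z) lincat_scheme \<Rightarrow> 'o \<Rightarrow> 'o \<Rightarrow> 'm \<Rightarrow> 'm \<Rightarrow> bool" where
  "retract_via S X Y s r \<longleftrightarrow>
     X \<in> obj S \<and> Y \<in> obj S \<and> s \<in> hom S X Y \<and> r \<in> hom S Y X \<and> r \<cdot>\<^bsub>S\<^esub> s = idm S X"

definition retract :: "('o, 'm, 'k, 'z) lincat_scheme \<Rightarrow> 'o \<Rightarrow> 'o \<Rightarrow> bool" where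
  "retract S X Y \<longleftrightarrow> (\<exists>s r. retract_via S X Y s r)"

definition nonzero_hom :: "('o, 'm::zero, 'k, 'z) lincat_scheme \<Rightarrow> 'o \<Rightarrow> 'o \<Rightarrow> bool" where
  "nonzero_hom S X Y \<longleftrightarrow> X \<in> obj S \<and> Y \<in> obj S \<and> (\<exists>f \<in> hom S X Y. f \<noteq> 0)"

context linear_category
begin

lemma zero_in_hom: "\<lbrakk>X \<in> obj S; Y \<in> obj S\<rbrakk> \<Longrightarrow> 0 \<in> hom S X Y"
  and add_in_hom: "\<lbrakk>X \<in> obj S; Y \<in> obj S; f \<in> hom S X Y; g \<in> hom S X Y\<rbrakk> \<Longrightarrow> f + g \<in> hom S X Y"
  and scl_in_hom: "\<lbrakk>X \<in> obj S; Y \<in> obj S; f \<in> hom S X Y\<rbrakk> \<Longrightarrow> scl S c f \<in> hom S X Y"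
proof -
  interpret vector_space "scl S" by (rule ambient_vector_space)
  show "\<lbrakk>X \<in> obj S; Y \<in> obj S\<rbrakk> \<Longrightarrow> 0 \<in> hom S X Y"
    and "\<lbrakk>X \<in> obj S; Y \<in> obj S; f \<in> hom S X Y; g \<in> hom S X Y\<rbrakk> \<Longrightarrow> f + g \<in> hom S X Y"
    and "\<lbrakk>X \<in> obj S; Y \<in> obj S; f \<in> hom S X Y\<rbrakk> \<Longrightarrow> scl S c f \<in> hom S X Y"
    using hom_subspace by (auto simp: subspace_def)
qed

lemma scl_simps:
  "scl S c (scl S d f) = scl S (c * d) f" "scl S 1 f = f" "scl S 0 f = 0" "scl S c 0 = 0"
  "scl S c f = 0 \<longleftrightarrow> c = 0 \<or> f = 0" "scl S (- 1) f = - f"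
proof -
  interpret vector_space "scl S" by (rule ambient_vector_space)
  show "scl S c (scl S d f) = scl S (c * d) f" "scl S 1 f = f" "scl S 0 f = 0" "scl S c 0 = 0"
    "scl S c f = 0 \<longleftrightarrow> c = 0 \<or> f = 0" "scl S (- 1) f = - f"
    by auto
qed

lemma diff_in_hom:
  assumes "X \<in> obj S" "Y \<in> obj S" "f \<in> hom S X Y" "g \<in> hom S X Y"
  shows "f - g \<in> hom S X Y"
  using add_in_hom[OF assms(1-3) scl_in_hom[OF assms(1,2,4), of "- 1"]] by (simp add: scl_simps)

lemma sum_in_hom:
  assumes "X \<in> obj S" "Y \<in> obj S" "\<And>a. a \<in> A \<Longrightarrow> f a \<in> hom S X Y"
  shows "sum f A \<in> hom S X Y"
  using assms(3)
  by (induction A rule: infinite_finite_induct) (auto intro: zero_in_hom add_in_hom assms)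

lemma cmp_zero_left: "\<lbrakk>X \<in> obj S; Y \<in> obj S; Z \<in> obj S; f \<in> hom S X Y\<rbrakk> \<Longrightarrow> 0 \<cdot> f = 0"
  using cmp_add_left[of X Y Z f 0 0] zero_in_hom by simp

lemma cmp_zero_right: "\<lbrakk>X \<in> obj S; Y \<in> obj S; Z \<in> obj S; g \<in> hom S Y Z\<rbrakk> \<Longrightarrow> g \<cdot> 0 = 0"
  using cmp_add_right[of X Y Z 0 0 g] zero_in_hom by simp

lemma cmp_diff_left:
  assumes "X \<in> obj S" "Y \<in> obj S" "Z \<in> obj S" "f \<in> hom S X Y" "g \<in> hom S Y Z" "g' \<in> hom S Y Z"
  shows "(g - g') \<cdot> f = g \<cdot> f - g' \<cdot> f"
  using cmp_add_left[OF assms(1-4) diff_in_hom[OF assms(2,3,5,6)] assms(6)] by simp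

lemma cmp_diff_right:
  assumes "X \<in> obj S" "Y \<in> obj S" "Z \<in> obj S" "f \<in> hom S X Y" "f' \<in> hom S X Y" "g \<in> hom S Y Z"
  shows "g \<cdot> (f - f') = g \<cdot> f - g \<cdot> f'"
  using cmp_add_right[OF assms(1-3) diff_in_hom[OF assms(1,2,4,5)] assms(5,6)] by simp

lemma cmp_sum_left:
  assumes "X \<in> obj S" "Y \<in> obj S" "Z \<in> obj S" "f \<in> hom S X Y" "\<And>a. a \<in> A \<Longrightarrow> g a \<in> hom S Y Z"
  shows "sum g A \<cdot> f = (\<Sum>a\<in>A. g a \<cdot> f)"
  using assms(5)
proof (induction A rule: infinite_finite_induct)
  case (insert x F)
  then show ?case
    using cmp_add_left[OF assms(1-4), of "g x" "sum g F"] sum_in_hom[OF assms(2,3), of F g] by simp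
qed (use cmp_zero_left[OF assms(1-4)] in auto)

lemma cmp_sum_right:
  assumes "X \<in> obj S" "Y \<in> obj S" "Z \<in> obj S" "g \<in> hom S Y Z" "\<And>a. a \<in> A \<Longrightarrow> f a \<in> hom S X Y"
  shows "g \<cdot> sum f A = (\<Sum>a\<in>A. g \<cdot> f a)"
  using assms(5)
proof (induction A rule: infinite_finite_induct)
  case (insert x F)
  then show ?case
    using cmp_add_right[OF assms(1-3) _ _ assms(4), of "f x" "sum f F"] sum_in_hom[OF assms(1,2), of F f]
    by simp
qed (use cmp_zero_right[OF assms(1-4)] in auto)

lemma inverse_pair_inv_mor:
  assumes "X \<in> obj S" "Y \<in> obj S" "is_iso S X Y f"
  shows "inverse_pair S X Y f (inv_mor S X Y f)"
proof -
  obtain g where g: "inverse_pair S X Y f g" using assms(3) unfolding is_iso_def by blast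
  have "g' = g" if "inverse_pair S X Y f g'" for g'
  proof -
    have "g' = g' \<cdot> (f \<cdot> g)" using g that cmp_idm[OF assms(2,1)] by (simp add: inverse_pair_def)
    also have "\<dots> = (g' \<cdot> f) \<cdot> g"
      using g that by (intro cmp_assoc[OF assms(2,1,2,1), symmetric]) (auto simp: inverse_pair_def)
    also have "\<dots> = g" using g that idm_cmp[OF assms(2,1)] by (simp add: inverse_pair_def)
    finally show ?thesis .
  qed
  then show ?thesis unfolding inv_mor_def using g theI[of "inverse_pair S X Y f"] by blast
qed

lemma retract_via_cancel:
  assumes "retract_via S X Y s r" "Z \<in> obj S" "f \<in> hom S Z X"
  shows "r \<cdot> (s \<cdot> f) = f"
  using assms cmp_assoc[of Z X Y X f s r] idm_cmp[of Z X f] by (simp add: retract_via_def)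

lemma retract_via_cancel':
  assumes "retract_via S X Y s r" "Z \<in> obj S" "f \<in> hom S X Z"
  shows "(f \<cdot> r) \<cdot> s = f"
  using assms cmp_assoc[of X Y X Z s r f] cmp_idm[of X Z f] by (simp add: retract_via_def)

lemma retract_trans:
  assumes "retract S X Y" "retract S Y Z"
  shows "retract S X Z"
proof -
  obtain s r s' r' where a: "retract_via S X Y s r" "retract_via S Y Z s' r'"
    using assms by (auto simp: retract_def)
  note d = a[unfolded retract_via_def]
  have "(r \<cdot> r') \<cdot> (s' \<cdot> s) = r \<cdot> (r' \<cdot> (s' \<cdot> s))"
    using d by (intro cmp_assoc[of X Z Y X]) (auto intro: cmp_in_hom[of X Y Z])
  also have "\<dots> = idm S X" using retract_via_cancel[OF a(2), of X s] d by simp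
  finally have "retract_via S X Z (s' \<cdot> s) (r \<cdot> r')"
    using d by (auto simp: retract_via_def intro: cmp_in_hom[of X Y Z] cmp_in_hom[of Z Y X])
  then show ?thesis by (auto simp: retract_def)
qed

lemma isomorphic_refl: "X \<in> obj S \<Longrightarrow> isomorphic S X X"
  unfolding isomorphic_def is_iso_def inverse_pair_def using idm_in_hom cmp_idm by metis

lemma isomorphic_sym: "isomorphic S X Y \<Longrightarrow> isomorphic S Y X"
  unfolding isomorphic_def is_iso_def inverse_pair_def by blast

lemma isomorphic_retract:
  "\<lbrakk>isomorphic S X Y; X \<in> obj S; Y \<in> obj S\<rbrakk> \<Longrightarrow> retract S X Y"
  unfolding isomorphic_def is_iso_def inverse_pair_def retract_def retract_via_def by blast

lemma isomorphic_trans: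
  assumes "isomorphic S X Y" "isomorphic S Y Z" "X \<in> obj S" "Y \<in> obj S" "Z \<in> obj S"
  shows "isomorphic S X Z"
proof -
  obtain s r s' r' where a: "inverse_pair S X Y s r" "inverse_pair S Y Z s' r'"
    using assms by (auto simp: isomorphic_def is_iso_def)
  have v: "retract_via S X Y s r" "retract_via S Y X r s" "retract_via S Y Z s' r'" "retract_via S Z Y r' s'"
    using a assms by (auto simp: inverse_pair_def retract_via_def)
  note d = v[unfolded retract_via_def]
  have 1: "s' \<cdot> s \<in> hom S X Z" "r \<cdot> r' \<in> hom S Z X" using d cmp_in_hom by metis+
  have "(r \<cdot> r') \<cdot> (s' \<cdot> s) = r \<cdot> (r' \<cdot> (s' \<cdot> s))"
    using d 1 by (intro cmp_assoc[of X Z Y X]) auto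
  moreover have "(s' \<cdot> s) \<cdot> (r \<cdot> r') = s' \<cdot> (s \<cdot> (r \<cdot> r'))"
    using d 1 by (intro cmp_assoc[of Z X Y Z]) auto
  ultimately have "inverse_pair S X Z (s' \<cdot> s) (r \<cdot> r')"
    using 1 d retract_via_cancel[OF v(3), of X s] retract_via_cancel[OF v(2), of Z r']
    by (auto simp: inverse_pair_def)
  then show ?thesis by (auto simp: isomorphic_def is_iso_def)
qed

lemma nonzero_hom_retract_right:
  assumes "nonzero_hom S A X" "retract S X Y"
  shows "nonzero_hom S A Y"
proof -
  obtain f s r where f: "f \<in> hom S A X" "f \<noteq> 0" "A \<in> obj S" and v: "retract_via S X Y s r"
    using assms by (auto simp: nonzero_hom_def retract_def)
  have "r \<cdot> (s \<cdot> f) = f" using v f by (simp add: retract_via_cancel[OF v])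
  then have "s \<cdot> f \<noteq> 0" using f v cmp_zero_right[of A Y X r] by (auto simp: retract_via_def)
  then show ?thesis using v f cmp_in_hom[of A X Y f s] by (auto simp: nonzero_hom_def retract_via_def)
qed

lemma nonzero_hom_retract_left:
  assumes "nonzero_hom S X A" "retract S X Y"
  shows "nonzero_hom S Y A"
proof -
  obtain f s r where f: "f \<in> hom S X A" "f \<noteq> 0" "A \<in> obj S" and v: "retract_via S X Y s r"
    using assms by (auto simp: nonzero_hom_def retract_def)
  have "(f \<cdot> r) \<cdot> s = f" using v f by (simp add: retract_via_cancel'[OF v])
  then have "f \<cdot> r \<noteq> 0" using f v cmp_zero_left[of X Y A s] by (auto simp: retract_via_def)
  then show ?thesis using v f cmp_in_hom[of Y X A r f] by (auto simp: nonzero_hom_def retract_via_def)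
qed

lemma nonzero_hom_isomorphic:
  assumes "nonzero_hom S X Y" "isomorphic S X X'" "isomorphic S Y Y'" "X' \<in> obj S" "Y' \<in> obj S"
  shows "nonzero_hom S X' Y'"
  using assms isomorphic_retract nonzero_hom_retract_left nonzero_hom_retract_right
  by (meson nonzero_hom_def)

lemma direct_sum_retract_via:
  "\<lbrakk>direct_sum S Y Xs i p; a < length Xs\<rbrakk> \<Longrightarrow> retract_via S (Xs ! a) Y (i a) (p a)"
  using nth_mem[of a Xs] by (auto simp: direct_sum_def retract_via_def)

lemma is_summand_imp_retract:
  assumes "is_summand S X Y"
  shows "retract S X Y"
proof -
  obtain C i p where "direct_sum S Y [X, C] i p" using assms by (auto simp: is_summand_def)
  from direct_sum_retract_via[OF this, of 0] show ?thesis by (auto simp: retract_def)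
qed

text \<open>The two projections are orthogonal because their sum is the identity:
  \<open>s' = (s r + s' r') s' = s r s' + s'\<close> gives \<open>s r s' = 0\<close>, and \<open>s\<close> is split by \<open>r\<close>.\<close>

lemma direct_sum_pairI:
  assumes "retract_via S X Y s r" "retract_via S C Y s' r'" "s \<cdot> r + s' \<cdot> r' = idm S Y"
  shows "direct_sum S Y [X, C] (\<lambda>a. if a = 0 then s else s') (\<lambda>a. if a = 0 then r else r')"
proof -
  note d = assms(1,2)[unfolded retract_via_def]
  have "s \<cdot> r \<in> hom S Y Y" "s' \<cdot> r' \<in> hom S Y Y" using d cmp_in_hom by metis+
  note d = d this
  have "s' = (s \<cdot> r + s' \<cdot> r') \<cdot> s'" using d assms(3) idm_cmp[of C Y s'] by simp
  also have "\<dots> = (s \<cdot> r) \<cdot> s' + (s' \<cdot> r') \<cdot> s'" using d by (intro cmp_add_left[of C Y Y]) auto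
  also have "(s' \<cdot> r') \<cdot> s' = s'" using d retract_via_cancel'[OF assms(2), of Y s'] by simp
  finally have 1: "(s \<cdot> r) \<cdot> s' = 0" by simp
  have "r \<cdot> s' \<in> hom S C X" using d cmp_in_hom by metis
  then have "r \<cdot> s' = r \<cdot> (s \<cdot> (r \<cdot> s'))" using d retract_via_cancel[OF assms(1), of C] by simp
  also have "\<dots> = 0" using d 1 cmp_assoc[of C Y X Y s' r s] cmp_zero_right[of C Y X r] by simp
  finally have rs': "r \<cdot> s' = 0" .
  have "s = (s \<cdot> r + s' \<cdot> r') \<cdot> s" using d assms(3) idm_cmp[of X Y s] by simp
  also have "\<dots> = (s \<cdot> r) \<cdot> s + (s' \<cdot> r') \<cdot> s" using d by (intro cmp_add_left[of X Y Y]) auto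
  also have "(s \<cdot> r) \<cdot> s = s" using d retract_via_cancel'[OF assms(1), of Y s] by simp
  finally have 1: "(s' \<cdot> r') \<cdot> s = 0" by simp
  have "r' \<cdot> s \<in> hom S X C" using d cmp_in_hom by metis
  then have "r' \<cdot> s = r' \<cdot> (s' \<cdot> (r' \<cdot> s))" using d retract_via_cancel[OF assms(2), of X] by simp
  also have "\<dots> = 0" using d 1 cmp_assoc[of X Y C Y s r' s'] cmp_zero_right[of X Y C r'] by simp
  finally have r's: "r' \<cdot> s = 0" .
  show ?thesis using d rs' r's assms(3) by (auto simp: direct_sum_def less_Suc_eq)
qed

text \<open>The complement is the image of the idempotent \<open>1 - s r\<close>.\<close>

lemma retract_imp_is_summand:
  assumes split: "\<And>X e. \<lbrakk>X \<in> obj S; e \<in> hom S X X; e \<cdot> e = e\<rbrakk>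
        \<Longrightarrow> \<exists>Y \<in> obj S. \<exists>s \<in> hom S Y X. \<exists>r \<in> hom S X Y. s \<cdot> r = e \<and> r \<cdot> s = idm S Y"
    and "retract S X Y"
  shows "is_summand S X Y"
proof -
  obtain s r where v: "retract_via S X Y s r" using assms by (auto simp: retract_def)
  note d = v[unfolded retract_via_def]
  have sr: "s \<cdot> r \<in> hom S Y Y" using d cmp_in_hom by metis
  have id: "idm S Y \<in> hom S Y Y" using d idm_in_hom by blast
  let ?e = "idm S Y - s \<cdot> r"
  have e: "?e \<in> hom S Y Y" using sr id d diff_in_hom by blast
  have "(s \<cdot> r) \<cdot> (s \<cdot> r) = s \<cdot> (r \<cdot> (s \<cdot> r))" using d sr by (intro cmp_assoc[of Y Y X Y]) auto
  then have srsr: "(s \<cdot> r) \<cdot> (s \<cdot> r) = s \<cdot> r" using d retract_via_cancel[OF v, of Y r] by simp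
  have "?e \<cdot> ?e = idm S Y \<cdot> ?e - (s \<cdot> r) \<cdot> ?e" using d sr id e by (intro cmp_diff_left[of Y Y Y]) auto
  also have "\<dots> = ?e"
    using d sr id e srsr by (simp add: idm_cmp[of Y Y] cmp_idm[of Y Y] cmp_diff_right[of Y Y Y])
  finally obtain C s' r' where C: "C \<in> obj S" "s' \<in> hom S C Y" "r' \<in> hom S Y C"
      "s' \<cdot> r' = ?e" "r' \<cdot> s' = idm S C"
    using split[OF _ e] d by blast
  then have "retract_via S C Y s' r'" using d by (simp add: retract_via_def)
  then show ?thesis
    using direct_sum_pairI[OF v, of C s' r'] C by (auto simp: is_summand_def)
qed

lemma direct_sum_append:
  assumes Y: "direct_sum S Y [A, C] i p" and A: "direct_sum S A As i1 p1" and C: "direct_sum S C Cs i2 p2"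
  shows "\<exists>j q. direct_sum S Y (As @ Cs) j q"
proof -
  let ?m = "length As"
  define j where "j a = (if a < ?m then i 0 \<cdot> i1 a else i 1 \<cdot> i2 (a - ?m))" for a
  define q where "q a = (if a < ?m then p1 a \<cdot> p 0 else p2 (a - ?m) \<cdot> p 1)" for a
  have o: "Y \<in> obj S" "A \<in> obj S" "C \<in> obj S" using Y by (auto simp: direct_sum_def)
  have h: "i 0 \<in> hom S A Y" "p 0 \<in> hom S Y A" "i 1 \<in> hom S C Y" "p 1 \<in> hom S Y C"
    and pi: "p 0 \<cdot> i 0 = idm S A" "p 1 \<cdot> i 1 = idm S C" "p 0 \<cdot> i 1 = 0" "p 1 \<cdot> i 0 = 0"
    and sm: "i 0 \<cdot> p 0 + i 1 \<cdot> p 1 = idm S Y"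
    using direct_sum_retract_via[OF Y, of 0] direct_sum_retract_via[OF Y, of 1] Y
    by (auto simp: retract_via_def direct_sum_def numeral_2_eq_2)
  have o1: "As ! a \<in> obj S" "i1 a \<in> hom S (As ! a) A" "p1 a \<in> hom S A (As ! a)" if "a < ?m" for a
    using direct_sum_retract_via[OF A that] by (auto simp: retract_via_def)
  have o2: "Cs ! a \<in> obj S" "i2 a \<in> hom S (Cs ! a) C" "p2 a \<in> hom S C (Cs ! a)" if "a < length Cs" for a
    using direct_sum_retract_via[OF C that] by (auto simp: retract_via_def)
  have four: "(u \<cdot> v) \<cdot> (w \<cdot> x) = u \<cdot> ((v \<cdot> w) \<cdot> x)"
    if "X1 \<in> obj S" "X2 \<in> obj S" "X3 \<in> obj S" "X4 \<in> obj S" "X5 \<in> obj S"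
      "x \<in> hom S X1 X2" "w \<in> hom S X2 X3" "v \<in> hom S X3 X4" "u \<in> hom S X4 X5" for u v w x X1 X2 X3 X4 X5
  proof -
    have "(u \<cdot> v) \<cdot> (w \<cdot> x) = u \<cdot> (v \<cdot> (w \<cdot> x))"
      using that cmp_in_hom[of X1 X2 X3 x w] by (intro cmp_assoc[of X1 X3 X4 X5]) auto
    also have "v \<cdot> (w \<cdot> x) = (v \<cdot> w) \<cdot> x"
      using that by (intro cmp_assoc[of X1 X2 X3 X4, symmetric]) auto
    finally show ?thesis .
  qed
  have homs: "j a \<in> hom S ((As @ Cs) ! a) Y \<and> q a \<in> hom S Y ((As @ Cs) ! a)"
    if "a < length (As @ Cs)" for a
  proof (cases "a < ?m")
    case True
    then show ?thesis using o1[of a] o h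
      by (auto simp: j_def q_def nth_append intro: cmp_in_hom[of _ A Y] cmp_in_hom[of Y A])
  next
    case False
    then show ?thesis using that o2[of "a - ?m"] o h
      by (auto simp: j_def q_def nth_append intro: cmp_in_hom[of _ C Y] cmp_in_hom[of Y C])
  qed
  have orth: "q a \<cdot> j b = (if a = b then idm S ((As @ Cs) ! a) else 0)"
    if ab: "a < length (As @ Cs)" "b < length (As @ Cs)" for a b
  proof -
    consider "a < ?m" "b < ?m" | "a < ?m" "\<not> b < ?m" | "\<not> a < ?m" "b < ?m" | "\<not> a < ?m" "\<not> b < ?m"
      by blast
    then show ?thesis
    proof cases
      case 1
      have "q a \<cdot> j b = p1 a \<cdot> ((p 0 \<cdot> i 0) \<cdot> i1 b)"
        unfolding j_def q_def using 1 o1 o h by (simp add: four[of "As ! b" A Y A "As ! a"])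
      also have "\<dots> = p1 a \<cdot> i1 b" using pi o1 1 o by (simp add: idm_cmp[of "As ! b"])
      finally show ?thesis using A 1 by (simp add: direct_sum_def nth_append)
    next
      case 2
      then have b: "b - ?m < length Cs" using ab by simp
      have "q a \<cdot> j b = p1 a \<cdot> ((p 0 \<cdot> i 1) \<cdot> i2 (b - ?m))"
        unfolding j_def q_def using 2 o1 o2[OF b] o h by (simp add: four[of "Cs ! (b - ?m)" C Y A "As ! a"])
      also have "\<dots> = 0"
        using pi o1[of a] o2[OF b] 2 o by (simp add: cmp_zero_left[of "Cs ! (b - ?m)" C] cmp_zero_right[of _ A "As ! a"])
      finally show ?thesis using 2 by auto
    next
      case 3
      then have a: "a - ?m < length Cs" using ab by simp
      have "q a \<cdot> j b = p2 (a - ?m) \<cdot> ((p 1 \<cdot> i 0) \<cdot> i1 b)"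
        unfolding j_def q_def using 3 o1 o2[OF a] o h by (simp add: four[of "As ! b" A Y C "Cs ! (a - ?m)"])
      also have "\<dots> = 0"
        using pi o1[of b] o2[OF a] 3 o by (simp add: cmp_zero_left[of "As ! b" A] cmp_zero_right[of _ C "Cs ! (a - ?m)"])
      finally show ?thesis using 3 by auto
    next
      case 4
      then have a: "a - ?m < length Cs" and b: "b - ?m < length Cs" using ab by simp_all
      have "q a \<cdot> j b = p2 (a - ?m) \<cdot> ((p 1 \<cdot> i 1) \<cdot> i2 (b - ?m))"
        unfolding j_def q_def using 4 o2[OF b] o2[OF a] o h
        by (simp add: four[of "Cs ! (b - ?m)" C Y C "Cs ! (a - ?m)"])
      also have "\<dots> = p2 (a - ?m) \<cdot> i2 (b - ?m)"
        using pi o2[OF b] o by (simp add: idm_cmp[of "Cs ! (b - ?m)"])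
      finally show ?thesis using C 4 a b by (auto simp: direct_sum_def nth_append)
    qed
  qed
  have "(\<Sum>a<length (As @ Cs). j a \<cdot> q a) = (\<Sum>a<?m. j a \<cdot> q a) + (\<Sum>a<length Cs. j (?m + a) \<cdot> q (?m + a))"
    using sum_lessThan_add[of "\<lambda>a. j a \<cdot> q a"] by simp
  also have "(\<Sum>a<?m. j a \<cdot> q a) = (\<Sum>a<?m. i 0 \<cdot> ((i1 a \<cdot> p1 a) \<cdot> p 0))"
  proof (intro sum.cong refl)
    fix a assume "a \<in> {..<?m}"
    then show "j a \<cdot> q a = i 0 \<cdot> ((i1 a \<cdot> p1 a) \<cdot> p 0)"
      using o1[of a] o h four[of Y A "As ! a" A Y] by (simp add: j_def q_def)
  qed
  also have "\<dots> = i 0 \<cdot> ((\<Sum>a<?m. i1 a \<cdot> p1 a) \<cdot> p 0)"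
  proof -
    have x: "i1 a \<cdot> p1 a \<in> hom S A A" if "a < ?m" for a using o1[OF that] o cmp_in_hom by metis
    have y: "(i1 a \<cdot> p1 a) \<cdot> p 0 \<in> hom S Y A" if "a < ?m" for a using x[OF that] o h cmp_in_hom by metis
    show ?thesis
      using x y o h cmp_sum_left[of Y A A "p 0" "{..<?m}" "\<lambda>a. i1 a \<cdot> p1 a"]
        cmp_sum_right[of Y A Y "i 0" "{..<?m}" "\<lambda>a. (i1 a \<cdot> p1 a) \<cdot> p 0"] by simp
  qed
  also have "\<dots> = i 0 \<cdot> p 0" using A o h by (simp add: direct_sum_def idm_cmp[of Y A])
  also have "(\<Sum>a<length Cs. j (?m + a) \<cdot> q (?m + a)) = (\<Sum>a<length Cs. i 1 \<cdot> ((i2 a \<cdot> p2 a) \<cdot> p 1))"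
  proof (intro sum.cong refl)
    fix a assume "a \<in> {..<length Cs}"
    then show "j (?m + a) \<cdot> q (?m + a) = i 1 \<cdot> ((i2 a \<cdot> p2 a) \<cdot> p 1)"
      using o2[of a] o h four[of Y C "Cs ! a" C Y] by (simp add: j_def q_def)
  qed
  also have "\<dots> = i 1 \<cdot> ((\<Sum>a<length Cs. i2 a \<cdot> p2 a) \<cdot> p 1)"
  proof -
    have x: "i2 a \<cdot> p2 a \<in> hom S C C" if "a < length Cs" for a using o2[OF that] o cmp_in_hom by metis
    have y: "(i2 a \<cdot> p2 a) \<cdot> p 1 \<in> hom S Y C" if "a < length Cs" for a using x[OF that] o h cmp_in_hom by metis
    show ?thesis
      using x y o h cmp_sum_left[of Y C C "p 1" "{..<length Cs}" "\<lambda>a. i2 a \<cdot> p2 a"]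
        cmp_sum_right[of Y C Y "i 1" "{..<length Cs}" "\<lambda>a. (i2 a \<cdot> p2 a) \<cdot> p 1"] by simp
  qed
  also have "\<dots> = i 1 \<cdot> p 1" using C o h by (simp add: direct_sum_def idm_cmp[of Y C])
  finally have "(\<Sum>a<length (As @ Cs). j a \<cdot> q a) = idm S Y" using sm by simp
  then have "direct_sum S Y (As @ Cs) j q"
    using homs orth A C o by (auto simp: direct_sum_def)
  then show ?thesis by blast
qed

text \<open>The map \<open>f \<mapsto> s f r\<close> embeds \<open>End(A)\<close> into \<open>End(Y)\<close>, and its image misses the idempotent \<open>s' r'\<close>:
  \<open>r'\<close> annihilates the image from the left, but \<open>r' s' r' = r' \<noteq> 0\<close>.\<close>

lemma dim_End_less:
  assumes fin: "\<And>X Y. \<lbrakk>X \<in> obj S; Y \<in> obj S\<rbrakk> \<Longrightarrow> \<exists>A. finite A \<and> module.span (scl S) A = hom S X Y"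
    and A: "retract_via S A Y s r" and C: "retract_via S C Y s' r'" and "r' \<cdot> s = 0" and "\<not> zero_obj S C"
  shows "hom_dim S A A < hom_dim S Y Y"
proof -
  interpret vector_space "scl S" by (rule ambient_vector_space)
  note d = A[unfolded retract_via_def] C[unfolded retract_via_def]
  obtain bA bY where b: "finite bA" "span bA = hom S A A" "finite bY" "span bY = hom S Y Y"
    using fin d by metis
  have fr: "f \<cdot> r \<in> hom S Y A" if "f \<in> hom S A A" for f using that d cmp_in_hom by metis
  have sfr: "s \<cdot> (f \<cdot> r) \<in> hom S Y Y" if "f \<in> hom S A A" for f using fr[OF that] d cmp_in_hom by metis
  have sr: "s' \<cdot> r' \<in> hom S Y Y" using d cmp_in_hom by metis
  show ?thesis unfolding hom_dim_def
  proof (rule dim_less_of_injection[OF b, where h = "\<lambda>f. s \<cdot> (f \<cdot> r)" and v = "s' \<cdot> r'"])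
    show "s \<cdot> ((f + g) \<cdot> r) = s \<cdot> (f \<cdot> r) + s \<cdot> (g \<cdot> r)" if "f \<in> hom S A A" "g \<in> hom S A A" for f g
      using d that fr by (simp add: cmp_add_left[of Y A A] cmp_add_right[of Y A Y])
    show "s \<cdot> (scl S c f \<cdot> r) = scl S c (s \<cdot> (f \<cdot> r))" if "f \<in> hom S A A" for c f
      using d that fr by (simp add: cmp_scl_left[of Y A A] cmp_scl_right[of Y A Y])
    show "f = 0" if f: "f \<in> hom S A A" "s \<cdot> (f \<cdot> r) = 0" for f
    proof -
      have "r \<cdot> (s \<cdot> (f \<cdot> r)) = f \<cdot> r"
        by (rule retract_via_cancel[OF A, of Y]) (use fr f d in auto)
      then have "f \<cdot> r = 0" using f d cmp_zero_right[of Y Y A r] by simp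
      moreover have "f = (f \<cdot> r) \<cdot> s" using f d retract_via_cancel'[OF A, of A] by simp
      ultimately show ?thesis using d cmp_zero_left[of A Y A s] by simp
    qed
    show "s' \<cdot> r' \<notin> (\<lambda>f. s \<cdot> (f \<cdot> r)) ` hom S A A"
    proof
      assume "s' \<cdot> r' \<in> (\<lambda>f. s \<cdot> (f \<cdot> r)) ` hom S A A"
      then obtain f where f: "f \<in> hom S A A" "s' \<cdot> r' = s \<cdot> (f \<cdot> r)" by blast
      have "r' = r' \<cdot> (s' \<cdot> r')" using d retract_via_cancel[OF C, of Y] by simp
      also have "\<dots> = (r' \<cdot> s) \<cdot> (f \<cdot> r)" using f fr d by (simp add: cmp_assoc[of Y A Y C])
      also have "\<dots> = 0" using assms f fr d by (simp add: cmp_zero_left[of Y A C])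
      finally have "idm S C = 0" using d cmp_zero_left[of C Y C s'] by simp
      then show False using assms d by (simp add: zero_obj_def)
    qed
  qed (use sfr sr in auto)
qed

text \<open>Splitting terminates because the endomorphism algebras of the parts have smaller dimension.\<close>

lemma exists_indecomposable_decomposition:
  assumes fin: "\<And>X Y. \<lbrakk>X \<in> obj S; Y \<in> obj S\<rbrakk> \<Longrightarrow> \<exists>A. finite A \<and> module.span (scl S) A = hom S X Y"
    and "Y \<in> obj S"
  shows "\<exists>Xs i p. direct_sum S Y Xs i p \<and> (\<forall>Z \<in> set Xs. indecomposable S Z)"
  using assms(2)
proof (induction "hom_dim S Y Y" arbitrary: Y rule: less_induct)
  case less
  consider "zero_obj S Y" | "indecomposable S Y" | "\<not> zero_obj S Y" "\<not> indecomposable S Y" by blast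
  then show ?case
  proof cases
    case 1
    then have "direct_sum S Y [] (\<lambda>_. 0) (\<lambda>_. 0)" by (simp add: direct_sum_def zero_obj_def)
    then show ?thesis by fastforce
  next
    case 2
    have "direct_sum S Y [Y] (\<lambda>_. idm S Y) (\<lambda>_. idm S Y)"
      using less.prems idm_in_hom cmp_idm[of Y Y "idm S Y"] by (simp add: direct_sum_def)
    then show ?thesis using 2 by fastforce
  next
    case 3
    then obtain A C i p where AC: "direct_sum S Y [A, C] i p" "\<not> zero_obj S A" "\<not> zero_obj S C"
      using less.prems by (auto simp: indecomposable_def)
    have vA: "retract_via S A Y (i 0) (p 0)" and vC: "retract_via S C Y (i 1) (p 1)"
      using direct_sum_retract_via[OF AC(1), of 0] direct_sum_retract_via[OF AC(1), of 1] by auto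
    have z: "p 1 \<cdot> i 0 = 0" "p 0 \<cdot> i 1 = 0" using AC(1) by (auto simp: direct_sum_def)
    obtain As i1 p1 where As: "direct_sum S A As i1 p1" "\<forall>Z \<in> set As. indecomposable S Z"
      using less.hyps[of A] dim_End_less[OF fin vA vC z(1) AC(3)] vA by (auto simp: retract_via_def)
    obtain Cs i2 p2 where Cs: "direct_sum S C Cs i2 p2" "\<forall>Z \<in> set Cs. indecomposable S Z"
      using less.hyps[of C] dim_End_less[OF fin vC vA z(2) AC(2)] vC by (auto simp: retract_via_def)
    obtain j q where "direct_sum S Y (As @ Cs) j q" using direct_sum_append[OF AC(1) As(1) Cs(1)] by blast
    moreover have "\<forall>Z \<in> set (As @ Cs). indecomposable S Z" using As Cs by auto
    ultimately show ?thesis by blast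
  qed
qed

end

section \<open>Coherence in monoidal categories\<close>

text \<open>Morphisms bundled with their source and target.  Composability of two arrows is then an equation
  between objects that rewriting can decide, whereas the hypotheses \<open>f \<in> hom S X Y\<close>,
  \<open>g \<in> hom S Y Z\<close> leave the middle object to be guessed.\<close>

datatype ('o, 'm) arrow = Arrow (src: 'o) (mor: 'm) (tgt: 'o)

context linear_category
begin

definition arr :: "('o, 'm) arrow \<Rightarrow> bool" where
  "arr f \<longleftrightarrow> src f \<in> obj S \<and> tgt f \<in> obj S \<and> mor f \<in> hom S (src f) (tgt f)"

definition arrow_cmp :: "('o, 'm) arrow \<Rightarrow> ('o, 'm) arrow \<Rightarrow> ('o, 'm) arrow" (infixr "\<bullet>" 70) where
  "g \<bullet> f = Arrow (src f) (mor g \<cdot> mor f) (tgt g)"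

definition ide :: "'o \<Rightarrow> ('o, 'm) arrow" where
  "ide X = Arrow X (idm S X) X"

lemma arr_Arrow: "\<lbrakk>X \<in> obj S; Y \<in> obj S; f \<in> hom S X Y\<rbrakk> \<Longrightarrow> arr (Arrow X f Y)"
  by (simp add: arr_def)

lemma arr_src [simp]: "arr f \<Longrightarrow> src f \<in> obj S"
  and arr_tgt [simp]: "arr f \<Longrightarrow> tgt f \<in> obj S"
  by (simp_all add: arr_def)

lemma ide_simps [simp]:
  "src (ide X) = X" "tgt (ide X) = X" "mor (ide X) = idm S X" "X \<in> obj S \<Longrightarrow> arr (ide X)"
  by (simp_all add: arr_def ide_def idm_in_hom del: arr_src arr_tgt)

lemma arrow_cmp_simps [simp]:
  "src (g \<bullet> f) = src f" "tgt (g \<bullet> f) = tgt g" "mor (g \<bullet> f) = mor g \<cdot> mor f"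
  "\<lbrakk>arr f; arr g; src g = tgt f\<rbrakk> \<Longrightarrow> arr (g \<bullet> f)"
  by (simp_all add: arr_def arrow_cmp_def cmp_in_hom[of "src f" "tgt f" "tgt g"] del: arr_src arr_tgt)

lemma arrow_cmp_assoc [simp]:
  "\<lbrakk>arr f; arr g; arr h; src g = tgt f; src h = tgt g\<rbrakk> \<Longrightarrow> (h \<bullet> g) \<bullet> f = h \<bullet> (g \<bullet> f)"
  using cmp_assoc[of "src f" "tgt f" "tgt g" "tgt h"] by (simp add: arr_def arrow_cmp_def del: arr_src arr_tgt)

lemma arrow_cmp_ide [simp]: "\<lbrakk>arr f; src f = X\<rbrakk> \<Longrightarrow> f \<bullet> ide X = f"
  using cmp_idm[of "src f" "tgt f"] by (cases f) (auto simp: arr_def arrow_cmp_def ide_def simp del: arr_src arr_tgt)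

lemma ide_arrow_cmp [simp]: "\<lbrakk>arr f; tgt f = X\<rbrakk> \<Longrightarrow> ide X \<bullet> f = f"
  using idm_cmp[of "src f" "tgt f"] by (cases f) (auto simp: arr_def arrow_cmp_def ide_def simp del: arr_src arr_tgt)

definition arrow_inverse :: "('o, 'm) arrow \<Rightarrow> ('o, 'm) arrow \<Rightarrow> bool" where
  "arrow_inverse f g \<longleftrightarrow> arr f \<and> arr g \<and> src g = tgt f \<and> tgt g = src f \<and>
     g \<bullet> f = ide (src f) \<and> f \<bullet> g = ide (tgt f)"

lemma arrow_inverse_cancel:
  assumes "arrow_inverse f g" "arr h"
  shows "tgt h = src f \<Longrightarrow> g \<bullet> f \<bullet> h = h" "tgt h = tgt f \<Longrightarrow> f \<bullet> g \<bullet> h = h"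
proof -
  note i = assms(1)[unfolded arrow_inverse_def]
  show "g \<bullet> f \<bullet> h = h" if "tgt h = src f"
  proof -
    have "g \<bullet> f \<bullet> h = (g \<bullet> f) \<bullet> h" using i that assms(2) arrow_cmp_assoc[of h f g] by metis
    then show ?thesis using i that assms(2) by simp
  qed
  show "f \<bullet> g \<bullet> h = h" if "tgt h = tgt f"
  proof -
    have "f \<bullet> g \<bullet> h = (f \<bullet> g) \<bullet> h" using i that assms(2) arrow_cmp_assoc[of h g f] by metis
    then show ?thesis using i that assms(2) by simp
  qed
qed

text \<open>This turns naturality of a constraint into naturality of its inverse.\<close>

lemma arrow_inverse_swap:
  assumes "arrow_inverse f f'" "arrow_inverse g g'" "f \<bullet> h = k \<bullet> g"
    "arr h" "arr k" "tgt h = src f" "src k = tgt g" "tgt k = tgt f" "src h = src g"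
  shows "h \<bullet> g' = f' \<bullet> k"
proof -
  note i = assms(1,2)[unfolded arrow_inverse_def]
  have "h \<bullet> g' = f' \<bullet> ((f \<bullet> h) \<bullet> g')"
    using i assms(4-) arrow_inverse_cancel(1)[OF assms(1), of "h \<bullet> g'"] by simp
  also have "\<dots> = f' \<bullet> ((k \<bullet> g) \<bullet> g')" unfolding assms(3) ..
  also have "\<dots> = f' \<bullet> k" using i assms(4-) by simp
  finally show ?thesis .
qed

lemma arrow_inverse_inv_mor:
  "\<lbrakk>X \<in> obj S; Y \<in> obj S; is_iso S X Y f\<rbrakk> \<Longrightarrow> arrow_inverse (Arrow X f Y) (Arrow Y (inv_mor S X Y f) X)"
  using inverse_pair_inv_mor[of X Y f]
  by (simp add: inverse_pair_def arrow_inverse_def arr_def arrow_cmp_def ide_def del: arr_src arr_tgt)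

lemma is_iso_inv_mor:
  "\<lbrakk>X \<in> obj S; Y \<in> obj S; is_iso S X Y f\<rbrakk> \<Longrightarrow> is_iso S Y X (inv_mor S X Y f)"
  using inverse_pair_inv_mor[of X Y f] by (auto simp: inverse_pair_def is_iso_def)

lemma inv_mor_inv_mor:
  assumes "X \<in> obj S" "Y \<in> obj S" "is_iso S X Y f"
  shows "inv_mor S Y X (inv_mor S X Y f) = f"
proof -
  let ?g = "inv_mor S X Y f"
  have 1: "arrow_inverse (Arrow X f Y) (Arrow Y ?g X)" using arrow_inverse_inv_mor assms by blast
  have 2: "arrow_inverse (Arrow Y ?g X) (Arrow X (inv_mor S Y X ?g) Y)"
    using arrow_inverse_inv_mor is_iso_inv_mor assms by blast
  have "Arrow X (inv_mor S Y X ?g) Y = Arrow X (inv_mor S Y X ?g) Y \<bullet> Arrow Y ?g X \<bullet> Arrow X f Y"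
    using 1 2 by (simp add: arrow_inverse_def)
  also have "\<dots> = Arrow X f Y"
    by (rule arrow_inverse_cancel(1)[OF 2]) (use 1 in \<open>simp_all add: arrow_inverse_def\<close>)
  finally show ?thesis by simp
qed

end

context linear_monoidal_category
begin

definition arrow_ten :: "('o, 'm) arrow \<Rightarrow> ('o, 'm) arrow \<Rightarrow> ('o, 'm) arrow" (infixr "\<star>" 75) where
  "f \<star> g = Arrow (src f \<odot> src g) (mor f \<otimes> mor g) (tgt f \<odot> tgt g)"

definition as :: "'o \<Rightarrow> 'o \<Rightarrow> 'o \<Rightarrow> ('o, 'm) arrow" where
  "as X Y Z = Arrow ((X \<odot> Y) \<odot> Z) (assoc S X Y Z) (X \<odot> Y \<odot> Z)"

definition asi :: "'o \<Rightarrow> 'o \<Rightarrow> 'o \<Rightarrow> ('o, 'm) arrow" where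
  "asi X Y Z = Arrow (X \<odot> Y \<odot> Z) (inv_mor S ((X \<odot> Y) \<odot> Z) (X \<odot> Y \<odot> Z) (assoc S X Y Z)) ((X \<odot> Y) \<odot> Z)"

definition lu :: "'o \<Rightarrow> ('o, 'm) arrow" where "lu X = Arrow (\<one> \<odot> X) (lunit S X) X"
definition lui :: "'o \<Rightarrow> ('o, 'm) arrow" where
  "lui X = Arrow X (inv_mor S (\<one> \<odot> X) X (lunit S X)) (\<one> \<odot> X)"
definition ru :: "'o \<Rightarrow> ('o, 'm) arrow" where "ru X = Arrow (X \<odot> \<one>) (runit S X) X"
definition rui :: "'o \<Rightarrow> ('o, 'm) arrow" where
  "rui X = Arrow X (inv_mor S (X \<odot> \<one>) X (runit S X)) (X \<odot> \<one>)"

lemmas [simp] = unit_in_obj ten_in_obj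

lemma arrow_ten_simps [simp]:
  "src (f \<star> g) = src f \<odot> src g" "tgt (f \<star> g) = tgt f \<odot> tgt g" "mor (f \<star> g) = mor f \<otimes> mor g"
  "\<lbrakk>arr f; arr g\<rbrakk> \<Longrightarrow> arr (f \<star> g)"
  by (simp_all add: arr_def arrow_ten_def tenm_in_hom del: arr_src arr_tgt)

lemma interchange:
  "\<lbrakk>arr f; arr f'; arr g; arr g'; src f' = tgt f; src g' = tgt g\<rbrakk>
    \<Longrightarrow> (f' \<star> g') \<bullet> (f \<star> g) = (f' \<bullet> f) \<star> (g' \<bullet> g)"
  using tenm_cmp[of "src f" "tgt f" "tgt f'" "src g" "tgt g" "tgt g'"]
  by (simp add: arr_def arrow_ten_def arrow_cmp_def del: arr_src arr_tgt)

lemma interchange_cmp: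
  "\<lbrakk>arr f; arr f'; arr g; arr g'; src f' = tgt f; src g' = tgt g; arr h; tgt h = src f \<odot> src g\<rbrakk>
    \<Longrightarrow> (f' \<star> g') \<bullet> (f \<star> g) \<bullet> h = ((f' \<bullet> f) \<star> (g' \<bullet> g)) \<bullet> h"
  using arrow_cmp_assoc[of h "f \<star> g" "f' \<star> g'", symmetric] by (simp add: interchange)

lemma ide_ten [simp]: "\<lbrakk>X \<in> obj S; Y \<in> obj S\<rbrakk> \<Longrightarrow> ide X \<star> ide Y = ide (X \<odot> Y)"
  by (simp add: arrow_ten_def ide_def tenm_idm)

lemma as_inverse: "\<lbrakk>X \<in> obj S; Y \<in> obj S; Z \<in> obj S\<rbrakk> \<Longrightarrow> arrow_inverse (as X Y Z) (asi X Y Z)"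
  unfolding as_def asi_def by (intro arrow_inverse_inv_mor assoc_iso) auto

lemma lu_inverse: "X \<in> obj S \<Longrightarrow> arrow_inverse (lu X) (lui X)"
  unfolding lu_def lui_def by (intro arrow_inverse_inv_mor lunit_iso) auto

lemma ru_inverse: "X \<in> obj S \<Longrightarrow> arrow_inverse (ru X) (rui X)"
  unfolding ru_def rui_def by (intro arrow_inverse_inv_mor runit_iso) auto

lemma src_tgt [simp]:
  "src (as X Y Z) = (X \<odot> Y) \<odot> Z" "tgt (as X Y Z) = X \<odot> Y \<odot> Z"
  "src (asi X Y Z) = X \<odot> Y \<odot> Z" "tgt (asi X Y Z) = (X \<odot> Y) \<odot> Z"
  "src (lu X) = \<one> \<odot> X" "tgt (lu X) = X" "src (lui X) = X" "tgt (lui X) = \<one> \<odot> X"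
  "src (ru X) = X \<odot> \<one>" "tgt (ru X) = X" "src (rui X) = X" "tgt (rui X) = X \<odot> \<one>"
  by (simp_all add: as_def asi_def lu_def lui_def ru_def rui_def)

lemma arr_constraint [simp]:
  "\<lbrakk>X \<in> obj S; Y \<in> obj S; Z \<in> obj S\<rbrakk> \<Longrightarrow> arr (as X Y Z)"
  "\<lbrakk>X \<in> obj S; Y \<in> obj S; Z \<in> obj S\<rbrakk> \<Longrightarrow> arr (asi X Y Z)"
  "X \<in> obj S \<Longrightarrow> arr (lu X)" "X \<in> obj S \<Longrightarrow> arr (lui X)"
  "X \<in> obj S \<Longrightarrow> arr (ru X)" "X \<in> obj S \<Longrightarrow> arr (rui X)"
  using as_inverse lu_inverse ru_inverse by (auto simp: arrow_inverse_def)

lemma constraint_inverse [simp]: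
  "\<lbrakk>X \<in> obj S; Y \<in> obj S; Z \<in> obj S\<rbrakk> \<Longrightarrow> asi X Y Z \<bullet> as X Y Z = ide ((X \<odot> Y) \<odot> Z)"
  "\<lbrakk>X \<in> obj S; Y \<in> obj S; Z \<in> obj S\<rbrakk> \<Longrightarrow> as X Y Z \<bullet> asi X Y Z = ide (X \<odot> Y \<odot> Z)"
  "X \<in> obj S \<Longrightarrow> lui X \<bullet> lu X = ide (\<one> \<odot> X)" "X \<in> obj S \<Longrightarrow> lu X \<bullet> lui X = ide X"
  "X \<in> obj S \<Longrightarrow> rui X \<bullet> ru X = ide (X \<odot> \<one>)" "X \<in> obj S \<Longrightarrow> ru X \<bullet> rui X = ide X"
  using as_inverse[of X Y Z] lu_inverse[of X] ru_inverse[of X] by (auto simp: arrow_inverse_def)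

lemma as_naturality:
  "\<lbrakk>arr f; arr g; arr h\<rbrakk>
    \<Longrightarrow> as (tgt f) (tgt g) (tgt h) \<bullet> ((f \<star> g) \<star> h) = (f \<star> (g \<star> h)) \<bullet> as (src f) (src g) (src h)"
  using assoc_natural[of "src f" "tgt f" "src g" "tgt g" "src h" "tgt h" "mor f" "mor g" "mor h"]
  by (simp add: arr_def as_def arrow_cmp_def arrow_ten_def del: arr_src arr_tgt)

lemma asi_naturality:
  assumes "arr f" "arr g" "arr h"
  shows "((f \<star> g) \<star> h) \<bullet> asi (src f) (src g) (src h) = asi (tgt f) (tgt g) (tgt h) \<bullet> (f \<star> (g \<star> h))"
  by (rule arrow_inverse_swap[OF as_inverse as_inverse as_naturality]) (use assms in simp_all)

lemma lu_naturality: "arr f \<Longrightarrow> lu (tgt f) \<bullet> (ide \<one> \<star> f) = f \<bullet> lu (src f)"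
  using lunit_natural[of "src f" "tgt f" "mor f"]
  by (cases f) (simp add: arr_def lu_def arrow_cmp_def arrow_ten_def ide_def del: arr_src arr_tgt)

lemma ru_naturality: "arr f \<Longrightarrow> ru (tgt f) \<bullet> (f \<star> ide \<one>) = f \<bullet> ru (src f)"
  using runit_natural[of "src f" "tgt f" "mor f"]
  by (cases f) (simp add: arr_def ru_def arrow_cmp_def arrow_ten_def ide_def del: arr_src arr_tgt)

lemma lui_naturality:
  assumes "arr f"
  shows "(ide \<one> \<star> f) \<bullet> lui (src f) = lui (tgt f) \<bullet> f"
  by (rule arrow_inverse_swap[OF lu_inverse lu_inverse lu_naturality]) (use assms in simp_all)

lemma rui_naturality:
  assumes "arr f"
  shows "(f \<star> ide \<one>) \<bullet> rui (src f) = rui (tgt f) \<bullet> f"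
  by (rule arrow_inverse_swap[OF ru_inverse ru_inverse ru_naturality]) (use assms in simp_all)

lemma arrow_pentagon:
  "\<lbrakk>W \<in> obj S; X \<in> obj S; Y \<in> obj S; Z \<in> obj S\<rbrakk>
    \<Longrightarrow> (ide W \<star> as X Y Z) \<bullet> as W (X \<odot> Y) Z \<bullet> (as W X Y \<star> ide Z) = as W X (Y \<odot> Z) \<bullet> as (W \<odot> X) Y Z"
  using pentagon[of W X Y Z] by (simp add: as_def arrow_cmp_def arrow_ten_def ide_def)

lemma arrow_triangle:
  "\<lbrakk>X \<in> obj S; Y \<in> obj S\<rbrakk> \<Longrightarrow> (ide X \<star> lu Y) \<bullet> as X \<one> Y = ru X \<star> ide Y"
  using triangle[of X Y] by (simp add: as_def lu_def ru_def arrow_cmp_def arrow_ten_def ide_def)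

text \<open>Tensoring with the unit object is isomorphic to the identity functor, hence faithful.\<close>

lemma ide_unit_ten_cancel:
  assumes "ide \<one> \<star> f = ide \<one> \<star> g" "arr f" "arr g" "src f = src g" "tgt f = tgt g"
  shows "f = g"
proof -
  have *: "f = lu (tgt f) \<bullet> (ide \<one> \<star> f) \<bullet> lui (src f)" if "arr f" for f
    using that arrow_inverse_cancel(2)[OF lu_inverse[of "tgt f"] that] by (simp add: lui_naturality)
  show ?thesis using *[of f] *[of g] assms by simp
qed

lemma ten_ide_unit_cancel:
  assumes "f \<star> ide \<one> = g \<star> ide \<one>" "arr f" "arr g" "src f = src g" "tgt f = tgt g"
  shows "f = g"
proof -
  have *: "f = ru (tgt f) \<bullet> (f \<star> ide \<one>) \<bullet> rui (src f)" if "arr f" for f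
    using that arrow_inverse_cancel(2)[OF ru_inverse[of "tgt f"] that] by (simp add: rui_naturality)
  show ?thesis using *[of f] *[of g] assms by simp
qed

text \<open>Kelly's argument: after tensoring with \<open>1\<close> on the left and composing with associators, both
  sides become \<open>(r\<^sub>1 \<otimes> X) \<otimes> Y\<close> followed by an associator, the left one by the pentagon, the
  triangle and naturality, the right one by naturality and the triangle.\<close>

lemma lu_ten:
  assumes X: "X \<in> obj S" and Y: "Y \<in> obj S"
  shows "lu (X \<odot> Y) \<bullet> as \<one> X Y = lu X \<star> ide Y"
proof (rule ide_unit_ten_cancel)
  \<comment> \<open>the part of the pentagon to be cancelled, and its inverse\<close>
  let ?u = "as \<one> (\<one> \<odot> X) Y \<bullet> (as \<one> \<one> X \<star> ide Y)"
  let ?v = "(asi \<one> \<one> X \<star> ide Y) \<bullet> asi \<one> (\<one> \<odot> X) Y"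
  let ?A = "ide \<one> \<star> (lu (X \<odot> Y) \<bullet> as \<one> X Y)" and ?B = "ide \<one> \<star> (lu X \<star> ide Y)"
  have "?A = (ide \<one> \<star> lu (X \<odot> Y)) \<bullet> (ide \<one> \<star> as \<one> X Y)" using X Y by (simp add: interchange)
  then have "?A \<bullet> ?u = (ide \<one> \<star> lu (X \<odot> Y)) \<bullet> ((ide \<one> \<star> as \<one> X Y) \<bullet> ?u)" using X Y by simp
  also have "\<dots> = ((ide \<one> \<star> lu (X \<odot> Y)) \<bullet> as \<one> \<one> (X \<odot> Y)) \<bullet> as (\<one> \<odot> \<one>) X Y"
    using X Y by (simp add: arrow_pentagon)
  also have "\<dots> = (ru \<one> \<star> (ide X \<star> ide Y)) \<bullet> as (\<one> \<odot> \<one>) X Y"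
    using X Y by (simp add: arrow_triangle del: arrow_cmp_assoc)
  also have "\<dots> = as \<one> X Y \<bullet> ((ru \<one> \<star> ide X) \<star> ide Y)"
    using X Y as_naturality[of "ru \<one>" "ide X" "ide Y"] by simp
  also have "\<dots> = as \<one> X Y \<bullet> ((ide \<one> \<star> lu X) \<star> ide Y) \<bullet> (as \<one> \<one> X \<star> ide Y)"
    using X Y by (simp add: interchange arrow_triangle)
  also have "\<dots> = ?B \<bullet> ?u"
    using X Y as_naturality[of "ide \<one>" "lu X" "ide Y"]
    by (simp flip: arrow_cmp_assoc)
  finally have eq: "?A \<bullet> ?u = ?B \<bullet> ?u" .
  have uv: "?u \<bullet> ?v = ide (\<one> \<odot> ((\<one> \<odot> X) \<odot> Y))"
    using X Y by (simp add: interchange_cmp)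
  have "?A = ?A \<bullet> (?u \<bullet> ?v)" unfolding uv using X Y by simp
  also have "\<dots> = (?A \<bullet> ?u) \<bullet> ?v" using X Y by simp
  also have "\<dots> = ?B \<bullet> (?u \<bullet> ?v)" unfolding eq using X Y by simp
  also have "\<dots> = ?B" unfolding uv using X Y by simp
  finally show "?A = ?B" .
qed (use X Y in simp_all)

text \<open>Naturality of the left unit constraint at itself gives \<open>1 \<otimes> l\<^sub>1 = l\<^bsub>1 \<otimes> 1\<^esub>\<close>; so by \<open>lu_ten\<close>
  and the triangle \<open>l\<^sub>1 \<otimes> 1\<close> and \<open>r\<^sub>1 \<otimes> 1\<close> agree.\<close>

lemma lu_unit: "lu \<one> = ru \<one>"
proof (rule ten_ide_unit_cancel)
  have l: "lu \<one> \<bullet> (ide \<one> \<star> lu \<one>) = lu \<one> \<bullet> lu (\<one> \<odot> \<one>)" using lu_naturality[of "lu \<one>"] by simp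
  have "lui \<one> \<bullet> (lu \<one> \<bullet> (ide \<one> \<star> lu \<one>)) = lui \<one> \<bullet> (lu \<one> \<bullet> lu (\<one> \<odot> \<one>))" using l by simp
  then have "ide \<one> \<star> lu \<one> = lu (\<one> \<odot> \<one>)" by (simp add: arrow_inverse_cancel(1)[OF lu_inverse])
  then show "lu \<one> \<star> ide \<one> = ru \<one> \<star> ide \<one>"
    using lu_ten[of \<one> \<one>] arrow_triangle[of \<one> \<one>] by simp
qed simp_all

end

section \<open>Reversing the tensor product\<close>

text \<open>
  Left and right duals trade places under this construction, as do left and right cells; a
  statement about one side for all categories therefore contains the statement about the other.
\<close>

definition reverse :: "('o, 'm, 'k, 'z) moncat_scheme \<Rightarrow> ('o, 'm, 'k, 'z) moncat_scheme" where
  "reverse S = S\<lparr>ten := \<lambda>X Y. ten S Y X, tenm := \<lambda>f g. tenm S g f,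
     assoc := \<lambda>X Y Z. inv_mor S ((Z \<odot>\<^bsub>S\<^esub> Y) \<odot>\<^bsub>S\<^esub> X) (Z \<odot>\<^bsub>S\<^esub> Y \<odot>\<^bsub>S\<^esub> X) (assoc S Z Y X),
     lunit := runit S, runit := lunit S\<rparr>"

lemma reverse_simps [simp]:
  "obj (reverse S) = obj S" "hom (reverse S) = hom S" "idm (reverse S) = idm S" "cmp (reverse S) = cmp S"
  "scl (reverse S) = scl S" "ten (reverse S) X Y = Y \<odot>\<^bsub>S\<^esub> X" "tenm (reverse S) f g = g \<otimes>\<^bsub>S\<^esub> f"
  "unit_obj (reverse S) = \<one>\<^bsub>S\<^esub>" "lunit (reverse S) = runit S" "runit (reverse S) = lunit S"
  "assoc (reverse S) X Y Z = inv_mor S ((Z \<odot>\<^bsub>S\<^esub> Y) \<odot>\<^bsub>S\<^esub> X) (Z \<odot>\<^bsub>S\<^esub> Y \<odot>\<^bsub>S\<^esub> X) (assoc S Z Y X)"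
  by (simp_all add: reverse_def)

lemma reverse_same [simp]:
  "is_iso (reverse S) = is_iso S" "inv_mor (reverse S) = inv_mor S"
  "isomorphic (reverse S) = isomorphic S"
  "direct_sum (reverse S) = direct_sum S" "is_summand (reverse S) = is_summand S"
  "zero_obj (reverse S) = zero_obj S" "indecomposable (reverse S) = indecomposable S"
  "hom_dim (reverse S) = hom_dim S" "retract (reverse S) = retract S"
  "nonzero_hom (reverse S) = nonzero_hom S"
  by (simp_all add: fun_eq_iff is_iso_def inv_mor_def isomorphic_def inverse_pair_def direct_sum_def
    is_summand_def zero_obj_def indecomposable_def hom_dim_def retract_def retract_via_def nonzero_hom_def)

context linear_monoidal_category
begin

lemma asi_pentagon:
  assumes "W \<in> obj S" "X \<in> obj S" "Y \<in> obj S" "Z \<in> obj S"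
  shows "(asi W X Y \<star> ide Z) \<bullet> asi W (X \<odot> Y) Z \<bullet> (ide W \<star> asi X Y Z) = asi (W \<odot> X) Y Z \<bullet> asi W X (Y \<odot> Z)"
proof -
  let ?p = "(ide W \<star> as X Y Z) \<bullet> as W (X \<odot> Y) Z \<bullet> (as W X Y \<star> ide Z)"
  let ?q = "(asi W X Y \<star> ide Z) \<bullet> asi W (X \<odot> Y) Z \<bullet> (ide W \<star> asi X Y Z)"
  let ?r = "asi (W \<odot> X) Y Z \<bullet> asi W X (Y \<odot> Z)"
  note c = arrow_inverse_cancel[OF as_inverse]
  have "?p \<bullet> ?q = ide (W \<odot> X \<odot> Y \<odot> Z)"
    using assms by (simp add: interchange_cmp c interchange)
  moreover have "?r \<bullet> ?p = ide (((W \<odot> X) \<odot> Y) \<odot> Z)"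
    using assms by (simp add: arrow_pentagon c)
  moreover have "?r \<bullet> (?p \<bullet> ?q) = (?r \<bullet> ?p) \<bullet> ?q" using assms by simp
  ultimately show ?thesis using assms by simp
qed

lemma asi_triangle:
  assumes "X \<in> obj S" "Y \<in> obj S"
  shows "(ru X \<star> ide Y) \<bullet> asi X \<one> Y = ide X \<star> lu Y"
proof -
  have "((ide X \<star> lu Y) \<bullet> as X \<one> Y) \<bullet> asi X \<one> Y = ide X \<star> lu Y" using assms by simp
  then show ?thesis using assms by (simp add: arrow_triangle del: arrow_cmp_assoc)
qed

lemma reverse_linear_monoidal_category: "linear_monoidal_category (reverse S)"
proof (intro linear_monoidal_category.intro linear_category.intro linear_monoidal_category_axioms.intro)
  show "vector_space (scl (reverse S))" using ambient_vector_space by simp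
  show "scl (reverse S) c g \<cdot>\<^bsub>reverse S\<^esub> f = scl (reverse S) c (g \<cdot>\<^bsub>reverse S\<^esub> f)"
    "g \<cdot>\<^bsub>reverse S\<^esub> scl (reverse S) c f = scl (reverse S) c (g \<cdot>\<^bsub>reverse S\<^esub> f)"
    if "X \<in> obj (reverse S)" "Y \<in> obj (reverse S)" "Z \<in> obj (reverse S)"
      "f \<in> hom (reverse S) X Y" "g \<in> hom (reverse S) Y Z" for X Y Z f g c
    using that cmp_scl_left[of X Y Z f g] cmp_scl_right[of X Y Z f g] by simp_all
next
  fix W X Y Z assume "W \<in> obj (reverse S)" "X \<in> obj (reverse S)" "Y \<in> obj (reverse S)" "Z \<in> obj (reverse S)"
  then show "(idm (reverse S) W \<otimes>\<^bsub>reverse S\<^esub> assoc (reverse S) X Y Z) \<cdot>\<^bsub>reverse S\<^esub>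
      assoc (reverse S) W (X \<odot>\<^bsub>reverse S\<^esub> Y) Z \<cdot>\<^bsub>reverse S\<^esub>
      (assoc (reverse S) W X Y \<otimes>\<^bsub>reverse S\<^esub> idm (reverse S) Z) =
      assoc (reverse S) W X (Y \<odot>\<^bsub>reverse S\<^esub> Z) \<cdot>\<^bsub>reverse S\<^esub> assoc (reverse S) (W \<odot>\<^bsub>reverse S\<^esub> X) Y Z"
    using arg_cong[OF asi_pentagon[of Z Y X W], of mor] by (simp add: asi_def)
next
  fix X Y assume "X \<in> obj (reverse S)" "Y \<in> obj (reverse S)"
  then show "(idm (reverse S) X \<otimes>\<^bsub>reverse S\<^esub> lunit (reverse S) Y) \<cdot>\<^bsub>reverse S\<^esub> assoc (reverse S) X \<one>\<^bsub>reverse S\<^esub> Y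
      = runit (reverse S) X \<otimes>\<^bsub>reverse S\<^esub> idm (reverse S) Y"
    using arg_cong[OF asi_triangle[of Y X], of mor] by (simp add: asi_def lu_def ru_def)
next
  fix X X' Y Y' Z Z' f g h
  assume "X \<in> obj (reverse S)" "X' \<in> obj (reverse S)" "Y \<in> obj (reverse S)" "Y' \<in> obj (reverse S)"
    "Z \<in> obj (reverse S)" "Z' \<in> obj (reverse S)"
    "f \<in> hom (reverse S) X X'" "g \<in> hom (reverse S) Y Y'" "h \<in> hom (reverse S) Z Z'"
  then show "assoc (reverse S) X' Y' Z' \<cdot>\<^bsub>reverse S\<^esub> ((f \<otimes>\<^bsub>reverse S\<^esub> g) \<otimes>\<^bsub>reverse S\<^esub> h) =
      (f \<otimes>\<^bsub>reverse S\<^esub> (g \<otimes>\<^bsub>reverse S\<^esub> h)) \<cdot>\<^bsub>reverse S\<^esub> assoc (reverse S) X Y Z"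
    using arg_cong[OF asi_naturality[of "Arrow Z h Z'" "Arrow Y g Y'" "Arrow X f X'"], of mor]
    by (simp add: asi_def arr_def del: arr_src arr_tgt)
next
  fix X Y Z assume "X \<in> obj (reverse S)" "Y \<in> obj (reverse S)" "Z \<in> obj (reverse S)"
  then show "is_iso (reverse S) ((X \<odot>\<^bsub>reverse S\<^esub> Y) \<odot>\<^bsub>reverse S\<^esub> Z) (X \<odot>\<^bsub>reverse S\<^esub> Y \<odot>\<^bsub>reverse S\<^esub> Z) (assoc (reverse S) X Y Z)"
    by (simp add: is_iso_inv_mor assoc_iso)
qed (simp_all add: hom_subspace idm_in_hom cmp_in_hom cmp_idm idm_cmp cmp_assoc cmp_add_left cmp_add_right
    tenm_in_hom tenm_idm tenm_cmp tenm_add_left tenm_add_right tenm_scl_left tenm_scl_right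
    lunit_iso lunit_natural runit_iso runit_natural)

lemma reverse_is_left_dual:
  assumes "is_left_dual S X Y e c"
  shows "is_left_dual (reverse S) Y X e c"
proof -
  have "X \<in> obj S" "Y \<in> obj S" using assms by (auto simp: is_left_dual_def)
  then show ?thesis using assms
    by (simp add: is_left_dual_def inv_mor_inv_mor assoc_iso)
qed

text \<open>This is \<open>lu_ten\<close> for the reversed category.\<close>

lemma ru_ten:
  assumes X: "X \<in> obj S" and Y: "Y \<in> obj S"
  shows "ru (X \<odot> Y) = (ide X \<star> ru Y) \<bullet> as X Y \<one>"
proof -
  interpret r: linear_monoidal_category "reverse S" by (rule reverse_linear_monoidal_category)
  have "ru (X \<odot> Y) \<bullet> asi X Y \<one> = ide X \<star> ru Y"
    using arg_cong[OF r.lu_ten[of Y X], of mor] X Y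
    by (simp add: r.lu_def r.as_def ru_def asi_def arrow_cmp_def arrow_ten_def ide_def)
  then have "(ide X \<star> ru Y) \<bullet> as X Y \<one> = (ru (X \<odot> Y) \<bullet> asi X Y \<one>) \<bullet> as X Y \<one>" by simp
  then show ?thesis using X Y by simp
qed

end

context linear_monoidal_category
begin

section \<open>Transposition along a duality\<close>

text \<open>This is one half of the bijection \<open>Hom(X, C) \<simeq> Hom(1, C \<otimes> Y)\<close>.  A preimage of \<open>g\<close> is
  \<open>X \<rightarrow> (C \<otimes> Y) \<otimes> X \<rightarrow> C \<otimes> (Y \<otimes> X) \<rightarrow> C\<close>, built from \<open>g\<close> and \<open>e\<close>.  By naturality, \<open>g\<close> can be
  moved to the right end of \<open>(f \<otimes> Y) c\<close>, and what remains on its left is \<open>C\<close> tensored with the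
  second zigzag identity.\<close>

lemma transpose_surj:
  assumes dual: "is_left_dual S X Y e c" and C: "C \<in> obj S" and g: "g \<in> hom S \<one> (C \<odot> Y)"
  shows "\<exists>f \<in> hom S X C. g = (f \<otimes> idm S Y) \<cdot> c"
proof -
  have X: "X \<in> obj S" and Y: "Y \<in> obj S" and e: "e \<in> hom S (Y \<odot> X) \<one>" and c: "c \<in> hom S \<one> (X \<odot> Y)"
    using dual by (auto simp: is_left_dual_def)
  define E where "E = Arrow (Y \<odot> X) e \<one>"
  define K where "K = Arrow \<one> c (X \<odot> Y)"
  define G where "G = Arrow \<one> g (C \<odot> Y)"
  have E [simp]: "arr E" "src E = Y \<odot> X" "tgt E = \<one>" unfolding E_def using X Y e by (auto intro: arr_Arrow)
  have K [simp]: "arr K" "src K = \<one>" "tgt K = X \<odot> Y" unfolding K_def using X Y c by (auto intro: arr_Arrow)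
  have G [simp]: "arr G" "src G = \<one>" "tgt G = C \<odot> Y" unfolding G_def using C Y g by (auto intro: arr_Arrow)
  note [simp] = X Y C
  have zigzag: "lu Y \<bullet> (E \<star> ide Y) \<bullet> asi Y X Y \<bullet> (ide Y \<star> K) \<bullet> rui Y = ide Y"
    using dual by (simp add: is_left_dual_def lu_def asi_def rui_def E_def K_def arrow_cmp_def arrow_ten_def ide_def)
  define F where "F = ru C \<bullet> (ide C \<star> E) \<bullet> as C Y X \<bullet> (G \<star> ide X) \<bullet> lui X"
  have F: "arr F" "src F = X" "tgt F = C" by (simp_all add: F_def)
  let ?A = "(ru C \<star> ide Y) \<bullet> ((ide C \<star> E) \<star> ide Y) \<bullet> (as C Y X \<star> ide Y)"
  \<comment> \<open>moving \<open>g\<close> to the right end\<close>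
  have s1: "(lui X \<star> ide Y) \<bullet> K = asi \<one> X Y \<bullet> lui (X \<odot> Y) \<bullet> K"
  proof -
    have "(lui X \<star> ide Y) \<bullet> (lu (X \<odot> Y) \<bullet> as \<one> X Y) \<bullet> asi \<one> X Y \<bullet> lui (X \<odot> Y) = lui X \<star> ide Y"
      using arrow_inverse_cancel(2)[OF as_inverse, of \<one> X Y "lui (X \<odot> Y)"] by simp
    moreover have "(lui X \<star> ide Y) \<bullet> (lu (X \<odot> Y) \<bullet> as \<one> X Y) \<bullet> asi \<one> X Y \<bullet> lui (X \<odot> Y)
        = asi \<one> X Y \<bullet> lui (X \<odot> Y)"
      by (simp add: lu_ten interchange_cmp del: arrow_cmp_assoc)
    ultimately show ?thesis by (metis F(1) K(1,3) arr_constraint(2,4) arrow_cmp_assoc X Y src_tgt(3,7,8) unit_in_obj ten_in_obj)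
  qed
  have s2: "lui (X \<odot> Y) \<bullet> K = (ide \<one> \<star> K) \<bullet> lui \<one>" using lui_naturality[of K] by simp
  have s3: "((G \<star> ide X) \<star> ide Y) \<bullet> asi \<one> X Y = asi (C \<odot> Y) X Y \<bullet> (G \<star> ide (X \<odot> Y))"
    using asi_naturality[of G "ide X" "ide Y"] by simp
  have s4: "(G \<star> ide (X \<odot> Y)) \<bullet> (ide \<one> \<star> K) = (ide (C \<odot> Y) \<star> K) \<bullet> (G \<star> ide \<one>)"
    by (simp add: interchange)
  have "lui \<one> = rui \<one>" by (simp add: lui_def rui_def lu_unit[unfolded lu_def ru_def, simplified])
  then have s5: "(G \<star> ide \<one>) \<bullet> lui \<one> = rui (C \<odot> Y) \<bullet> G" using rui_naturality[of G] by simp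
  have "(F \<star> ide Y) \<bullet> K = ?A \<bullet> ((G \<star> ide X) \<star> ide Y) \<bullet> (lui X \<star> ide Y) \<bullet> K"
    by (simp add: F_def interchange_cmp)
  also have "\<dots> = ?A \<bullet> (((G \<star> ide X) \<star> ide Y) \<bullet> asi \<one> X Y) \<bullet> (ide \<one> \<star> K) \<bullet> lui \<one>"
    unfolding s1 s2 by simp
  also have "\<dots> = ?A \<bullet> asi (C \<odot> Y) X Y \<bullet> ((G \<star> ide (X \<odot> Y)) \<bullet> (ide \<one> \<star> K)) \<bullet> lui \<one>"
    unfolding s3 by simp
  also have "\<dots> = ?A \<bullet> asi (C \<odot> Y) X Y \<bullet> (ide (C \<odot> Y) \<star> K) \<bullet> (G \<star> ide \<one>) \<bullet> lui \<one>"
    unfolding s4 by simp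
  also have "\<dots> = (?A \<bullet> asi (C \<odot> Y) X Y \<bullet> (ide (C \<odot> Y) \<star> K) \<bullet> rui (C \<odot> Y)) \<bullet> G"
    unfolding s5 by simp
  also have "?A \<bullet> asi (C \<odot> Y) X Y \<bullet> (ide (C \<odot> Y) \<star> K) \<bullet> rui (C \<odot> Y) = ide (C \<odot> Y)"
  proof -
    \<comment> \<open>pulling \<open>C\<close> out of every factor\<close>
    have t2: "as C \<one> Y \<bullet> ((ide C \<star> E) \<star> ide Y) = (ide C \<star> (E \<star> ide Y)) \<bullet> as C (Y \<odot> X) Y"
      using as_naturality[of "ide C" E "ide Y"] by simp
    have t3: "as C (Y \<odot> X) Y \<bullet> (as C Y X \<star> ide Y) \<bullet> asi (C \<odot> Y) X Y = (ide C \<star> asi Y X Y) \<bullet> as C Y (X \<odot> Y)"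
    proof -
      have "(ide C \<star> asi Y X Y) \<bullet> ((ide C \<star> as Y X Y) \<bullet> as C (Y \<odot> X) Y \<bullet> (as C Y X \<star> ide Y)) \<bullet> asi (C \<odot> Y) X Y
          = as C (Y \<odot> X) Y \<bullet> (as C Y X \<star> ide Y) \<bullet> asi (C \<odot> Y) X Y"
        by (simp add: interchange_cmp)
      then show ?thesis by (simp add: arrow_pentagon)
    qed
    have t4: "as C Y (X \<odot> Y) \<bullet> (ide (C \<odot> Y) \<star> K) = (ide C \<star> (ide Y \<star> K)) \<bullet> as C Y \<one>"
      using as_naturality[of "ide C" "ide Y" K] by simp
    have t5: "as C Y \<one> \<bullet> rui (C \<odot> Y) = ide C \<star> rui Y"
    proof -
      have "(ide C \<star> rui Y) \<bullet> ru (C \<odot> Y) \<bullet> rui (C \<odot> Y) = ide C \<star> rui Y" by simp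
      then show ?thesis by (simp add: ru_ten interchange_cmp)
    qed
    have "?A \<bullet> asi (C \<odot> Y) X Y \<bullet> (ide (C \<odot> Y) \<star> K) \<bullet> rui (C \<odot> Y)
       = (ide C \<star> lu Y) \<bullet> (as C \<one> Y \<bullet> ((ide C \<star> E) \<star> ide Y)) \<bullet> (as C Y X \<star> ide Y) \<bullet> asi (C \<odot> Y) X Y
          \<bullet> (ide (C \<odot> Y) \<star> K) \<bullet> rui (C \<odot> Y)"
      by (simp flip: arrow_triangle)
    also have "\<dots> = (ide C \<star> lu Y) \<bullet> (ide C \<star> (E \<star> ide Y)) \<bullet>
        (as C (Y \<odot> X) Y \<bullet> (as C Y X \<star> ide Y) \<bullet> asi (C \<odot> Y) X Y) \<bullet> (ide (C \<odot> Y) \<star> K) \<bullet> rui (C \<odot> Y)"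
      unfolding t2 by simp
    also have "\<dots> = (ide C \<star> lu Y) \<bullet> (ide C \<star> (E \<star> ide Y)) \<bullet> (ide C \<star> asi Y X Y) \<bullet>
        (as C Y (X \<odot> Y) \<bullet> (ide (C \<odot> Y) \<star> K)) \<bullet> rui (C \<odot> Y)"
      unfolding t3 by simp
    also have "\<dots> = (ide C \<star> lu Y) \<bullet> (ide C \<star> (E \<star> ide Y)) \<bullet> (ide C \<star> asi Y X Y) \<bullet>
        (ide C \<star> (ide Y \<star> K)) \<bullet> (as C Y \<one> \<bullet> rui (C \<odot> Y))"
      unfolding t4 by simp
    also have "\<dots> = ide C \<star> (lu Y \<bullet> (E \<star> ide Y) \<bullet> asi Y X Y \<bullet> (ide Y \<star> K) \<bullet> rui Y)"
      unfolding t5 by (simp add: interchange)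
    also have "\<dots> = ide (C \<odot> Y)" unfolding zigzag by simp
    finally show ?thesis .
  qed
  finally have eq: "(F \<star> ide Y) \<bullet> K = G" by simp
  have "(mor F \<otimes> idm S Y) \<cdot> c = g"
    using arg_cong[OF eq, of mor] by (simp add: K_def G_def)
  moreover have "mor F \<in> hom S X C" using F by (auto simp: arr_def simp del: arr_src arr_tgt)
  ultimately show ?thesis by blast
qed

end

section \<open>Grading shifts\<close>

context linear_category
begin

lemma functor_in_obj: "\<lbrakk>linear_endofunctor S F Fm; X \<in> obj S\<rbrakk> \<Longrightarrow> F X \<in> obj S"
  by (simp add: linear_endofunctor_def)

lemma functor_retract_via:
  assumes F: "linear_endofunctor S F Fm" and "retract_via S X Y s r"
  shows "retract_via S (F X) (F Y) (Fm s) (Fm r)"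
proof -
  note d = assms(2)[unfolded retract_via_def] and F = F[unfolded linear_endofunctor_def]
  have "Fm r \<cdot> Fm s = idm S (F X)" using d F by metis
  then show ?thesis using d F by (simp add: retract_via_def)
qed

lemma functor_retract:
  "\<lbrakk>linear_endofunctor S F Fm; retract S X Y\<rbrakk> \<Longrightarrow> retract S (F X) (F Y)"
  unfolding retract_def using functor_retract_via by blast

lemma isomorphic_iff_retract_via:
  "\<lbrakk>X \<in> obj S; Y \<in> obj S\<rbrakk> \<Longrightarrow> isomorphic S X Y \<longleftrightarrow> (\<exists>f g. retract_via S X Y f g \<and> retract_via S Y X g f)"
  by (auto simp: isomorphic_def is_iso_def inverse_pair_def retract_via_def)

lemma functor_isomorphic:
  assumes "linear_endofunctor S F Fm" "isomorphic S X Y" "X \<in> obj S" "Y \<in> obj S"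
  shows "isomorphic S (F X) (F Y)"
  using assms functor_retract_via[OF assms(1)] functor_in_obj[OF assms(1)]
  by (meson isomorphic_iff_retract_via)

lemma functor_zero:
  assumes "linear_endofunctor S F Fm" "X \<in> obj S" "Y \<in> obj S"
  shows "Fm 0 = 0"
proof -
  have "Fm (0 + 0) = Fm 0 + Fm 0"
    using assms zero_in_hom[of X Y] unfolding linear_endofunctor_def by blast
  then show ?thesis by simp
qed

text \<open>A functor with a quasi-inverse is faithful.\<close>

lemma functor_nonzero_hom:
  assumes F: "linear_endofunctor S F Fm" and G: "linear_endofunctor S G Gm"
    and t: "natural_iso S (G \<circ> F) (Gm \<circ> Fm) id id t" and nz: "nonzero_hom S X Y"
  shows "nonzero_hom S (F X) (F Y)"
proof -
  obtain f where f: "f \<in> hom S X Y" "f \<noteq> 0" and o: "X \<in> obj S" "Y \<in> obj S"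
    using nz by (auto simp: nonzero_hom_def)
  have o': "F X \<in> obj S" "F Y \<in> obj S" "G (F X) \<in> obj S" "G (F Y) \<in> obj S"
    using o functor_in_obj F G by blast+
  obtain u where u: "inverse_pair S (G (F X)) X (t X) u"
    using t o by (auto simp: natural_iso_def is_iso_def)
  have tY: "t Y \<in> hom S (G (F Y)) Y" using t o by (auto simp: natural_iso_def is_iso_def inverse_pair_def)
  have "Fm f \<noteq> 0"
  proof
    assume 0: "Fm f = 0"
    have "t Y \<cdot> Gm (Fm f) = f \<cdot> t X" using t o f by (auto simp: natural_iso_def)
    then have "f \<cdot> t X = 0" using 0 functor_zero[OF G o] tY o' o by (simp add: cmp_zero_right)
    moreover have "(f \<cdot> t X) \<cdot> u = f \<cdot> (t X \<cdot> u)"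
      using u f o o' by (intro cmp_assoc[of X "G (F X)" X Y]) (auto simp: inverse_pair_def)
    moreover have "0 \<cdot> u = 0"
      using cmp_zero_left[of X "G (F X)" Y u] u o o' by (simp add: inverse_pair_def)
    ultimately show False using u f o by (simp add: inverse_pair_def cmp_idm[of X Y])
  qed
  moreover have "Fm f \<in> hom S (F X) (F Y)" using F o f unfolding linear_endofunctor_def by blast
  ultimately show ?thesis using o' by (auto simp: nonzero_hom_def)
qed

end

context linear_monoidal_category
begin

lemma isomorphic_ten:
  assumes "isomorphic S X X'" "isomorphic S Y Y'" "X \<in> obj S" "X' \<in> obj S" "Y \<in> obj S" "Y' \<in> obj S"
  shows "isomorphic S (X \<odot> Y) (X' \<odot> Y')"
proof -
  obtain f f' g g' where p: "inverse_pair S X X' f f'" "inverse_pair S Y Y' g g'"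
    using assms by (auto simp: isomorphic_def is_iso_def)
  have "(f' \<otimes> g') \<cdot> (f \<otimes> g) = idm S (X \<odot> Y)" "(f \<otimes> g) \<cdot> (f' \<otimes> g') = idm S (X' \<odot> Y')"
    using p assms tenm_cmp[of X X' X Y Y' Y f f' g g'] tenm_cmp[of X' X X' Y' Y Y' f' f g' g]
    by (auto simp: inverse_pair_def tenm_idm)
  then have "inverse_pair S (X \<odot> Y) (X' \<odot> Y') (f \<otimes> g) (f' \<otimes> g')"
    using p assms by (auto simp: inverse_pair_def intro: tenm_in_hom)
  then show ?thesis by (auto simp: isomorphic_def is_iso_def)
qed

end

text \<open>Shifts act here on objects up to isomorphism.  In this form their properties are symmetric under
  reversing the tensor product, so that left and right cells can share one development.\<close>

locale graded_monoidal_category =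
  linear_monoidal_category S
  for S :: "('o, 'm::ab_group_add, 'k::field, 'z) moncat_scheme" (structure)
    and T :: "('o, 'm) autoequiv" +
  assumes shift_in_obj: "X \<in> obj S \<Longrightarrow> shift T i X \<in> obj S"
    and shift_isomorphic:
      "\<lbrakk>X \<in> obj S; Y \<in> obj S; isomorphic S X Y\<rbrakk> \<Longrightarrow> isomorphic S (shift T i X) (shift T i Y)"
    and shift_retract: "retract S X Y \<Longrightarrow> retract S (shift T i X) (shift T i Y)"
    and shift_nonzero_hom: "nonzero_hom S X Y \<Longrightarrow> nonzero_hom S (shift T i X) (shift T i Y)"
    and shift_shift: "X \<in> obj S \<Longrightarrow> isomorphic S (shift T i (shift T j X)) (shift T (i + j) X)"
    and ten_shift: "\<lbrakk>X \<in> obj S; Y \<in> obj S\<rbrakk> \<Longrightarrow> isomorphic S (X \<odot> shift T i Y) (shift T i (X \<odot> Y))"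
    and shift_ten: "\<lbrakk>X \<in> obj S; Y \<in> obj S\<rbrakk> \<Longrightarrow> isomorphic S (shift T i X \<odot> Y) (shift T i (X \<odot> Y))"

lemma shift_0 [simp]: "shift T 0 X = X"
  by (simp add: shift_def)

context bimodule_autoequivalence
begin

abbreviation "F \<equiv> fobj T"
abbreviation "G \<equiv> gobj T"

lemmas F_in_obj = functor_in_obj[OF fobj_functor]
lemmas G_in_obj = functor_in_obj[OF gobj_functor]
lemmas F_isomorphic = functor_isomorphic[OF fobj_functor]
lemmas G_isomorphic = functor_isomorphic[OF gobj_functor]

lemma GF: "X \<in> obj S \<Longrightarrow> isomorphic S (G (F X)) X"
  using quasi_inverse_left by (auto simp: natural_iso_def isomorphic_def)

lemma FG: "X \<in> obj S \<Longrightarrow> isomorphic S (F (G X)) X"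
  using quasi_inverse_right by (auto simp: natural_iso_def isomorphic_def)

lemma shift_preserves:
  assumes "P X Y" "\<And>X Y. P X Y \<Longrightarrow> P (F X) (F Y)" "\<And>X Y. P X Y \<Longrightarrow> P (G X) (G Y)"
  shows "P (shift T i X) (shift T i Y)"
proof -
  have "P ((F ^^ n) X) ((F ^^ n) Y)" "P ((G ^^ n) X) ((G ^^ n) Y)" for n
    using assms by (induction n) auto
  then show ?thesis by (simp add: shift_def)
qed

lemma shift_obj: "X \<in> obj S \<Longrightarrow> shift T i X \<in> obj S"
  using shift_preserves[of "\<lambda>X Y. X \<in> obj S" X X i] F_in_obj G_in_obj by blast

lemma shift_iso:
  "\<lbrakk>X \<in> obj S; Y \<in> obj S; isomorphic S X Y\<rbrakk> \<Longrightarrow> isomorphic S (shift T i X) (shift T i Y)"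
  using shift_preserves[of "\<lambda>X Y. X \<in> obj S \<and> Y \<in> obj S \<and> isomorphic S X Y" X Y i]
    F_in_obj G_in_obj F_isomorphic G_isomorphic by blast

lemma shift_succ: "X \<in> obj S \<Longrightarrow> isomorphic S (shift T (i + 1) X) (F (shift T i X))"
proof (cases "0 \<le> i")
  case True
  then have "nat (i + 1) = Suc (nat i)" by simp
  then show "X \<in> obj S \<Longrightarrow> ?thesis" using True shift_obj[of X "i + 1"] by (simp add: shift_def isomorphic_refl)
next
  case False
  then obtain n where n: "nat (- i) = Suc n" by (metis Suc_pred zero_less_nat_eq not_le neg_0_less_iff_less)
  assume X: "X \<in> obj S"
  have "shift T (i + 1) X = (G ^^ n) X"
  proof (cases "i = - 1")
    case True then show ?thesis using n by (simp add: shift_def)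
  next
    case False2: False
    then have "nat (- (i + 1)) = n" using n by simp
    then show ?thesis using False False2 by (simp add: shift_def)
  qed
  moreover have "F (shift T i X) = F (G ((G ^^ n) X))" using n False by (simp add: shift_def)
  moreover have "(G ^^ n) X \<in> obj S" using X G_in_obj by (induction n) auto
  ultimately show ?thesis using FG isomorphic_sym by metis
qed

lemma shift_pred:
  assumes "X \<in> obj S"
  shows "isomorphic S (shift T (i - 1) X) (G (shift T i X))"
proof -
  have "isomorphic S (shift T i X) (F (shift T (i - 1) X))" using shift_succ[OF assms, of "i - 1"] by simp
  then have "isomorphic S (G (shift T i X)) (G (F (shift T (i - 1) X)))"
    using assms shift_obj F_in_obj G_isomorphic by blast
  then show ?thesis
    using assms shift_obj F_in_obj G_in_obj GF isomorphic_sym isomorphic_trans by metis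
qed

lemma shift_add:
  assumes X: "X \<in> obj S"
  shows "isomorphic S (shift T i (shift T j X)) (shift T (i + j) X)"
proof (induction i rule: int_induct[where k = 0])
  case base
  then show ?case using X by (simp add: isomorphic_refl shift_obj)
next
  case (step1 i)
  note o = shift_obj[OF X] shift_obj[OF shift_obj[OF X]] F_in_obj
  have "isomorphic S (F (shift T i (shift T j X))) (F (shift T (i + j) X))"
    using step1 o F_isomorphic by blast
  moreover have "isomorphic S (F (shift T (i + j) X)) (shift T (i + 1 + j) X)"
    using shift_succ[OF X, of "i + j"] isomorphic_sym by (simp add: algebra_simps)
  ultimately show ?case
    using shift_succ[of "shift T j X" i] o isomorphic_trans by metis
next
  case (step2 i)
  note o = shift_obj[OF X] shift_obj[OF shift_obj[OF X]] G_in_obj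
  have "isomorphic S (G (shift T i (shift T j X))) (G (shift T (i + j) X))"
    using step2 o G_isomorphic by blast
  moreover have "isomorphic S (G (shift T (i + j) X)) (shift T (i - 1 + j) X)"
    using shift_pred[OF X, of "i + j"] isomorphic_sym by (simp add: algebra_simps)
  ultimately show ?case
    using shift_pred[of "shift T j X" i] o isomorphic_trans by metis
qed

text \<open>For negative shifts, \<open>H (G Y) \<simeq> G (F (H (G Y))) \<simeq> G (H (F (G Y))) \<simeq> G (H Y)\<close>.  The map \<open>H\<close>
  stands for \<open>X \<otimes> _\<close> and for \<open>_ \<otimes> Y\<close>.\<close>

lemma shift_commute:
  assumes H: "\<And>X. X \<in> obj S \<Longrightarrow> H X \<in> obj S"
    and Hiso: "\<And>X Y. \<lbrakk>X \<in> obj S; Y \<in> obj S; isomorphic S X Y\<rbrakk> \<Longrightarrow> isomorphic S (H X) (H Y)"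
    and HF: "\<And>X. X \<in> obj S \<Longrightarrow> isomorphic S (F (H X)) (H (F X))"
    and X: "X \<in> obj S"
  shows "isomorphic S (H (shift T i X)) (shift T i (H X))"
proof -
  have HG: "isomorphic S (H (G Y)) (G (H Y))" if Y: "Y \<in> obj S" for Y
  proof -
    note o = Y G_in_obj F_in_obj H
    have "isomorphic S (F (H (G Y))) (H Y)"
      using HF[of "G Y"] Hiso[OF _ _ FG[OF Y]] o isomorphic_trans by metis
    then have "isomorphic S (G (F (H (G Y)))) (G (H Y))" using o G_isomorphic by metis
    then show ?thesis using o GF[of "H (G Y)"] isomorphic_sym isomorphic_trans by metis
  qed
  show ?thesis
  proof (induction i rule: int_induct[where k = 0])
    case base
    then show ?case using X H by (simp add: isomorphic_refl)
  next
    case (step1 i)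
    note o = X shift_obj F_in_obj H
    have 1: "isomorphic S (H (shift T (i + 1) X)) (H (F (shift T i X)))"
      using Hiso shift_succ[OF X] o by metis
    have 2: "isomorphic S (H (F (shift T i X))) (F (H (shift T i X)))"
      using HF isomorphic_sym o by metis
    have 3: "isomorphic S (F (H (shift T i X))) (F (shift T i (H X)))" using step1 o F_isomorphic by metis
    have 4: "isomorphic S (F (shift T i (H X))) (shift T (i + 1) (H X))"
      using shift_succ isomorphic_sym o by metis
    have "isomorphic S (H (shift T (i + 1) X)) (F (H (shift T i X)))"
      by (rule isomorphic_trans[OF 1 2]) (use o in auto)
    moreover have "isomorphic S (F (H (shift T i X))) (shift T (i + 1) (H X))"
      by (rule isomorphic_trans[OF 3 4]) (use o in auto)
    ultimately show ?case by (rule isomorphic_trans) (use o in auto)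
  next
    case (step2 i)
    note o = X shift_obj G_in_obj H
    have 1: "isomorphic S (H (shift T (i - 1) X)) (H (G (shift T i X)))"
      using Hiso shift_pred[OF X] o by metis
    have 2: "isomorphic S (H (G (shift T i X))) (G (H (shift T i X)))"
      using HG o by metis
    have 3: "isomorphic S (G (H (shift T i X))) (G (shift T i (H X)))" using step2 o G_isomorphic by metis
    have 4: "isomorphic S (G (shift T i (H X))) (shift T (i - 1) (H X))"
      using shift_pred isomorphic_sym o by metis
    have "isomorphic S (H (shift T (i - 1) X)) (G (H (shift T i X)))"
      by (rule isomorphic_trans[OF 1 2]) (use o in auto)
    moreover have "isomorphic S (G (H (shift T i X))) (shift T (i - 1) (H X))"
      by (rule isomorphic_trans[OF 3 4]) (use o in auto)
    ultimately show ?case by (rule isomorphic_trans) (use o in auto)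
  qed
qed

lemma graded_monoidal_category: "graded_monoidal_category S T"
proof
  show "retract S (shift T i X) (shift T i Y)" if "retract S X Y" for i X Y
    using shift_preserves[of "retract S", OF that] functor_retract fobj_functor gobj_functor by blast
  show "nonzero_hom S (shift T i X) (shift T i Y)" if "nonzero_hom S X Y" for i X Y
    using shift_preserves[of "nonzero_hom S", OF that] functor_nonzero_hom fobj_functor gobj_functor
      quasi_inverse_left quasi_inverse_right by blast
  show "isomorphic S (X \<odot> shift T i Y) (shift T i (X \<odot> Y))" if "X \<in> obj S" "Y \<in> obj S" for i X Y
    by (rule shift_commute[of "\<lambda>Y. X \<odot> Y"])
      (use that lact_iso[of X] isomorphic_refl isomorphic_ten in \<open>auto simp: isomorphic_def\<close>)
  show "isomorphic S (shift T i X \<odot> Y) (shift T i (X \<odot> Y))" if "X \<in> obj S" "Y \<in> obj S" for i X Y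
    by (rule shift_commute[of "\<lambda>X. X \<odot> Y"])
      (use that ract_iso[of _ Y] isomorphic_refl isomorphic_ten in \<open>auto simp: isomorphic_def\<close>)
qed (use shift_obj shift_iso shift_add in auto)

end

context graded_monoidal_category
begin

lemma reverse_graded_monoidal_category: "graded_monoidal_category (reverse S) T"
  using reverse_linear_monoidal_category
  by (simp add: graded_monoidal_category_def graded_monoidal_category_axioms_def shift_in_obj
    shift_isomorphic shift_retract shift_nonzero_hom shift_shift ten_shift shift_ten)

end

section \<open>Nonzero morphisms\<close>

context linear_category
begin

lemma mor_cmp_zero:
  assumes "arr f" "arr g" "src g = tgt f"
  shows "mor f = 0 \<Longrightarrow> mor g \<cdot> mor f = 0" "mor g = 0 \<Longrightarrow> mor g \<cdot> mor f = 0"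
  using assms cmp_zero_left[of "src f" "tgt f" "tgt g" "mor f"] cmp_zero_right[of "src f" "tgt f" "tgt g" "mor g"]
  unfolding arr_def by auto

lemma nonzero_hom_iff: "\<lbrakk>X \<in> obj S; Y \<in> obj S\<rbrakk> \<Longrightarrow> nonzero_hom S X Y \<longleftrightarrow> hom S X Y \<noteq> {0}"
  using zero_in_hom[of X Y] by (auto simp: nonzero_hom_def)

end

context linear_monoidal_category
begin

lemma tenm_zero_left: "\<lbrakk>X \<in> obj S; X' \<in> obj S; Y \<in> obj S; Y' \<in> obj S; g \<in> hom S Y Y'\<rbrakk> \<Longrightarrow> 0 \<otimes> g = 0"
  using tenm_add_left[of X X' Y Y' 0 0 g] zero_in_hom by simp

lemma tenm_zero_right: "\<lbrakk>X \<in> obj S; X' \<in> obj S; Y \<in> obj S; Y' \<in> obj S; f \<in> hom S X X'\<rbrakk> \<Longrightarrow> f \<otimes> 0 = 0"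
  using tenm_add_right[of X X' Y Y' f 0 0] zero_in_hom by simp

lemma arrow_zigzag:
  assumes "is_left_dual S X Y e c"
  shows "lu Y \<bullet> (Arrow (Y \<odot> X) e \<one> \<star> ide Y) \<bullet> asi Y X Y \<bullet> (ide Y \<star> Arrow \<one> c (X \<odot> Y)) \<bullet> rui Y = ide Y"
  using assms by (simp add: is_left_dual_def lu_def asi_def rui_def arrow_cmp_def arrow_ten_def ide_def)

text \<open>Both morphisms occur as factors in the zigzag identity for \<open>Y\<close>.\<close>

lemma is_left_dual_nonzero:
  assumes "is_left_dual S X Y e c" "idm S Y \<noteq> 0"
  shows "e \<noteq> 0" "c \<noteq> 0"
proof -
  have d [simp]: "X \<in> obj S" "Y \<in> obj S" and h: "e \<in> hom S (Y \<odot> X) \<one>" "c \<in> hom S \<one> (X \<odot> Y)"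
    using assms(1) by (auto simp: is_left_dual_def)
  define E where "E = Arrow (Y \<odot> X) e \<one>"
  define K where "K = Arrow \<one> c (X \<odot> Y)"
  have E [simp]: "arr E" "src E = Y \<odot> X" "tgt E = \<one>" "mor E = e" unfolding E_def using h by (auto intro: arr_Arrow)
  have K [simp]: "arr K" "src K = \<one>" "tgt K = X \<odot> Y" "mor K = c" unfolding K_def using h by (auto intro: arr_Arrow)
  let ?f1 = "ide Y \<star> K" and ?f2 = "asi Y X Y \<bullet> (ide Y \<star> K) \<bullet> rui Y" and ?f3 = "E \<star> ide Y"
  have z: "mor (lu Y) \<cdot> mor (?f3 \<bullet> ?f2) \<noteq> 0"
    using arg_cong[OF arrow_zigzag[OF assms(1)], of mor] assms(2) by (simp flip: E_def K_def)
  show "e \<noteq> 0"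
  proof
    assume "e = 0"
    then have "mor ?f3 = 0" using tenm_zero_left[of "Y \<odot> X" \<one> Y Y] idm_in_hom by simp
    then have "mor ?f3 \<cdot> mor ?f2 = 0" by (intro mor_cmp_zero(2)) simp_all
    then have "mor (lu Y) \<cdot> mor (?f3 \<bullet> ?f2) = 0" by (intro mor_cmp_zero(1)) simp_all
    then show False using z by simp
  qed
  show "c \<noteq> 0"
  proof
    assume "c = 0"
    then have "mor ?f1 = 0" using tenm_zero_right[of Y Y \<one> "X \<odot> Y"] idm_in_hom by simp
    then have "mor ?f1 \<cdot> mor (rui Y) = 0" by (intro mor_cmp_zero(2)) simp_all
    then have "mor (asi Y X Y) \<cdot> mor (?f1 \<bullet> rui Y) = 0" by (intro mor_cmp_zero(1)) simp_all
    then have "mor ?f3 \<cdot> mor ?f2 = 0" by (intro mor_cmp_zero(1)) simp_all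
    then have "mor (lu Y) \<cdot> mor (?f3 \<bullet> ?f2) = 0" by (intro mor_cmp_zero(1)) simp_all
    then show False using z by simp
  qed
qed

end

context linear_category
begin

lemma nonzero_hom_iso_right: "\<lbrakk>nonzero_hom S A X; isomorphic S X Y; Y \<in> obj S\<rbrakk> \<Longrightarrow> nonzero_hom S A Y"
  using nonzero_hom_isomorphic[of A X A Y] isomorphic_refl by (auto simp: nonzero_hom_def)

lemma nonzero_hom_iso_left: "\<lbrakk>nonzero_hom S X A; isomorphic S X Y; Y \<in> obj S\<rbrakk> \<Longrightarrow> nonzero_hom S Y A"
  using nonzero_hom_isomorphic[of X A Y A] isomorphic_refl by (auto simp: nonzero_hom_def)

lemma retract_in_obj: "retract S X Y \<Longrightarrow> X \<in> obj S" "retract S X Y \<Longrightarrow> Y \<in> obj S"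
  by (auto simp: retract_def retract_via_def)

lemma retract_iso_right: "\<lbrakk>retract S A X; isomorphic S X Y; Y \<in> obj S\<rbrakk> \<Longrightarrow> retract S A Y"
  using retract_trans isomorphic_retract retract_in_obj by blast

lemma retract_iso_left: "\<lbrakk>retract S X A; isomorphic S X Y; Y \<in> obj S\<rbrakk> \<Longrightarrow> retract S Y A"
  using retract_trans isomorphic_retract isomorphic_sym retract_in_obj by blast

end

section \<open>Hom spaces between the indecomposable objects\<close>

text \<open>The map \<open>R\<close> stands for right duals.  It is a parameter because the left duals of a rigid category
  are right duals in the reversed category, whose left cells are the right cells of the original.\<close>

locale cell_setting =
  graded_monoidal_category S T
  for S :: "('o, 'm::ab_group_add, 'k::field, 'z) moncat_scheme" (structure)
    and T :: "('o, 'm) autoequiv" +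
  fixes W :: "'w set" and B :: "'w \<Rightarrow> 'o" and R :: "'o \<Rightarrow> 'o"
  assumes idempotents_split:
      "\<lbrakk>X \<in> obj S; e \<in> hom S X X; e \<cdot> e = e\<rbrakk>
        \<Longrightarrow> \<exists>Y \<in> obj S. \<exists>s \<in> hom S Y X. \<exists>r \<in> hom S X Y. s \<cdot> r = e \<and> r \<cdot> s = idm S Y"
    and hom_finite:
      "\<lbrakk>X \<in> obj S; Y \<in> obj S\<rbrakk> \<Longrightarrow> \<exists>A. finite A \<and> module.span (scl S) A = hom S X Y"
    and end_unit: "bij_betw (\<lambda>c. scl S c (idm S \<one>)) UNIV (hom S \<one> \<one>)"
    and dual: "X \<in> obj S \<Longrightarrow> \<exists>e c. is_left_dual S (R X) X e c"
    and B_indecomposable: "x \<in> W \<Longrightarrow> indecomposable S (B x)"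
    and dual_B: "x \<in> W \<Longrightarrow> \<exists>y \<in> W. isomorphic S (R (B x)) (B y)"
    and classification: "indecomposable S X \<Longrightarrow>
          \<exists>!(x, i). x \<in> W \<and> isomorphic S X (shift T i (B x))"
    and orthogonality: "\<lbrakk>x \<in> W; y \<in> W; i \<le> 0\<rbrakk> \<Longrightarrow>
          hom_dim S (B x) (shift T i (B y)) = (if x = y \<and> i = 0 then 1 else 0)"
begin

abbreviation sh :: "int \<Rightarrow> 'o \<Rightarrow> 'o" where "sh \<equiv> shift T"
abbreviation top_obj :: "'w \<Rightarrow> 'o" where "top_obj \<equiv> top_shift S T W B"
abbreviation D :: "'w set" where "D \<equiv> D_set S T W B"

lemma B_obj [simp]: "x \<in> W \<Longrightarrow> B x \<in> obj S"
  using B_indecomposable by (simp add: indecomposable_def)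

lemma B_nonzero: "x \<in> W \<Longrightarrow> idm S (B x) \<noteq> 0"
  using B_indecomposable by (simp add: indecomposable_def zero_obj_def)

lemma R_obj [simp]: "X \<in> obj S \<Longrightarrow> R X \<in> obj S"
  using dual[of X] by (auto simp: is_left_dual_def)

lemmas [simp] = shift_in_obj

lemma is_summand_iff_retract: "is_summand S X Y \<longleftrightarrow> retract S X Y"
  using is_summand_imp_retract retract_imp_is_summand[OF idempotents_split] by blast

lemma hom_B_shift_B:
  assumes "nonzero_hom S (sh i (B x)) (sh j (B y))" "x \<in> W" "y \<in> W"
  shows "i < j \<or> (i = j \<and> x = y)"
proof (rule ccontr)
  interpret vs: vector_space "scl S" by (rule ambient_vector_space)
  assume c: "\<not> ?thesis"
  have "nonzero_hom S (sh (- i) (sh i (B x))) (sh (- i) (sh j (B y)))" using assms shift_nonzero_hom by blast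
  then have nz: "nonzero_hom S (B x) (sh (j - i) (B y))"
    using nonzero_hom_isomorphic[OF _ shift_shift[of "B x" "- i" i] shift_shift[of "B y" "- i" j]] assms by simp
  have "hom_dim S (B x) (sh (j - i) (B y)) = 0" using c assms by (subst orthogonality) auto
  moreover obtain A where "finite A" "module.span (scl S) A = hom S (B x) (sh (j - i) (B y))"
    using hom_finite[of "B x" "sh (j - i) (B y)"] assms by auto
  ultimately show False
    using vs.dim_zero_imp nz nonzero_hom_iff assms by (auto simp: hom_dim_def)
qed

lemma End_B_scalar:
  assumes x: "x \<in> W" and f: "f \<in> hom S (B x) (B x)"
  shows "\<exists>t. f = scl S t (idm S (B x))"
proof -
  interpret vs: vector_space "scl S" by (rule ambient_vector_space)
  obtain A where A: "finite A" "module.span (scl S) A = hom S (B x) (B x)"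
    using hom_finite[of "B x" "B x"] x by auto
  have "vs.dim (hom S (B x) (B x)) = 1" using orthogonality[OF x x, of 0] by (simp add: hom_dim_def)
  then obtain v where v: "hom S (B x) (B x) = range (\<lambda>c. scl S c v)" using vs.dim_one_iff[OF A] by auto
  obtain s t where st: "idm S (B x) = scl S s v" "f = scl S t v" using v f idm_in_hom[of "B x"] x by auto
  then have "s \<noteq> 0" using B_nonzero[OF x] by auto
  then have "f = scl S (t / s) (idm S (B x))" using st by simp
  then show ?thesis by blast
qed

text \<open>Conjugation by an isomorphism with \<open>B\<^sub>x\<close> preserves scalars.\<close>

lemma End_scalar:
  assumes x: "x \<in> W" and X: "X \<in> obj S" "isomorphic S X (B x)" and f: "f \<in> hom S X X"
  shows "\<exists>t. f = scl S t (idm S X)"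
proof -
  obtain u v where p: "retract_via S X (B x) u v" "retract_via S (B x) X v u"
    using X x isomorphic_iff_retract_via by auto
  note d = p[unfolded retract_via_def]
  have fv: "f \<cdot> v \<in> hom S (B x) X" using f d cmp_in_hom by metis
  then have "u \<cdot> (f \<cdot> v) \<in> hom S (B x) (B x)" using d cmp_in_hom by metis
  then obtain t where t: "u \<cdot> (f \<cdot> v) = scl S t (idm S (B x))" using End_B_scalar x by blast
  have "f \<cdot> v = v \<cdot> (u \<cdot> (f \<cdot> v))" using retract_via_cancel[OF p(1) _ fv] d by simp
  also have "\<dots> = scl S t v"
    using t d idm_in_hom[of "B x"] cmp_scl_right[of "B x" "B x" X "idm S (B x)" v] cmp_idm[of "B x" X v] by simp
  finally have "(f \<cdot> v) \<cdot> u = scl S t (v \<cdot> u)" using d cmp_scl_left[of X "B x" X u v] by simp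
  then show ?thesis using d f retract_via_cancel'[OF p(1) _ f] by auto
qed

section \<open>The coevaluation\<close>

lemma nonzero_hom_transpose:
  assumes "nonzero_hom S \<one> (C \<odot> Y)" "C \<in> obj S" "Y \<in> obj S"
  shows "nonzero_hom S (R Y) C"
proof -
  obtain e c where d: "is_left_dual S (R Y) Y e c" using dual assms by blast
  obtain g where g: "g \<in> hom S \<one> (C \<odot> Y)" "g \<noteq> 0" using assms by (auto simp: nonzero_hom_def)
  obtain f where f: "f \<in> hom S (R Y) C" "g = (f \<otimes> idm S Y) \<cdot> c" using transpose_surj[OF d _ g(1)] assms by blast
  have "f \<noteq> 0"
  proof
    assume "f = 0"
    then have "f \<otimes> idm S Y = 0" using tenm_zero_left[of "R Y" C Y Y] assms idm_in_hom by simp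
    then show False using f g cmp_zero_left[of \<one> "R Y \<odot> Y" "C \<odot> Y" c] d assms by (auto simp: is_left_dual_def)
  qed
  then show ?thesis using f assms by (auto simp: nonzero_hom_def)
qed

text \<open>A morphism \<open>1 \<rightarrow> R B\<^sub>z \<otimes> B\<^sub>z\<close> is the transpose of an endomorphism of \<open>R B\<^sub>z \<simeq> B\<^sub>y\<close>, that is, of a
  scalar; and the transpose of the identity is the coevaluation.\<close>

lemma coev_spans:
  assumes z: "z \<in> W" and d: "is_left_dual S (R (B z)) (B z) e c" and g: "g \<in> hom S \<one> (R (B z) \<odot> B z)"
  shows "\<exists>t. g = scl S t c"
proof -
  obtain f where f: "f \<in> hom S (R (B z)) (R (B z))" "g = (f \<otimes> idm S (B z)) \<cdot> c"
    using transpose_surj[OF d _ g] z by auto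
  obtain y where "y \<in> W" "isomorphic S (R (B z)) (B y)" using dual_B z by blast
  then obtain t where t: "f = scl S t (idm S (R (B z)))" using End_scalar f z by fastforce
  have c: "c \<in> hom S \<one> (R (B z) \<odot> B z)" using d by (simp add: is_left_dual_def)
  have "f \<otimes> idm S (B z) = scl S t (idm S (R (B z) \<odot> B z))"
    using z idm_in_hom by (simp add: t tenm_scl_left[of "R (B z)" "R (B z)" "B z" "B z"] tenm_idm)
  then have "g = scl S t c"
    using f c z idm_in_hom[of "R (B z) \<odot> B z"]
      cmp_scl_left[of \<one> "R (B z) \<odot> B z" "R (B z) \<odot> B z" c "idm S (R (B z) \<odot> B z)" t]
      idm_cmp[of \<one> "R (B z) \<odot> B z" c] by simp
  then show ?thesis ..
qed

text \<open>If \<open>h : 1 \<rightarrow> X\<close> is nonzero, then so is \<open>s h\<close>, which is therefore a nonzero multiple of the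
  coevaluation.\<close>

lemma coev_factors:
  assumes z: "z \<in> W" and d: "is_left_dual S (R (B z)) (B z) e c"
    and v: "retract_via S X (R (B z) \<odot> B z) s r" and nz: "nonzero_hom S \<one> X"
  shows "\<exists>g \<in> hom S \<one> X. g \<noteq> 0 \<and> c = s \<cdot> g"
proof -
  note vd = v[unfolded retract_via_def]
  obtain h where h: "h \<in> hom S \<one> X" "h \<noteq> 0" using nz by (auto simp: nonzero_hom_def)
  have rsh: "r \<cdot> (s \<cdot> h) = h" using retract_via_cancel[OF v _ h(1)] by simp
  have sh: "s \<cdot> h \<in> hom S \<one> (R (B z) \<odot> B z)" using vd h cmp_in_hom[OF unit_in_obj] by metis
  obtain t where t: "s \<cdot> h = scl S t c" using coev_spans[OF z d sh] by blast
  have "t \<noteq> 0"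
  proof
    assume "t = 0"
    then have "s \<cdot> h = 0" using t by (simp add: scl_simps)
    then show False using rsh h vd cmp_zero_right[of \<one> _ X r] by auto
  qed
  then have "c = scl S (1 / t) (s \<cdot> h)" by (simp add: t scl_simps)
  also have "\<dots> = s \<cdot> scl S (1 / t) h" using vd h cmp_scl_right[of \<one> X _ h s] by auto
  finally have "c = s \<cdot> scl S (1 / t) h" .
  moreover have "scl S (1 / t) h \<in> hom S \<one> X" using h vd scl_in_hom by auto
  moreover have "scl S (1 / t) h \<noteq> 0" using h \<open>t \<noteq> 0\<close> by (simp add: scl_simps)
  ultimately show ?thesis by blast
qed

lemma coev_nonzero_hom: "z \<in> W \<Longrightarrow> nonzero_hom S \<one> (R (B z) \<odot> B z)"
  using dual[of "B z"] is_left_dual_nonzero(2)[OF _ B_nonzero, of "R (B z)" z]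
  by (auto simp: nonzero_hom_def is_left_dual_def)

lemma ev_nonzero_hom: "z \<in> W \<Longrightarrow> nonzero_hom S (B z \<odot> R (B z)) \<one>"
  using dual[of "B z"] is_left_dual_nonzero(1)[OF _ B_nonzero, of "R (B z)" z]
  by (auto simp: nonzero_hom_def is_left_dual_def)

section \<open>The unit object\<close>

text \<open>The idempotent of a summand of the unit object is a scalar, hence \<open>0\<close> or \<open>1\<close>.\<close>

lemma unit_indecomposable: "indecomposable S \<one>"
proof -
  have z: "idm S \<one> \<noteq> 0"
  proof
    assume "idm S \<one> = 0"
    then have "scl S 0 (idm S \<one>) = scl S 1 (idm S \<one>)" by (simp add: scl_simps)
    then show False using end_unit by (metis bij_betw_def inj_onD UNIV_I zero_neq_one)
  qed
  have "zero_obj S A \<or> zero_obj S C" if sum: "direct_sum S \<one> [A, C] i p" for A C i p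
  proof -
    have vA: "retract_via S A \<one> (i 0) (p 0)" and vC: "retract_via S C \<one> (i 1) (p 1)"
      using direct_sum_retract_via[OF sum, of 0] direct_sum_retract_via[OF sum, of 1] by auto
    note d = vA[unfolded retract_via_def] vC[unfolded retract_via_def]
    have "i 0 \<cdot> p 0 \<in> hom S \<one> \<one>" using d cmp_in_hom by metis
    then obtain t where t: "i 0 \<cdot> p 0 = scl S t (idm S \<one>)" using end_unit by (auto simp: bij_betw_def)
    have "0 = (p 1 \<cdot> i 0) \<cdot> p 0" using sum d cmp_zero_left[of \<one> A C "p 0"] by (simp add: direct_sum_def)
    also have "\<dots> = p 1 \<cdot> (i 0 \<cdot> p 0)" using d by (intro cmp_assoc[of \<one> A \<one> C]) auto
    also have "\<dots> = scl S t (p 1)"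
      using t d cmp_scl_right[of \<one> \<one> C "idm S \<one>" "p 1" t] cmp_idm[of \<one> C "p 1"] idm_in_hom by simp
    finally consider "t = 0" | "p 1 = 0" by (auto simp: scl_simps)
    then show ?thesis
    proof cases
      case 1
      then have "i 0 \<cdot> p 0 = 0" using t by (simp add: scl_simps)
      then have "p 0 = 0" using retract_via_cancel[OF vA, of \<one> "p 0"] d cmp_zero_right[of \<one> \<one> A "p 0"] by simp
      then have "idm S A = 0" using d cmp_zero_left[of A \<one> A "i 0"] by simp
      then show ?thesis using d by (simp add: zero_obj_def)
    next
      case 2
      then have "idm S C = 0" using d cmp_zero_left[of C \<one> C "i 1"] by simp
      then show ?thesis using d by (simp add: zero_obj_def)
    qed
  qed
  then show ?thesis using z by (auto simp: indecomposable_def zero_obj_def)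
qed

lemma ten_unit_isomorphic: "X \<in> obj S \<Longrightarrow> isomorphic S (X \<odot> \<one>) X"
  and unit_ten_isomorphic: "X \<in> obj S \<Longrightarrow> isomorphic S (\<one> \<odot> X) X"
  using runit_iso lunit_iso by (auto simp: isomorphic_def)

text \<open>The point is that the unit object is some \<open>B\<^sub>e\<close> without a shift.  If \<open>1 \<simeq> B\<^sub>e\<langle>j\<rangle>\<close> and
  \<open>R B\<^sub>e \<simeq> B\<^sub>y\<close>, then \<open>R B\<^sub>e \<otimes> B\<^sub>e\<close> and \<open>B\<^sub>e \<otimes> R B\<^sub>e\<close> are both isomorphic to \<open>B\<^sub>y\<langle>-j\<rangle>\<close>, so the
  coevaluation and the evaluation of \<open>B\<^sub>e\<close> give nonzero morphisms \<open>B\<^sub>e\<langle>j\<rangle> \<rightarrow> B\<^sub>y\<langle>-j\<rangle>\<close> and back.\<close>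

lemma unit_isomorphic_B: "\<exists>e \<in> W. isomorphic S \<one> (B e)"
proof -
  obtain e j where e: "e \<in> W" and iso: "isomorphic S \<one> (sh j (B e))"
    using classification[OF unit_indecomposable] by auto
  obtain y where y: "y \<in> W" "isomorphic S (R (B e)) (B y)" using dual_B e by blast
  have "isomorphic S (sh (- j) \<one>) (sh (- j) (sh j (B e)))" using iso e by (simp add: shift_isomorphic)
  then have Be: "isomorphic S (B e) (sh (- j) \<one>)"
    using shift_shift[of "B e" "- j" j] e isomorphic_trans[of "sh (- j) \<one>" _ "B e"] isomorphic_sym by fastforce
  have "nonzero_hom S \<one> (B y \<odot> sh (- j) \<one>)"
    using nonzero_hom_iso_right[OF coev_nonzero_hom[OF e] isomorphic_ten[OF y(2) Be]] y e by simp
  then have "nonzero_hom S \<one> (sh (- j) (B y \<odot> \<one>))"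
    using nonzero_hom_iso_right ten_shift[of "B y" \<one> "- j"] y by simp
  then have "nonzero_hom S \<one> (sh (- j) (B y))"
    using nonzero_hom_iso_right shift_isomorphic[OF _ _ ten_unit_isomorphic[of "B y"], of "- j"] y by simp
  then have "nonzero_hom S (sh j (B e)) (sh (- j) (B y))" using nonzero_hom_iso_left[OF _ iso] e by simp
  then have "j \<le> 0" using hom_B_shift_B e y by fastforce
  have "nonzero_hom S (sh (- j) \<one> \<odot> B y) \<one>"
    using nonzero_hom_iso_left[OF ev_nonzero_hom[OF e] isomorphic_ten[OF Be y(2)]] y e by simp
  then have "nonzero_hom S (sh (- j) (\<one> \<odot> B y)) \<one>"
    using nonzero_hom_iso_left shift_ten[of \<one> "B y" "- j"] y by simp
  then have "nonzero_hom S (sh (- j) (B y)) \<one>"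
    using nonzero_hom_iso_left shift_isomorphic[OF _ _ unit_ten_isomorphic[of "B y"], of "- j"] y by simp
  then have "nonzero_hom S (sh (- j) (B y)) (sh j (B e))" using nonzero_hom_iso_right[OF _ iso] e by simp
  then have "0 \<le> j" using hom_B_shift_B e y by fastforce
  with \<open>j \<le> 0\<close> have "j = 0" by simp
  then show ?thesis using iso e by auto
qed

lemma hom_unit_nonneg:
  assumes "nonzero_hom S \<one> (sh i (B x))" "x \<in> W"
  shows "0 \<le> i"
proof -
  obtain e where e: "e \<in> W" "isomorphic S \<one> (B e)" using unit_isomorphic_B by blast
  then have "nonzero_hom S (sh 0 (B e)) (sh i (B x))" using nonzero_hom_iso_left[OF assms(1) e(2)] by simp
  then show ?thesis using hom_B_shift_B e assms by fastforce
qed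

section \<open>The functions a and Delta\<close>

text \<open>Shifting by \<open>k = n - i\<close>, the composite \<open>1 \<rightarrow> B\<^sub>x\<langle>n\<rangle> \<rightarrow> (B\<^sub>y \<otimes> B\<^sub>z)\<langle>k\<rangle> \<simeq> B\<^sub>y\<langle>k\<rangle> \<otimes> B\<^sub>z\<close> is nonzero
  and transposes to a nonzero morphism \<open>R B\<^sub>z \<rightarrow> B\<^sub>y\<langle>k\<rangle>\<close>; orthogonality requires \<open>k \<ge> 0\<close>.
  In particular \<open>a(x) \<le> \<Delta>(x)\<close>.\<close>

lemma summand_shift_bound:
  assumes x: "x \<in> W" and y: "y \<in> W" and z: "z \<in> W"
    and r: "retract S (sh i (B x)) (B y \<odot> B z)" and nz: "nonzero_hom S \<one> (sh n (B x))"
  shows "i < n \<or> (i = n \<and> isomorphic S (R (B z)) (B y))"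
proof -
  let ?k = "n - i"
  have "nonzero_hom S (sh (- ?k) \<one>) (sh (- ?k) (sh n (B x)))" using nz by (rule shift_nonzero_hom)
  then have "nonzero_hom S (sh (- ?k) \<one>) (sh i (B x))"
    using nonzero_hom_iso_right shift_shift[of "B x" "- ?k" n] x by simp
  then have "nonzero_hom S (sh (- ?k) \<one>) (B y \<odot> B z)" using nonzero_hom_retract_right r by blast
  then have "nonzero_hom S (sh ?k (sh (- ?k) \<one>)) (sh ?k (B y \<odot> B z))" by (rule shift_nonzero_hom)
  then have "nonzero_hom S \<one> (sh ?k (B y \<odot> B z))"
    using nonzero_hom_iso_left shift_shift[of \<one> ?k "- ?k"] by simp
  then have "nonzero_hom S \<one> (sh ?k (B y) \<odot> B z)"
    using nonzero_hom_iso_right isomorphic_sym[OF shift_ten[of "B y" "B z" ?k]] y z by simp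
  then have "nonzero_hom S (R (B z)) (sh ?k (B y))" using nonzero_hom_transpose y z by simp
  moreover obtain w where w: "w \<in> W" "isomorphic S (R (B z)) (B w)" using dual_B z by blast
  ultimately have "nonzero_hom S (sh 0 (B w)) (sh ?k (B y))" using nonzero_hom_iso_left by simp
  then have "0 < ?k \<or> (0 = ?k \<and> w = y)" using hom_B_shift_B w y by blast
  then show ?thesis using w by auto
qed

lemma top_shift_eq: "a_fun S T W B x = ereal (of_int i) \<Longrightarrow> top_obj x = sh i (B x)"
  by (simp add: top_shift_def the_equality)

lemma D_subset: "d \<in> D \<Longrightarrow> d \<in> W"
  by (simp add: D_set_def)

text \<open>Such an \<open>i\<close> satisfies \<open>\<Delta>(x) \<le> i \<le> a(x)\<close>, and the opposite inequality is
  \<open>summand_shift_bound\<close>.\<close>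

lemma D_I:
  assumes x: "x \<in> W" "nonzero_hom S \<one> (sh i (B x))"
    and yz: "y \<in> W" "z \<in> W" "retract S (sh i (B x)) (B y \<odot> B z)"
  shows "x \<in> D \<and> top_obj x = sh i (B x)"
proof -
  have i: "0 \<le> i" using hom_unit_nonneg x by blast
  have "ereal (of_int j) \<le> ereal (of_int i)"
    if "\<exists>y \<in> W. \<exists>z \<in> W. is_summand S (sh j (B x)) (B y \<odot> B z)" for j
    using that summand_shift_bound[OF x(1) _ _ _ x(2), of _ _ j] is_summand_iff_retract by fastforce
  then have a: "a_fun S T W B x = ereal (of_int i)"
    unfolding a_fun_def using yz is_summand_iff_retract
    by (intro antisym SUP_least SUP_upper) auto
  have "enat (nat i) \<le> enat n" if "hom S \<one> (sh (int n) (B x)) \<noteq> {0}" for n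
    using that summand_shift_bound[OF x(1) yz, of "int n"] nonzero_hom_iff x by fastforce
  moreover have "hom S \<one> (sh (int (nat i)) (B x)) \<noteq> {0}" using x i nonzero_hom_iff by fastforce
  ultimately have "Delta S T B x = enat (nat i)"
    unfolding Delta_def by (intro antisym INF_greatest INF_lower) auto
  then show ?thesis using a i x top_shift_eq by (simp add: D_set_def)
qed

text \<open>A supremum of integers that is finite is attained.\<close>

lemma D_E:
  assumes "d \<in> D"
  obtains i y z where "y \<in> W" "z \<in> W" "top_obj d = sh i (B d)" "nonzero_hom S \<one> (sh i (B d))"
    "retract S (sh i (B d)) (B y \<odot> B z)"
proof -
  have d: "d \<in> W" "a_fun S T W B d = ereal_of_enat (Delta S T B d)" "Delta S T B d \<noteq> \<infinity>"
    using assms by (auto simp: D_set_def)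
  define N where "N = {n. hom S \<one> (sh (int n) (B d)) \<noteq> {0}}"
  have Delta: "Delta S T B d = (INF n \<in> N. enat n)" by (simp add: Delta_def N_def)
  have "N \<noteq> {}" using Delta d(3) by (auto simp: top_enat_def)
  define n where "n = (LEAST n. n \<in> N)"
  have n: "n \<in> N" unfolding n_def using \<open>N \<noteq> {}\<close> by (auto intro: LeastI)
  have "Delta S T B d = enat n"
    unfolding Delta using n by (intro antisym INF_greatest INF_lower) (auto simp: n_def intro: Least_le)
  then have a: "a_fun S T W B d = ereal (of_int (int n))" using d by simp
  have nz: "nonzero_hom S \<one> (sh (int n) (B d))" using n d nonzero_hom_iff by (simp add: N_def)
  have "\<exists>y \<in> W. \<exists>z \<in> W. is_summand S (sh (int n) (B d)) (B y \<odot> B z)"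
  proof (rule ccontr)
    assume none: "\<not> ?thesis"
    have "j \<le> int n - 1" if "\<exists>y \<in> W. \<exists>z \<in> W. is_summand S (sh j (B d)) (B y \<odot> B z)" for j
      using that summand_shift_bound[OF d(1) _ _ _ nz, of _ _ j] is_summand_iff_retract none by fastforce
    then have "a_fun S T W B d \<le> ereal (of_int (int n - 1))"
      unfolding a_fun_def by (intro SUP_least) (auto simp del: of_int_diff)
    then show False using a by simp
  qed
  then show thesis using that top_shift_eq[OF a] nz is_summand_iff_retract by blast
qed

lemma top_unit_nonzero_hom: "d \<in> D \<Longrightarrow> nonzero_hom S \<one> (top_obj d)"
  by (metis D_E)

lemma top_summand_dual:
  assumes "d \<in> D" "y \<in> W" "z \<in> W" "retract S (top_obj d) (B y \<odot> B z)"
  shows "isomorphic S (R (B z)) (B y)"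
proof -
  obtain i where "top_obj d = sh i (B d)" "nonzero_hom S \<one> (sh i (B d))" using D_E assms(1) by metis
  then show ?thesis using summand_shift_bound[of d y z i i] assms D_subset by auto
qed

lemma top_hom_unique:
  assumes "d \<in> D" "d' \<in> D" "nonzero_hom S (top_obj d) (top_obj d')" "nonzero_hom S (top_obj d') (top_obj d)"
  shows "d = d'"
proof -
  obtain i j where "top_obj d = sh i (B d)" "top_obj d' = sh j (B d')" using D_E assms by metis
  then show ?thesis using assms hom_B_shift_B[of i d j d'] hom_B_shift_B[of j d' i d] D_subset by auto
qed

section \<open>The distinguished summand\<close>

text \<open>The coevaluation factors as \<open>s g\<close> through \<open>X\<close> and as \<open>s' g'\<close> through \<open>X'\<close>, so
  \<open>p' s g = g' \<noteq> 0\<close> for the projection \<open>p'\<close> onto \<open>X'\<close>.\<close>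

lemma nonzero_hom_between_unit_summands:
  assumes z: "z \<in> W" and r: "retract S X (R (B z) \<odot> B z)" "nonzero_hom S \<one> X"
    and r': "retract S X' (R (B z) \<odot> B z)" "nonzero_hom S \<one> X'"
  shows "nonzero_hom S X X'"
proof -
  let ?Y = "R (B z) \<odot> B z"
  obtain e c where d: "is_left_dual S (R (B z)) (B z) e c" using dual z B_obj by blast
  obtain s p where v: "retract_via S X ?Y s p" using r by (auto simp: retract_def)
  obtain s' p' where v': "retract_via S X' ?Y s' p'" using r' by (auto simp: retract_def)
  note vd = v[unfolded retract_via_def] v'[unfolded retract_via_def]
  obtain g where g: "g \<in> hom S \<one> X" "c = s \<cdot> g" using coev_factors[OF z d v r(2)] by blast
  obtain g' where g': "g' \<in> hom S \<one> X'" "g' \<noteq> 0" "c = s' \<cdot> g'" using coev_factors[OF z d v' r'(2)] by blast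
  have "(p' \<cdot> s) \<cdot> g = p' \<cdot> (s' \<cdot> g')"
    using cmp_assoc[of \<one> X ?Y X' g s p'] vd g g' by simp
  also have "\<dots> = g'" using retract_via_cancel[OF v' _ g'(1)] by simp
  finally have "p' \<cdot> s \<noteq> 0" using g' g vd cmp_zero_left[of \<one> X X' g] by auto
  moreover have "p' \<cdot> s \<in> hom S X X'" using vd cmp_in_hom[of X ?Y X'] by blast
  ultimately show ?thesis using vd by (auto simp: nonzero_hom_def)
qed

lemma unit_summand_is_top:
  assumes z: "z \<in> W" and X: "indecomposable S X" "retract S X (R (B z) \<odot> B z)" "nonzero_hom S \<one> X"
  shows "\<exists>d \<in> D. isomorphic S X (top_obj d)"
proof -
  obtain x i where x: "x \<in> W" "isomorphic S X (sh i (B x))" using classification[OF X(1)] by auto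
  obtain y where y: "y \<in> W" "isomorphic S (R (B z)) (B y)" using dual_B z by blast
  have "nonzero_hom S \<one> (sh i (B x))" using nonzero_hom_iso_right[OF X(3) x(2)] x by simp
  moreover have "retract S (sh i (B x)) (B y \<odot> B z)"
    using retract_iso_right[OF retract_iso_left[OF X(2) x(2)] isomorphic_ten[OF y(2) isomorphic_refl]] x y z by simp
  ultimately show ?thesis using D_I[OF x(1) _ y(1) z] x by metis
qed

text \<open>Otherwise every component of the coevaluation would vanish.\<close>

lemma decomposition_unit_summand:
  assumes z: "z \<in> W" and sum: "direct_sum S (R (B z) \<odot> B z) Xs i p"
  shows "\<exists>a < length Xs. nonzero_hom S \<one> (Xs ! a)"
proof (rule ccontr)
  let ?Y = "R (B z) \<odot> B z"
  assume none: "\<not> ?thesis"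
  obtain e c where d: "is_left_dual S (R (B z)) (B z) e c" using dual z B_obj by blast
  have c: "c \<in> hom S \<one> ?Y" "c \<noteq> 0" using d is_left_dual_nonzero[OF d B_nonzero[OF z]] by (auto simp: is_left_dual_def)
  have v: "retract_via S (Xs ! a) ?Y (i a) (p a)" if "a < length Xs" for a
    using direct_sum_retract_via[OF sum that] .
  have ipc: "(i a \<cdot> p a) \<cdot> c = 0" if a: "a < length Xs" for a
  proof -
    note vd = v[OF a, unfolded retract_via_def]
    have "p a \<cdot> c \<in> hom S \<one> (Xs ! a)" using vd c cmp_in_hom[of \<one> ?Y "Xs ! a"] by simp
    then have "p a \<cdot> c = 0" using none a vd by (auto simp: nonzero_hom_def)
    then show ?thesis
      using vd c cmp_assoc[of \<one> ?Y "Xs ! a" ?Y c "p a" "i a"] cmp_zero_right[of \<one> "Xs ! a" ?Y "i a"] by simp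
  qed
  have ip: "i a \<cdot> p a \<in> hom S ?Y ?Y" if "a < length Xs" for a
    using v[OF that] cmp_in_hom[of ?Y "Xs ! a" ?Y] by (simp add: retract_via_def)
  have "c = (\<Sum>a<length Xs. i a \<cdot> p a) \<cdot> c" using sum c z idm_cmp[of \<one> ?Y c] by (simp add: direct_sum_def)
  also have "\<dots> = (\<Sum>a<length Xs. (i a \<cdot> p a) \<cdot> c)" using c z ip by (intro cmp_sum_left[of \<one> ?Y ?Y]) auto
  also have "\<dots> = 0" using ipc by simp
  finally show False using c by simp
qed

lemma unique_top_summand:
  assumes z: "z \<in> W"
  shows "\<exists>!d. d \<in> D \<and> retract S (top_obj d) (R (B z) \<odot> B z)"
proof (rule ex_ex1I)
  obtain Xs i p where sum: "direct_sum S (R (B z) \<odot> B z) Xs i p" and ind: "\<forall>Z \<in> set Xs. indecomposable S Z"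
    using exists_indecomposable_decomposition[OF hom_finite, of "R (B z) \<odot> B z"] z by auto
  obtain a where a: "a < length Xs" "nonzero_hom S \<one> (Xs ! a)" using decomposition_unit_summand[OF z sum] by blast
  have r: "retract S (Xs ! a) (R (B z) \<odot> B z)" using direct_sum_retract_via[OF sum a(1)] by (auto simp: retract_def)
  obtain d where "d \<in> D" "isomorphic S (Xs ! a) (top_obj d)" using unit_summand_is_top[OF z _ r a(2)] ind a by auto
  moreover from this have "top_obj d \<in> obj S" using top_unit_nonzero_hom by (auto simp: nonzero_hom_def)
  ultimately show "\<exists>d. d \<in> D \<and> retract S (top_obj d) (R (B z) \<odot> B z)" using retract_iso_left[OF r] by blast
next
  fix d d' assume "d \<in> D \<and> retract S (top_obj d) (R (B z) \<odot> B z)" "d' \<in> D \<and> retract S (top_obj d') (R (B z) \<odot> B z)"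
  then show "d = d'"
    using nonzero_hom_between_unit_summands[OF z] top_unit_nonzero_hom top_hom_unique by metis
qed

text \<open>At most one term is isomorphic to \<open>B\<^sub>d\<langle>a(d)\<rangle>\<close>, since the coevaluation cannot factor through two
  orthogonal summands; and the summand through which it does factor is
  \<open>B\<^sub>d\<langle>a(d)\<rangle>\<close> as soon as that object is a summand at all.\<close>

lemma top_multiplicity:
  assumes d: "d \<in> D" and z: "z \<in> W" and sum: "direct_sum S (R (B z) \<odot> B z) Xs i p"
    and ind: "\<forall>Z \<in> set Xs. indecomposable S Z"
  shows "length (filter (\<lambda>Z. isomorphic S Z (top_obj d)) Xs) =
    (if retract S (top_obj d) (R (B z) \<odot> B z) then 1 else 0)"
proof -
  let ?Y = "R (B z) \<odot> B z"
  let ?I = "{a. a < length Xs \<and> isomorphic S (Xs ! a) (top_obj d)}"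
  have top: "top_obj d \<in> obj S" using d top_unit_nonzero_hom by (auto simp: nonzero_hom_def)
  have v: "retract_via S (Xs ! a) ?Y (i a) (p a)" if "a < length Xs" for a
    using direct_sum_retract_via[OF sum that] .
  have r: "retract S (Xs ! a) ?Y" "Xs ! a \<in> obj S" if "a < length Xs" for a
    using v[OF that] by (auto simp: retract_def retract_via_def)
  have nz: "nonzero_hom S \<one> (Xs ! a)" if "a \<in> ?I" for a
    using that nonzero_hom_iso_right[OF top_unit_nonzero_hom[OF d] isomorphic_sym] r by auto
  obtain e c where dd: "is_left_dual S (R (B z)) (B z) e c" using dual z B_obj by blast
  have atmost: "a = b" if a: "a \<in> ?I" and b: "b \<in> ?I" for a b
  proof (rule ccontr)
    assume "a \<noteq> b"
    have len: "a < length Xs" "b < length Xs" using a b by auto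
    note vd = v[OF len(1), unfolded retract_via_def] v[OF len(2), unfolded retract_via_def]
    obtain g where g: "g \<in> hom S \<one> (Xs ! a)" "c = i a \<cdot> g" using coev_factors[OF z dd v[OF len(1)] nz[OF a]] by blast
    obtain g' where g': "g' \<in> hom S \<one> (Xs ! b)" "g' \<noteq> 0" "c = i b \<cdot> g'"
      using coev_factors[OF z dd v[OF len(2)] nz[OF b]] by blast
    have "(p b \<cdot> i a) \<cdot> g = p b \<cdot> (i b \<cdot> g')"
      using cmp_assoc[of \<one> "Xs ! a" ?Y "Xs ! b" g "i a" "p b"] vd g g' by simp
    also have "\<dots> = g'" using retract_via_cancel[OF v[OF len(2)] _ g'(1)] by simp
    finally have "(p b \<cdot> i a) \<cdot> g = g'" .
    moreover have "p b \<cdot> i a = 0" using sum len \<open>a \<noteq> b\<close> by (simp add: direct_sum_def)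
    ultimately show False using g g' vd cmp_zero_left[of \<one> "Xs ! a" "Xs ! b" g] by simp
  qed
  have len: "length (filter (\<lambda>Z. isomorphic S Z (top_obj d)) Xs) = card ?I" by (rule length_filter_conv_card)
  show ?thesis
  proof (cases "retract S (top_obj d) ?Y")
    case True
    obtain a where a: "a < length Xs" "nonzero_hom S \<one> (Xs ! a)" using decomposition_unit_summand[OF z sum] by blast
    obtain d' where d': "d' \<in> D" "isomorphic S (Xs ! a) (top_obj d')"
      using unit_summand_is_top[OF z _ r(1)[OF a(1)] a(2)] ind a by auto
    have "top_obj d' \<in> obj S" using top_unit_nonzero_hom[OF d'(1)] by (auto simp: nonzero_hom_def)
    then have "retract S (top_obj d') ?Y" using retract_iso_left[OF r(1)[OF a(1)] d'(2)] by blast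
    then have "d' = d" using unique_top_summand[OF z] d d' True by blast
    then have "a \<in> ?I" using a d' by simp
    then have I: "?I = {a}" using atmost by blast
    show ?thesis unfolding len I using True by simp
  next
    case False
    then have I: "?I = {}" using retract_iso_left[OF r(1)] top by blast
    show ?thesis unfolding len I using False by simp
  qed
qed

lemma summand_multiplicity_top:
  assumes d: "d \<in> D" and z: "z \<in> W"
  shows "summand_multiplicity S (top_obj d) (R (B z) \<odot> B z) \<le> 1"
proof -
  let ?n = "if retract S (top_obj d) (R (B z) \<odot> B z) then 1 else 0 :: nat"
  obtain Xs i p where "direct_sum S (R (B z) \<odot> B z) Xs i p" "\<forall>Z \<in> set Xs. indecomposable S Z"
    using exists_indecomposable_decomposition[OF hom_finite, of "R (B z) \<odot> B z"] z by auto
  then have "summand_multiplicity S (top_obj d) (R (B z) \<odot> B z) = ?n"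
    unfolding summand_multiplicity_def using top_multiplicity[OF d z] by (intro the_equality) metis+
  then show ?thesis by simp
qed

lemma hom_dim_unit_top:
  assumes d: "d \<in> D"
  shows "hom_dim S \<one> (top_obj d) = 1"
proof -
  interpret vs: vector_space "scl S" by (rule ambient_vector_space)
  obtain i y z where yz: "y \<in> W" "z \<in> W" "top_obj d = sh i (B d)" "retract S (top_obj d) (B y \<odot> B z)"
    using D_E[OF d] by metis
  have "isomorphic S (B y) (R (B z))" using top_summand_dual d yz isomorphic_sym by blast
  then have "retract S (top_obj d) (R (B z) \<odot> B z)"
    using retract_iso_right[OF yz(4) isomorphic_ten[OF _ isomorphic_refl]] yz by simp
  then obtain s r where v: "retract_via S (top_obj d) (R (B z) \<odot> B z) s r" by (auto simp: retract_def)
  note vd = v[unfolded retract_via_def]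
  obtain e c where dd: "is_left_dual S (R (B z)) (B z) e c" using dual yz B_obj by blast
  obtain g where g: "g \<in> hom S \<one> (top_obj d)" "g \<noteq> 0" "c = s \<cdot> g"
    using coev_factors[OF yz(2) dd v top_unit_nonzero_hom[OF d]] by blast
  have "\<exists>t. h = scl S t g" if h: "h \<in> hom S \<one> (top_obj d)" for h
  proof -
    have "s \<cdot> h \<in> hom S \<one> (R (B z) \<odot> B z)" using vd h cmp_in_hom[OF unit_in_obj] by metis
    then obtain t where t: "s \<cdot> h = scl S t c" using coev_spans[OF yz(2) dd] by blast
    have "s \<cdot> g \<in> hom S \<one> (R (B z) \<odot> B z)" using vd g cmp_in_hom[OF unit_in_obj] by metis
    then have "r \<cdot> (s \<cdot> h) = scl S t (r \<cdot> (s \<cdot> g))"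
      using t g vd cmp_scl_right[of \<one> "R (B z) \<odot> B z" "top_obj d" "s \<cdot> g" r t] by simp
    then show ?thesis using retract_via_cancel[OF v _ h] retract_via_cancel[OF v _ g(1)] by auto
  qed
  moreover have "scl S t g \<in> hom S \<one> (top_obj d)" for t using g vd scl_in_hom[OF unit_in_obj _ g(1)] by blast
  ultimately have "hom S \<one> (top_obj d) = range (\<lambda>c. scl S c g)" by fast
  moreover obtain A where "finite A" "module.span (scl S) A = hom S \<one> (top_obj d)"
    using hom_finite[of \<one> "top_obj d"] vd by auto
  ultimately show ?thesis unfolding hom_dim_def using vs.dim_one_iff g by blast
qed

section \<open>Left cells\<close>

text \<open>Let \<open>\<iota>\<close> and \<open>\<pi>\<close> realize \<open>B\<^sub>y\<close> as a summand of \<open>Y \<otimes> B\<^sub>x\<close>.  The morphism \<open>(R B\<^sub>y \<otimes> \<iota>) c\<^sub>y\<close> from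
  \<open>1\<close> to \<open>(R B\<^sub>y \<otimes> Y) \<otimes> B\<^sub>x\<close> is the transpose \<open>(\<rho> \<otimes> B\<^sub>x) c\<^sub>x\<close> of some \<open>\<rho> : R B\<^sub>x \<rightarrow> R B\<^sub>y \<otimes> Y\<close>.
  Then \<open>\<phi> = (R B\<^sub>y \<otimes> \<pi>) (\<rho> \<otimes> B\<^sub>x)\<close> sends \<open>c\<^sub>x\<close> to \<open>(R B\<^sub>y \<otimes> \<pi> \<iota>) c\<^sub>y = c\<^sub>y\<close>.\<close>

lemma prec_left_coev:
  assumes x: "x \<in> W" and y: "y \<in> W" and prec: "prec_left S B x y"
    and dx: "is_left_dual S (R (B x)) (B x) ex cx" and dy: "is_left_dual S (R (B y)) (B y) ey cy"
  shows "\<exists>\<phi> \<in> hom S (R (B x) \<odot> B x) (R (B y) \<odot> B y). \<phi> \<cdot> cx = cy"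
proof -
  obtain Y where Y [simp]: "Y \<in> obj S" and "retract S (B y) (Y \<odot> B x)"
    using prec is_summand_iff_retract by (auto simp: prec_left_def)
  then obtain \<iota> \<pi> where v: "\<iota> \<in> hom S (B y) (Y \<odot> B x)" "\<pi> \<in> hom S (Y \<odot> B x) (B y)" "\<pi> \<cdot> \<iota> = idm S (B y)"
    by (auto simp: retract_def retract_via_def)
  note [simp] = B_obj[OF x] B_obj[OF y]
  have c: "cx \<in> hom S \<one> (R (B x) \<odot> B x)" "cy \<in> hom S \<one> (R (B y) \<odot> B y)" using dx dy by (auto simp: is_left_dual_def)
  define I where "I = Arrow (B y) \<iota> (Y \<odot> B x)"
  define P where "P = Arrow (Y \<odot> B x) \<pi> (B y)"
  define Cx where "Cx = Arrow \<one> cx (R (B x) \<odot> B x)"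
  define Cy where "Cy = Arrow \<one> cy (R (B y) \<odot> B y)"
  have I [simp]: "arr I" "src I = B y" "tgt I = Y \<odot> B x" unfolding I_def using v by (auto intro: arr_Arrow)
  have P [simp]: "arr P" "src P = Y \<odot> B x" "tgt P = B y" unfolding P_def using v by (auto intro: arr_Arrow)
  have Cx [simp]: "arr Cx" "src Cx = \<one>" "tgt Cx = R (B x) \<odot> B x" unfolding Cx_def using c by (auto intro: arr_Arrow)
  have Cy [simp]: "arr Cy" "src Cy = \<one>" "tgt Cy = R (B y) \<odot> B y" unfolding Cy_def using c by (auto intro: arr_Arrow)
  have PI: "P \<bullet> I = ide (B y)" using v by (simp add: P_def I_def arrow_cmp_def ide_def)
  let ?g = "asi (R (B y)) Y (B x) \<bullet> (ide (R (B y)) \<star> I) \<bullet> Cy"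
  have g: "arr ?g" "src ?g = \<one>" "tgt ?g = (R (B y) \<odot> Y) \<odot> B x" by simp_all
  then obtain \<rho> where \<rho>: "\<rho> \<in> hom S (R (B x)) (R (B y) \<odot> Y)" "mor ?g = (\<rho> \<otimes> idm S (B x)) \<cdot> cx"
    using transpose_surj[OF dx, of "R (B y) \<odot> Y" "mor ?g"] unfolding arr_def by auto
  define Rh where "Rh = Arrow (R (B x)) \<rho> (R (B y) \<odot> Y)"
  have Rh [simp]: "arr Rh" "src Rh = R (B x)" "tgt Rh = R (B y) \<odot> Y" unfolding Rh_def using \<rho> by (auto intro: arr_Arrow)
  have eq: "(Rh \<star> ide (B x)) \<bullet> Cx = ?g"
    using \<rho>(2) by (intro arrow.expand) (simp add: Rh_def Cx_def)
  let ?\<phi> = "(ide (R (B y)) \<star> P) \<bullet> as (R (B y)) Y (B x) \<bullet> (Rh \<star> ide (B x))"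
  have "?\<phi> \<bullet> Cx = (ide (R (B y)) \<star> P) \<bullet> as (R (B y)) Y (B x) \<bullet> ?g" by (simp add: eq)
  also have "\<dots> = (ide (R (B y)) \<star> P) \<bullet> (ide (R (B y)) \<star> I) \<bullet> Cy"
    by (simp add: arrow_inverse_cancel(2)[OF as_inverse])
  also have "\<dots> = Cy" by (simp add: interchange_cmp PI)
  finally have "mor (?\<phi> \<bullet> Cx) = mor Cy" by (rule arg_cong)
  then have "mor ?\<phi> \<cdot> cx = cy" by (simp only: arrow_cmp_simps(3)) (simp add: Cx_def Cy_def)
  moreover have "arr ?\<phi>" "src ?\<phi> = R (B x) \<odot> B x" "tgt ?\<phi> = R (B y) \<odot> B y" by simp_all
  then have "mor ?\<phi> \<in> hom S (R (B x) \<odot> B x) (R (B y) \<odot> B y)" unfolding arr_def by metis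
  ultimately show ?thesis by blast
qed

lemma prec_left_top_nonzero_hom:
  assumes x: "x \<in> W" and y: "y \<in> W" and prec: "prec_left S B x y"
    and X: "retract S X (R (B x) \<odot> B x)" "nonzero_hom S \<one> X"
    and X': "retract S X' (R (B y) \<odot> B y)" "nonzero_hom S \<one> X'"
  shows "nonzero_hom S X X'"
proof -
  let ?Y = "R (B x) \<odot> B x" and ?Y' = "R (B y) \<odot> B y"
  obtain e c where d: "is_left_dual S (R (B x)) (B x) e c" using dual x B_obj by blast
  obtain e' c' where d': "is_left_dual S (R (B y)) (B y) e' c'" using dual y B_obj by blast
  obtain \<phi> where \<phi>: "\<phi> \<in> hom S ?Y ?Y'" "\<phi> \<cdot> c = c'" using prec_left_coev[OF x y prec d d'] by blast
  obtain s p where v: "retract_via S X ?Y s p" using X by (auto simp: retract_def)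
  obtain s' p' where v': "retract_via S X' ?Y' s' p'" using X' by (auto simp: retract_def)
  note vd = v[unfolded retract_via_def] v'[unfolded retract_via_def]
  obtain g where g: "g \<in> hom S \<one> X" "c = s \<cdot> g" using coev_factors[OF x d v X(2)] by blast
  obtain g' where g': "g' \<in> hom S \<one> X'" "g' \<noteq> 0" "c' = s' \<cdot> g'" using coev_factors[OF y d' v' X'(2)] by blast
  have ps: "p' \<cdot> \<phi> \<in> hom S ?Y X'" "(p' \<cdot> \<phi>) \<cdot> s \<in> hom S X X'" using vd \<phi> cmp_in_hom by metis+
  have c: "c \<in> hom S \<one> ?Y" using d by (simp add: is_left_dual_def)
  have "((p' \<cdot> \<phi>) \<cdot> s) \<cdot> g = (p' \<cdot> \<phi>) \<cdot> c"
    using cmp_assoc[of \<one> X ?Y X' g s "p' \<cdot> \<phi>"] vd g ps by simp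
  also have "\<dots> = p' \<cdot> (s' \<cdot> g')"
    using cmp_assoc[of \<one> ?Y ?Y' X' c \<phi> p'] vd c \<phi> g' by simp
  also have "\<dots> = g'" using retract_via_cancel[OF v' _ g'(1)] by simp
  finally have "(p' \<cdot> \<phi>) \<cdot> s \<noteq> 0" using g' g vd cmp_zero_left[of \<one> X X' g] by auto
  then show ?thesis using ps vd by (auto simp: nonzero_hom_def)
qed

text \<open>The first relation only needs a shift.  For the second, the coevaluation is \<open>s g\<close> with
  \<open>s : B\<^sub>d\<langle>a(d)\<rangle> \<rightarrow> R B\<^sub>z \<otimes> B\<^sub>z\<close>; substituted into the zigzag identity of \<open>B\<^sub>z\<close>, this factors the
  identity of \<open>B\<^sub>z\<close> through \<open>B\<^sub>z \<otimes> B\<^sub>d\<langle>a(d)\<rangle> \<simeq> B\<^sub>z\<langle>a(d)\<rangle> \<otimes> B\<^sub>d\<close>.\<close>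

lemma prec_left_top:
  assumes z: "z \<in> W" and d: "d \<in> D" and r: "retract S (top_obj d) (R (B z) \<odot> B z)"
  shows "prec_left S B z d" "prec_left S B d z"
proof -
  obtain i where i: "top_obj d = sh i (B d)" using D_E[OF d] by metis
  note [simp] = B_obj[OF z] B_obj[OF D_subset[OF d]]
  have "retract S (sh (- i) (sh i (B d))) (sh (- i) (R (B z) \<odot> B z))" using r i by (simp add: shift_retract)
  then have "retract S (B d) (sh (- i) (R (B z) \<odot> B z))"
    using retract_iso_left[OF _ shift_shift[of "B d" "- i" i]] by simp
  then have "retract S (B d) (sh (- i) (R (B z)) \<odot> B z)"
    using retract_iso_right isomorphic_sym[OF shift_ten[of "R (B z)" "B z" "- i"]] by simp
  then show "prec_left S B z d"
    unfolding prec_left_def is_summand_iff_retract by (intro bexI[of _ "sh (- i) (R (B z))"]) simp_all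
  let ?X = "top_obj d"
  have X [simp]: "?X \<in> obj S" by (simp add: i)
  obtain s p where v: "retract_via S ?X (R (B z) \<odot> B z) s p" using r by (auto simp: retract_def)
  obtain e c where dd: "is_left_dual S (R (B z)) (B z) e c" using dual[of "B z"] by auto
  obtain g where g: "g \<in> hom S \<one> ?X" "c = s \<cdot> g" using coev_factors[OF z dd v top_unit_nonzero_hom[OF d]] by blast
  define E where "E = Arrow (B z \<odot> R (B z)) e \<one>"
  define Gg where "Gg = Arrow \<one> g ?X"
  define Ss where "Ss = Arrow ?X s (R (B z) \<odot> B z)"
  have E [simp]: "arr E" "src E = B z \<odot> R (B z)" "tgt E = \<one>" unfolding E_def using dd by (auto intro: arr_Arrow simp: is_left_dual_def)
  have Gg [simp]: "arr Gg" "src Gg = \<one>" "tgt Gg = ?X" unfolding Gg_def using g by (auto intro: arr_Arrow)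
  have Ss [simp]: "arr Ss" "src Ss = ?X" "tgt Ss = R (B z) \<odot> B z" unfolding Ss_def using v by (auto intro: arr_Arrow simp: retract_via_def)
  have "Arrow \<one> c (R (B z) \<odot> B z) = Ss \<bullet> Gg" using g by (simp add: Ss_def Gg_def arrow_cmp_def)
  then have "lu (B z) \<bullet> (E \<star> ide (B z)) \<bullet> asi (B z) (R (B z)) (B z) \<bullet> (ide (B z) \<star> (Ss \<bullet> Gg)) \<bullet> rui (B z) = ide (B z)"
    using arrow_zigzag[OF dd] by (simp add: E_def)
  moreover have "(ide (B z) \<star> (Ss \<bullet> Gg)) = (ide (B z) \<star> Ss) \<bullet> (ide (B z) \<star> Gg)" by (simp add: interchange)
  moreover define p1 where "p1 = lu (B z) \<bullet> (E \<star> ide (B z)) \<bullet> asi (B z) (R (B z)) (B z) \<bullet> (ide (B z) \<star> Ss)"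
  moreover define s1 where "s1 = (ide (B z) \<star> Gg) \<bullet> rui (B z)"
  ultimately have "p1 \<bullet> s1 = ide (B z)" by simp
  then have "mor (p1 \<bullet> s1) = mor (ide (B z))" by (rule arg_cong)
  then have "mor p1 \<cdot> mor s1 = idm S (B z)" by (simp only: arrow_cmp_simps ide_simps)
  moreover have "arr p1" "src p1 = B z \<odot> ?X" "tgt p1 = B z" by (simp_all add: p1_def)
  moreover have "arr s1" "src s1 = B z" "tgt s1 = B z \<odot> ?X" by (simp_all add: s1_def)
  ultimately have "retract_via S (B z) (B z \<odot> ?X) (mor s1) (mor p1)"
    unfolding retract_via_def arr_def by metis
  then have "retract S (B z) (B z \<odot> sh i (B d))" by (auto simp: retract_def i)
  then have "retract S (B z) (sh i (B z \<odot> B d))" using retract_iso_right ten_shift[of "B z" "B d" i] by simp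
  then have "retract S (B z) (sh i (B z) \<odot> B d)"
    using retract_iso_right isomorphic_sym[OF shift_ten[of "B z" "B d" i]] by simp
  then show "prec_left S B d z"
    unfolding prec_left_def is_summand_iff_retract by (intro bexI[of _ "sh i (B z)"]) simp_all
qed

text \<open>The element of \<open>\<D>\<close> attached to a member of the cell does not depend on the member, and it lies
  in the cell.  An arbitrary \<open>d' \<in> \<D>\<close> in the cell is attached to some \<open>z\<close>, which belongs to the
  same cell by \<open>prec_left_top\<close>; hence \<open>d'\<close> is attached to itself as well.\<close>

lemma left_cell_top:
  assumes "\<Gamma> \<in> left_cells S W B"
  shows "\<exists>d. \<Gamma> \<inter> D = {d} \<and> (\<forall>z \<in> \<Gamma>. retract S (top_obj d) (R (B z) \<odot> B z))"
proof -
  obtain x where x: "x \<in> W" and \<Gamma>: "\<Gamma> = {y \<in> W. prec_left S B x y \<and> prec_left S B y x}"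
    using assms by (auto simp: left_cells_def quotient_def)
  obtain d where d: "d \<in> D" "retract S (top_obj d) (R (B x) \<odot> B x)" using unique_top_summand[OF x] by blast
  have same: "d' = d" if z: "z \<in> \<Gamma>" and d': "d' \<in> D" "retract S (top_obj d') (R (B z) \<odot> B z)" for z d'
    using z d d' x prec_left_top_nonzero_hom top_unit_nonzero_hom top_hom_unique unfolding \<Gamma> by blast
  have summand: "retract S (top_obj d) (R (B z) \<odot> B z)" if z: "z \<in> \<Gamma>" for z
    using unique_top_summand[of z] same[OF z] z unfolding \<Gamma> by blast
  have "d \<in> \<Gamma>" using prec_left_top[OF x d] D_subset[OF d(1)] unfolding \<Gamma> by simp
  moreover have "d' = d" if d': "d' \<in> \<Gamma>" "d' \<in> D" for d'
  proof -
    obtain i y z where yz: "y \<in> W" "z \<in> W" "retract S (top_obj d') (B y \<odot> B z)" using D_E[OF d'(2)] by metis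
    have "isomorphic S (B y) (R (B z))" using top_summand_dual d' yz isomorphic_sym by blast
    then have r: "retract S (top_obj d') (R (B z) \<odot> B z)"
      using retract_iso_right[OF yz(3) isomorphic_ten[OF _ isomorphic_refl]] yz by simp
    obtain d'' where d'': "d'' \<in> D" "retract S (top_obj d'') (R (B d') \<odot> B d')"
      using unique_top_summand[OF D_subset[OF d'(2)]] by blast
    have "d'' = d'"
      using prec_left_top[OF yz(2) d'(2) r] d' d'' r yz D_subset prec_left_top_nonzero_hom
        top_unit_nonzero_hom top_hom_unique by metis
    then show ?thesis using same[OF d'(1) d''] by simp
  qed
  ultimately show ?thesis using d summand by blast
qed

lemma left_cell_coev_factors:
  assumes "\<Gamma> \<in> left_cells S W B" "\<Gamma> \<inter> D = {d}" "z \<in> \<Gamma>" "is_left_dual S (R (B z)) (B z) e c"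
  shows "factors_through_summand S \<one> (R (B z) \<odot> B z) c (top_obj d)"
proof -
  obtain d' where "\<Gamma> \<inter> D = {d'}" "\<forall>z \<in> \<Gamma>. retract S (top_obj d') (R (B z) \<odot> B z)"
    using left_cell_top[OF assms(1)] by blast
  then have r: "retract S (top_obj d) (R (B z) \<odot> B z)" using assms by auto
  have z: "z \<in> W" using assms by (auto simp: left_cells_def quotient_def)
  have d: "d \<in> D" using assms by blast
  have "\<exists>g \<in> hom S \<one> (top_obj d). c = i 0 \<cdot> g"
    if "direct_sum S (R (B z) \<odot> B z) [top_obj d, C] i p" for C i p
    using coev_factors[OF z assms(4) _ top_unit_nonzero_hom[OF d]] direct_sum_retract_via[OF that, of 0] by auto
  then show ?thesis using r by (auto simp: factors_through_summand_def is_summand_iff_retract)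
qed

end

section \<open>Right cells\<close>

lemma reverse_cell_data [simp]:
  fixes S :: "('o, 'm::ab_group_add, 'k::field, 'z) moncat_scheme"
  shows "a_fun (reverse S) T W B = a_fun S T W B" "Delta (reverse S) T B = Delta S T B"
  "D_set (reverse S) T W B = D_set S T W B" "top_shift (reverse S) T W B = top_shift S T W B"
  "left_cells (reverse S) W B = right_cells S W B"
  "factors_through_summand (reverse S) = factors_through_summand S"
proof -
  show a: "a_fun (reverse S) T W B = a_fun S T W B"
    unfolding a_fun_def by (intro ext arg_cong[of _ _ Sup] image_cong) auto
  show Delta: "Delta (reverse S) T B = Delta S T B" by (simp add: Delta_def fun_eq_iff)
  show "D_set (reverse S) T W B = D_set S T W B" by (simp add: D_set_def a Delta)
  show "top_shift (reverse S) T W B = top_shift S T W B" by (simp add: top_shift_def a fun_eq_iff)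
  show "left_cells (reverse S) W B = right_cells S W B"
    by (simp add: left_cells_def right_cells_def prec_left_def prec_right_def)
  show "factors_through_summand (reverse S) = factors_through_summand S"
    by (simp add: factors_through_summand_def fun_eq_iff)
qed

theorem theoremA2p5:
  fixes S :: "('o, 'm::ab_group_add, 'k::field) rigidcat"
    and T :: "('o, 'm) autoequiv"
    and W :: "'w set"
    and B :: "'w \<Rightarrow> 'o"
  assumes "pseudo_tensor_category S"
    and "bimodule_autoequivalence S T"
    and indecomposables: "\<And>x. x \<in> W \<Longrightarrow> indecomposable S (B x)"
    and dual_closed: "\<And>x. x \<in> W \<Longrightarrow>
          (\<exists>y \<in> W. isomorphic S (ldual S (B x)) (B y)) \<and> (\<exists>y \<in> W. isomorphic S (rdual S (B x)) (B y))"
    and classification: "\<And>X. indecomposable S X \<Longrightarrow>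
          \<exists>!(x, i). x \<in> W \<and> isomorphic S X (shift T i (B x))"
    and orthogonality: "\<And>x y i. \<lbrakk>x \<in> W; y \<in> W; i \<le> 0\<rbrakk> \<Longrightarrow>
          hom_dim S (B x) (shift T i (B y)) = (if x = y \<and> i = 0 then 1 else 0)"
  shows "
      (\<forall>d \<in> D_set S T W B. \<forall>y \<in> W. \<forall>z \<in> W.
          is_summand S (top_shift S T W B d) (B y \<odot>\<^bsub>S\<^esub> B z) \<longrightarrow> y = rstar S W B z)
    \<and>
      (\<forall>z \<in> W. \<exists>!d. d \<in> D_set S T W B \<and>
          is_summand S (top_shift S T W B d) (rdual S (B z) \<odot>\<^bsub>S\<^esub> B z))
    \<and>
      (\<forall>d \<in> D_set S T W B.
          (\<forall>z \<in> W. summand_multiplicity S (top_shift S T W B d) (rdual S (B z) \<odot>\<^bsub>S\<^esub> B z) \<le> 1) \<and>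
          hom_dim S \<one>\<^bsub>S\<^esub> (top_shift S T W B d) = 1)
    \<and>
      (\<forall>\<Gamma> \<in> left_cells S W B. \<exists>d. \<Gamma> \<inter> D_set S T W B = {d} \<and>
          (\<forall>z \<in> \<Gamma>. is_summand S (top_shift S T W B d) (rdual S (B z) \<odot>\<^bsub>S\<^esub> B z)))
    \<and>
      (\<forall>P \<in> right_cells S W B. \<exists>d. P \<inter> D_set S T W B = {d} \<and>
          (\<forall>y \<in> P. is_summand S (top_shift S T W B d) (B y \<odot>\<^bsub>S\<^esub> ldual S (B y))))
    \<and>
      (\<forall>P \<in> right_cells S W B. \<forall>d. P \<inter> D_set S T W B = {d} \<longrightarrow>
          (\<forall>y \<in> P. factors_through_summand S \<one>\<^bsub>S\<^esub> (B y \<odot>\<^bsub>S\<^esub> ldual S (B y)) (co S (B y))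
             (top_shift S T W B d)))"
proof -
  interpret pseudo_tensor_category S by fact
  have grS: "graded_monoidal_category S T"
    by (rule bimodule_autoequivalence.graded_monoidal_category) fact
  have rdual_B: "\<exists>y \<in> W. isomorphic S (rdual S (B x)) (B y)"
    and ldual_B: "\<exists>y \<in> W. isomorphic S (ldual S (B x)) (B y)" if "x \<in> W" for x
    using dual_closed[OF that] by auto
  interpret l: cell_setting S T W B "rdual S"
    by (intro cell_setting.intro cell_setting_axioms.intro)
      (fact grS idempotent_complete hom_finite_dim end_unit right_dual indecomposables rdual_B
        classification orthogonality)+
  interpret r: cell_setting "reverse S" T W B "ldual S"
  proof (intro cell_setting.intro cell_setting_axioms.intro)
    show "graded_monoidal_category (reverse S) T"
      by (rule l.reverse_graded_monoidal_category)
    show "\<exists>e c. is_left_dual (reverse S) (ldual S X) X e c" if "X \<in> obj (reverse S)" for X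
      using reverse_is_left_dual[OF left_dual[of X]] that by auto
    show "\<exists>!(x, i). x \<in> W \<and> isomorphic (reverse S) X (shift T i (B x))" if "indecomposable (reverse S) X" for X
      using classification[of X] that by simp
  qed (use idempotent_complete hom_finite_dim end_unit indecomposables ldual_B orthogonality in simp_all)
  have rstar: "y = rstar S W B z" if "isomorphic S (rdual S (B z)) (B y)" "y \<in> W" "z \<in> W" for y z
  proof -
    have uniq: "w = y" if w: "w \<in> W" "isomorphic S (rdual S (B z)) (B w)" for w
    proof -
      have "isomorphic S (B y) (shift T 0 (B w))"
        using that \<open>isomorphic S (rdual S (B z)) (B y)\<close> \<open>y \<in> W\<close> \<open>z \<in> W\<close>
          isomorphic_trans[OF isomorphic_sym, of "rdual S (B z)" "B y" "B w"] by simp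
      moreover have "isomorphic S (B y) (shift T 0 (B y))" using \<open>y \<in> W\<close> by (simp add: isomorphic_refl)
      ultimately show ?thesis using classification[OF indecomposables[OF \<open>y \<in> W\<close>]] w \<open>y \<in> W\<close> by blast
    qed
    show ?thesis
      unfolding rstar_def by (rule the_equality[symmetric], rule conjI[OF that(2,1)], elim conjE, rule uniq)
  qed
  show ?thesis
  proof (intro conjI ballI allI impI)
    fix d y z assume "d \<in> D_set S T W B" "y \<in> W" "z \<in> W" "is_summand S (top_shift S T W B d) (B y \<odot>\<^bsub>S\<^esub> B z)"
    then show "y = rstar S W B z" using rstar l.top_summand_dual l.is_summand_iff_retract by blast
  next
    fix z assume "z \<in> W"
    then show "\<exists>!d. d \<in> D_set S T W B \<and> is_summand S (top_shift S T W B d) (rdual S (B z) \<odot>\<^bsub>S\<^esub> B z)"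
      using l.unique_top_summand l.is_summand_iff_retract by simp
  next
    fix d z assume "d \<in> D_set S T W B" "z \<in> W"
    then show "summand_multiplicity S (top_shift S T W B d) (rdual S (B z) \<odot>\<^bsub>S\<^esub> B z) \<le> 1"
      by (rule l.summand_multiplicity_top)
  next
    fix d assume "d \<in> D_set S T W B"
    then show "hom_dim S \<one>\<^bsub>S\<^esub> (top_shift S T W B d) = 1" by (rule l.hom_dim_unit_top)
  next
    fix \<Gamma> assume "\<Gamma> \<in> left_cells S W B"
    then show "\<exists>d. \<Gamma> \<inter> D_set S T W B = {d} \<and>
        (\<forall>z \<in> \<Gamma>. is_summand S (top_shift S T W B d) (rdual S (B z) \<odot>\<^bsub>S\<^esub> B z))"
      using l.left_cell_top l.is_summand_iff_retract by simp
  next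
    fix P assume "P \<in> right_cells S W B"
    then show "\<exists>d. P \<inter> D_set S T W B = {d} \<and>
        (\<forall>y \<in> P. is_summand S (top_shift S T W B d) (B y \<odot>\<^bsub>S\<^esub> ldual S (B y)))"
      using r.left_cell_top[of P] l.is_summand_iff_retract by simp
  next
    fix P d y assume P: "P \<in> right_cells S W B" "P \<inter> D_set S T W B = {d}" "y \<in> P"
    then have "y \<in> W" by (auto simp: right_cells_def quotient_def)
    then have "is_left_dual (reverse S) (ldual S (B y)) (B y) (ev S (B y)) (co S (B y))"
      using reverse_is_left_dual[OF left_dual] by simp
    then show "factors_through_summand S \<one>\<^bsub>S\<^esub> (B y \<odot>\<^bsub>S\<^esub> ldual S (B y)) (co S (B y)) (top_shift S T W B d)"
      using r.left_cell_coev_factors[of P d y] P by simp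
  qed
qed

end
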